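(* For $m\in\mathbb{N}$ let $\gamma^\sharp(L^m_\infty(\mathbb{R}))$ denote the infimum of all constants $\gamma$ such that the inequality $$\|f\|_{L^m_\infty(\mathbb{R})|_E}\le\gamma\,\sup_{S\subset E,\ \#S=m+1}\|f|_S\|_{L^m_\infty(\mathbb{R})|_S}$$ holds for every closed set $E\subset\mathbb{R}$ with $\#E\ge m+1$ and every $f\in L^m_\infty(\mathbb{R})|_E$. Then: (i) $\gamma^\sharp(L^1_\infty(\mathbb{R}))=1$ and $\gamma^\sharp(L^2_\infty(\mathbb{R}))=2$; (ii) for every $m\in\mathbb{N}$ with $m>2$, $$\left(\frac{\pi}{2}\right)^{m-1}<\gamma^\sharp(L^m_\infty(\mathbb{R}))<(m-1)\,9^m.$$
   Context: $L^m_\infty(\mathbb{R})$ is the space of all functions $F:\mathbb{R}\to\mathbb{R}$ such that $F^{(m-1)}$ is absolutely continuous on $\mathbb{R}$ and $F^{(m)}\in L_\infty(\mathbb{R})$, with seminorm $\|F\|_{L^m_\infty(\mathbb{R})}=\|F^{(m)}\|_{L_\infty(\mathbb{R})}$. For a closed set $E$, the trace space $L^m_\infty(\mathbb{R})|_E$ consists of all $f:E\to\mathbb{R}$ that are restrictions of functions in $L^m_\infty(\mathbb{R})$, with seminorm $\|f\|_{L^m_\infty(\mathbb{R})|_E}=\inf\{\|F\|_{L^m_\infty(\mathbb{R})}:F\in L^m_\infty(\mathbb{R}),\ F|_E=f\}$. *)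

theory Defs
  imports "HOL-Probability.Essential_Supremum"
begin

definition absolutely_continuous_real :: "(real \<Rightarrow> real) \<Rightarrow> bool" where
  "absolutely_continuous_real g \<longleftrightarrow>
     (\<forall>\<epsilon>>0. \<exists>\<delta>>0. \<forall>(n::nat) a b.
        (\<forall>i<n. a i \<le> b i) \<and> disjoint_family_on (\<lambda>i. {a i<..<b i}) {..<n} \<and>
        (\<Sum>i<n. b i - a i) < \<delta> \<longrightarrow> (\<Sum>i<n. \<bar>g (b i) - g (a i)\<bar>) < \<epsilon>)"

text \<open>
  The derivative of order \<open>m\<close> is only defined almost everywhere. Where \<open>(deriv ^^ (m - 1)) F\<close> is
  not differentiable, \<^term>\<open>deriv\<close> returns an unspecified value, the same one at all such points.
  These points form a null set for \<open>F\<close> in \<open>L_inf m\<close>, so the value does not affect the essential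
  supremum. As \<^term>\<open>esssup\<close> is infinite on non-measurable functions, its finiteness in \<open>L_inf\<close>
  includes measurability.
\<close>

definition L_inf_seminorm :: "nat \<Rightarrow> (real \<Rightarrow> real) \<Rightarrow> ereal" where
  "L_inf_seminorm m F = esssup lebesgue (\<lambda>x. ereal \<bar>(deriv ^^ m) F x\<bar>)"

text \<open>Intended for \<open>m \<ge> 1\<close>.\<close>

definition L_inf :: "nat \<Rightarrow> (real \<Rightarrow> real) set" where
  "L_inf m = {F. (\<forall>k < m - 1. \<forall>x. (deriv ^^ k) F differentiable at x) \<and>
                 absolutely_continuous_real ((deriv ^^ (m - 1)) F) \<and>
                 L_inf_seminorm m F < \<infinity>}"

text \<open>
  A function on \<open>E\<close> is represented by a total function of which only the values on \<open>E\<close> matter, so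
  the restriction of \<open>f\<close> to \<open>S \<subseteq> E\<close> is represented by \<open>f\<close> itself.
\<close>

definition L_inf_trace :: "nat \<Rightarrow> real set \<Rightarrow> (real \<Rightarrow> real) set" where
  "L_inf_trace m E = {f. \<exists>F\<in>L_inf m. \<forall>x\<in>E. F x = f x}"

definition trace_seminorm :: "nat \<Rightarrow> real set \<Rightarrow> (real \<Rightarrow> real) \<Rightarrow> ereal" where
  "trace_seminorm m E f = Inf {L_inf_seminorm m F | F. F \<in> L_inf m \<and> (\<forall>x\<in>E. F x = f x)}"

definition finiteness_constant :: "nat \<Rightarrow> real \<Rightarrow> bool" where
  "finiteness_constant m \<gamma> \<longleftrightarrow>
     (\<forall>E. closed E \<and> (infinite E \<or> m + 1 \<le> card E) \<longrightarrow>
       (\<forall>f\<in>L_inf_trace m E.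
          trace_seminorm m E f
            \<le> ereal \<gamma> * (SUP S\<in>{S. S \<subseteq> E \<and> card S = m + 1}. trace_seminorm m S f)))"

text \<open>The infimum is taken in \<^typ>\<open>ereal\<close>, so it is \<open>\<infinity>\<close> if no constant is admissible.\<close>

definition gamma_sharp :: "nat \<Rightarrow> ereal" where
  "gamma_sharp m = Inf {ereal \<gamma> | \<gamma>. finiteness_constant m \<gamma>}"

end

theory Submission
  imports Defs "HOL-Library.Diagonal_Subsequence"
begin

text \<open>
  An absolutely continuous function is differentiable almost everywhere and is recovered from its
  derivative, so a function is in \<open>L_inf m\<close> with seminorm at most \<open>C\<close> iff its derivative of order
  \<open>m - 1\<close> is \<open>C\<close>-Lipschitz. By Rolle's theorem the trace seminorm on \<open>m + 1\<close> points is \<open>m!\<close> times the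
  modulus of the divided difference.

  Upper bound: by compactness it suffices to extend from finite sets \<open>t\<^sub>0 < \<dots> < t\<^sub>N\<close>. With \<open>P\<^sub>i\<close> the
  polynomial interpolating at \<open>m\<close> consecutive points starting with \<open>t\<^sub>i\<close>, the difference of \<open>P\<^sub>i\<close> and its
  successor is a divided difference times \<open>\<Prod>\<^sub>0\<^sub><\<^sub>l\<^sub><\<^sub>m (x - t\<^sub>i\<^sub>+\<^sub>l)\<close>; switching from each \<open>P\<^sub>i\<close> to its successor
  with a smooth step supported between \<open>t\<^sub>i\<close> and \<open>t\<^sub>i\<^sub>+\<^sub>m\<close> gives the extension (de Boor), and Leibniz' rule bounds
  its derivative of order \<open>m\<close>. For \<open>m = 1, 2\<close> optimal steps replace the smooth ones.

  Lower bound: take \<open>E = \<int>\<close> and \<open>f i = (-1)^i\<close>, whose divided differences on \<open>m + 1\<close> points are at most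
  \<open>2 ^ m / m!\<close>. Averaging over integer translations turns an extension into one with \<open>F (x + 1) = - F x\<close>,
  and for such functions Wirtinger's inequality bounds \<open>F\<close> by its derivative of order \<open>m\<close>.
\<close>

section \<open>Absolutely continuous functions\<close>

text \<open>At the nodes strictly between \<open>t\<^sub>i\<close> and
  \<open>t\<^sub>i\<^sub>+\<^sub>m\<close> the difference of successive interpolants vanishes, so
  the value of a step is free there and the step may use the whole length
  \<open>t\<^sub>i\<^sub>+\<^sub>m - t\<^sub>i\<close>. This length is also a factor of that
  difference, and it cancels the negative power left by differentiation, so no bound depends on the
  spacing of the nodes. Of the 9, one factor 3 comes from the binomial sum of the powers of 2 that
  differencing a step costs; the other bounds \<open>21 / 20 * exp 1\<close>, where
  \<open>21 / 20\<close> is the price of smoothing the step. In the lower bound every order gains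
  \<open>pi\<close> from Wirtinger's inequality and loses 2 to the divided differences, so the
  result hinges on a constant: the estimates at both ends of the chain must be good enough to leave
  \<open>2 * pi < sqrt 48\<close>. The obstacle throughout is that the derivative of order
  \<open>m\<close> exists only almost everywhere; both bounds are therefore argued with Lipschitz
  constants of the derivative of order \<open>m - 1\<close>.\<close>

definition incr :: "(real \<Rightarrow> real) \<Rightarrow> real set \<Rightarrow> real" where
  "incr g K = g (Sup K) - g (Inf K)"

lemma incr_Icc [simp]: "a \<le> b \<Longrightarrow> incr g {a..b} = g b - g a"
  by (simp add: incr_def)

lemma incr_division:
  fixes a b :: real
  assumes "a \<le> b" and "r division_of {a..b}"
  shows "(\<Sum>K\<in>r. incr g K) = g b - g a"
proof -
  \<comment> \<open>Additivity over divisions holds for operative functions, which must vanish on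
    the empty set, hence the conditional; members of a division are nonempty, so it disappears in
    the sum.\<close>
  let ?f = "(\<lambda>K::real set. if K = {} then 0 else g(interval_upperbound K) - g(interval_lowerbound K))"
  interpret operative_real plus 0 ?f
    rewrites "comm_monoid_set.F (+) 0 = sum"
    by standard[1] (auto simp add: sum_def)
  note d = assms(2)
  have "?f {a..b} = sum ?f r" using division[of r a b] assms(2) by simp
  moreover have "sum ?f r = (\<Sum>K\<in>r. incr g K)"
    using division_ofD(3)[OF d] by (intro sum.cong) (auto simp: incr_def interval_upperbound_real interval_lowerbound_real)
  ultimately show ?thesis using assms by auto
qed

section \<open>Finite families of intervals and Vitali coverings\<close>

definition intervals :: "real set set \<Rightarrow> bool" where
  "intervals P \<longleftrightarrow> finite P \<and> (\<forall>K\<in>P. \<exists>u v. u < v \<and> K = {u..v}) \<and>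
     (\<forall>K\<in>P. \<forall>J\<in>P. K \<noteq> J \<longrightarrow> interior K \<inter> interior J = {})"

lemma intervalsE:
  assumes "intervals P" "K \<in> P"
  obtains u v where "u < v" "K = {u..v}"
proof -
  have "\<forall>K\<in>P. \<exists>u v. u < v \<and> K = {u..v}" using assms(1) by (simp add: intervals_def)
  from bspec[OF this assms(2)] show ?thesis using that by (elim exE conjE)
qed

lemma intervals_subset: "intervals P \<Longrightarrow> Q \<subseteq> P \<Longrightarrow> intervals Q"
  unfolding intervals_def by (meson finite_subset subsetD)

lemma intervals_measure:
  assumes "intervals P"
  shows "(\<Sum>K\<in>P. incr (\<lambda>x. x) K) = measure lebesgue (\<Union>P)" "\<Union>P \<in> lmeasurable"
proof -
  have d: "P division_of \<Union>P"
    using assms unfolding intervals_def division_of_def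
    by (metis Union_upper atLeastatMost_empty_iff box_real(2) less_le_not_le)
  have "measure lebesgue (\<Union>P) = sum (measure lebesgue) P"
    using content_division[OF d] by simp
  also have "\<dots> = (\<Sum>K\<in>P. incr (\<lambda>x. x) K)"
    using assms by (intro sum.cong) (auto simp: intervals_def)
  finally show "(\<Sum>K\<in>P. incr (\<lambda>x. x) K) = measure lebesgue (\<Union>P)" by simp
  show "\<Union>P \<in> lmeasurable" using d lmeasurable_division by blast
qed

text \<open>A partial division extends to a division of the whole interval. The gaps
  \<open>G\<close> do not depend on \<open>g\<close>, so one family serves both for increments of a
  function and, with the identity map, for lengths.\<close>

lemma fill_gaps:
  assumes Q: "intervals Q" and sub: "\<Union>Q \<subseteq> {a..b}" and ab: "a < b"
  obtains G where "intervals G" "\<Union>G \<subseteq> {a..b}"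
    "\<And>g. incr g {a..b} = (\<Sum>K\<in>Q. incr g K) + (\<Sum>K\<in>G. incr g K)"
proof -
  have d: "Q division_of \<Union>Q"
    using Q unfolding intervals_def division_of_def
    by (metis Union_upper atLeastatMost_empty_iff box_real(2) less_le_not_le)
  have d2: "{{a..b}} division_of {a..b}"
    using ab division_of_self[of a b] by simp
  obtain r where r: "Q \<subseteq> r" "r division_of {a..b}"
    using partial_division_extend[OF d d2 sub] .
  \<comment> \<open>Degenerate members carry no increment and are dropped; the others have nonempty
    interiors, which later tell members of different families apart.\<close>
  define G where "G = {K \<in> r - Q. Inf K < Sup K}"
  have fin: "finite r" using r by blast
  have form: "\<exists>u v. u \<le> v \<and> K = {u..v}" if "K \<in> r" for K
    using division_ofD(3,4)[OF r(2) that] by (metis atLeastatMost_empty_iff box_real(2))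
  show ?thesis
  proof
    show "intervals G"
      unfolding intervals_def G_def
    proof (intro conjI ballI impI)
      show "finite {K \<in> r - Q. Inf K < Sup K}" using fin by auto
      fix K assume K: "K \<in> {K \<in> r - Q. Inf K < Sup K}"
      then obtain u v where "u \<le> v" "K = {u..v}" using form by blast
      then show "\<exists>u v. u < v \<and> K = {u..v}" using K by auto
    next
      fix K J assume "K \<in> {K \<in> r - Q. Inf K < Sup K}" "J \<in> {K \<in> r - Q. Inf K < Sup K}" "K \<noteq> J"
      then show "interior K \<inter> interior J = {}" using division_ofD(5)[OF r(2)] by auto
    qed
    show "\<Union>G \<subseteq> {a..b}" using r(2) by (auto simp: G_def dest: division_ofD(2))
    fix g
    have "incr g {a..b} = (\<Sum>K\<in>r. incr g K)" using incr_division[OF _ r(2), of g] ab by simp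
    also have "\<dots> = (\<Sum>K\<in>Q. incr g K) + (\<Sum>K\<in>r - Q. incr g K)"
      using sum.subset_diff[OF r(1) fin, of "incr g"] by simp
    also have "(\<Sum>K\<in>r - Q. incr g K) = (\<Sum>K\<in>G. incr g K)"
    proof (rule sum.mono_neutral_right)
      show "\<forall>K\<in>r - Q - G. incr g K = 0"
      proof
        fix K assume K: "K \<in> r - Q - G"
        then obtain u v where uv: "u \<le> v" "K = {u..v}" using form by blast
        then have "u = v" using K by (auto simp: G_def)
        then show "incr g K = 0" using uv by (simp add: incr_def)
      qed
    qed (use fin in \<open>auto simp: G_def\<close>)
    finally show "incr g {a..b} = (\<Sum>K\<in>Q. incr g K) + (\<Sum>K\<in>G. incr g K)" .
  qed
qed

lemma absolutely_continuous_intervals: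
  assumes "absolutely_continuous_real g" "0 < e"
  obtains d where "0 < d"
    "\<And>G. intervals G \<Longrightarrow> (\<Sum>K\<in>G. incr (\<lambda>x. x) K) < d \<Longrightarrow> (\<Sum>K\<in>G. \<bar>incr g K\<bar>) < e"
proof -
  from assms have "\<exists>d>0. \<forall>(n::nat) a b. (\<forall>i<n. a i \<le> b i) \<and> disjoint_family_on (\<lambda>i. {a i<..<b i}) {..<n} \<and>
        (\<Sum>i<n. b i - a i) < d \<longrightarrow> (\<Sum>i<n. \<bar>g (b i) - g (a i)\<bar>) < e"
    unfolding absolutely_continuous_real_def by simp
  then obtain d where d: "d > 0" and ac: "\<forall>(n::nat) a b. (\<forall>i<n. a i \<le> b i) \<and> disjoint_family_on (\<lambda>i. {a i<..<b i}) {..<n} \<and>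
        (\<Sum>i<n. b i - a i) < d \<longrightarrow> (\<Sum>i<n. \<bar>g (b i) - g (a i)\<bar>) < e"
    by blast
  show ?thesis
  proof (rule that[OF d])
    fix G assume G: "intervals G" "(\<Sum>K\<in>G. incr (\<lambda>x. x) K) < d"
    have fin: "finite G" using G by (simp add: intervals_def)
    obtain h where h: "bij_betw h {..<card G} G"
      using ex_bij_betw_nat_finite[OF fin] by (auto simp: atLeast0LessThan)
    have hK: "\<exists>u v. u < v \<and> h i = {u..v}" if "i < card G" for i
      using G(1) h that unfolding intervals_def by (metis bij_betwE lessThan_iff)
    have 1: "\<forall>i<card G. Inf (h i) \<le> Sup (h i)"
      using hK by fastforce
    have int: "interior (h i) = {Inf (h i)<..<Sup (h i)}" if "i < card G" for i
      using hK[OF that] by auto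
    have 2: "disjoint_family_on (\<lambda>i. {Inf (h i)<..<Sup (h i)}) {..<card G}"
      unfolding disjoint_family_on_def
    proof (intro ballI impI)
      fix i j assume ij: "i \<in> {..<card G}" "j \<in> {..<card G}" "i \<noteq> j"
      then have "h i \<noteq> h j" "h i \<in> G" "h j \<in> G"
        using h by (auto simp: bij_betw_def inj_on_def)
      then have "interior (h i) \<inter> interior (h j) = {}"
        using G(1) by (simp add: intervals_def)
      then show "{Inf (h i)<..<Sup (h i)} \<inter> {Inf (h j)<..<Sup (h j)} = {}"
        using int ij by simp
    qed
    have s: "(\<Sum>i<card G. f (h i)) = (\<Sum>K\<in>G. f K)" for f :: "real set \<Rightarrow> real"
      using sum.reindex_bij_betw[OF h] .
    have 3: "(\<Sum>i<card G. Sup (h i) - Inf (h i)) < d"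
      using G(2) s[of "\<lambda>K. Sup K - Inf K"] by (simp add: incr_def)
    show "(\<Sum>K\<in>G. \<bar>incr g K\<bar>) < e"
      using ac[rule_format, OF conjI[OF 1 conjI[OF 2 3]]] s[of "\<lambda>K. \<bar>g (Sup K) - g (Inf K)\<bar>"] by (simp add: incr_def)
  qed
qed

text \<open>Vitali's theorem gives countably many disjoint intervals covering \<open>E\<close> up to
  a null set; by continuity of the measure from above, finitely many of them already miss less than
  \<open>e\<close>. The predicate \<open>R\<close> is arbitrary, so each use chooses what its
  intervals must satisfy.\<close>

lemma Vitali_intervals:
  assumes E: "E \<in> lmeasurable" and "0 < e"
    and cov: "\<And>x d. x \<in> E \<Longrightarrow> 0 < d \<Longrightarrow> \<exists>u v. u < v \<and> x \<in> {u..v} \<and> v - u < d \<and> R u v"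
  obtains P where "intervals P" "\<And>K. K \<in> P \<Longrightarrow> \<exists>u v. u < v \<and> K = {u..v} \<and> R u v"
    "measure lebesgue (E - \<Union>P) < e"
proof -
  define K where "K = {(u::real, v::real). u < v \<and> R u v}"
  define a where "a = (\<lambda>(u::real, v::real). (u + v) / 2)"
  define r where "r = (\<lambda>(u::real, v::real). (v - u) / 2)"
  have cb: "cball (a i) (r i) = {fst i..snd i}" for i
    by (cases i) (auto simp: a_def r_def cball_eq_atLeastAtMost field_simps)
  obtain C where C: "countable C" "C \<subseteq> K"
     "pairwise (\<lambda>i j. disjnt (cball (a i) (r i)) (cball (a j) (r j))) C"
     "negligible(E - (\<Union>i \<in> C. cball (a i) (r i)))"
  proof (rule Vitali_covering_theorem_cballs[of K r E a])
    fix i assume "i \<in> K" then show "0 < r i" by (auto simp: K_def r_def)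
  next
    fix x and d :: real assume xd: "x \<in> E" "0 < d"
    obtain u v where "u < v" "x \<in> {u..v}" "v - u < d" "R u v" using cov[OF xd] by blast
    moreover from this have "x \<in> cball (a (u,v)) (r (u,v))" unfolding cb by simp
    ultimately show "\<exists>i. i \<in> K \<and> x \<in> cball (a i) (r i) \<and> r i < d"
      by (intro exI[of _ "(u,v)"] conjI) (auto simp: K_def r_def)
  qed blast
  have C2: "negligible (E - (\<Union>i\<in>C. {fst i..snd i}))" using C(4) by (simp add: cb)
  have dis: "disjnt {fst i..snd i} {fst j..snd j}" if "i \<in> C" "j \<in> C" "i \<noteq> j" for i j
    using C(3) that unfolding pairwise_def cb by blast
  have iv: "intervals ((\<lambda>i. {fst i..snd i}) ` D)" if "finite D" "D \<subseteq> C" for D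
    unfolding intervals_def
  proof (intro conjI ballI impI)
    show "finite ((\<lambda>i. {fst i..snd i}) ` D)" using that by simp
    fix J assume J: "J \<in> (\<lambda>i. {fst i..snd i}) ` D"
    then show "\<exists>u v. u < v \<and> J = {u..v}" using C(2) that by (force simp: K_def)
    fix L assume L: "L \<in> (\<lambda>i. {fst i..snd i}) ` D" "J \<noteq> L"
    then have "disjnt J L" using J that by (auto intro!: dis)
    then show "interior J \<inter> interior L = {}"
      using interior_subset unfolding disjnt_def by blast
  qed
  have Rk: "\<exists>u v. u < v \<and> J = {u..v} \<and> R u v" if "J \<in> (\<lambda>i. {fst i..snd i}) ` D" "D \<subseteq> C" for J D
    using that C(2) by (force simp: K_def)
  \<comment> \<open>Intersecting with \<open>C\<close> keeps the indices inside \<open>C\<close>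
    even if \<open>C\<close> is empty, where \<open>from_nat_into\<close> is unspecified.\<close>
  define F where "F n = (\<Union>i\<in>C \<inter> from_nat_into C ` {..<n}. {fst i..snd i})" for n :: nat
  define A where "A n = E - F n" for n
  have FM: "F n \<in> sets lebesgue" for n
    unfolding F_def by (intro sets.finite_UN) auto
  have "(\<lambda>n. measure lebesgue (A n)) \<longlonglongrightarrow> measure lebesgue (\<Inter>n. A n)"
  proof (rule Lim_measure_decseq)
    show "range A \<subseteq> sets lebesgue" using E FM by (auto simp: A_def)
    show "decseq A" unfolding decseq_def A_def F_def
      by (intro allI impI Diff_mono UN_mono Int_mono image_mono) auto
    fix i
    have "emeasure lebesgue (A i) \<le> emeasure lebesgue E"
      using E by (intro emeasure_mono) (auto simp: A_def)
    then show "emeasure lebesgue (A i) \<noteq> \<infinity>"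
      using E by (auto simp: fmeasurable_def top_unique)
  qed
  moreover have "(\<Inter>n. A n) = E - (\<Union>i\<in>C. {fst i..snd i})"
  proof -
    have "(\<Union>n. F n) = (\<Union>i\<in>C. {fst i..snd i})"
    proof -
      have "C \<inter> from_nat_into C ` UNIV = C"
        using from_nat_into_surj[OF C(1)] by blast
      moreover have "(\<Union>n. C \<inter> from_nat_into C ` {..<n}) = C \<inter> from_nat_into C ` UNIV" by blast
      ultimately show ?thesis unfolding F_def by (simp only: UN_UN_flatten[symmetric])
    qed
    then show ?thesis by (auto simp: A_def)
  qed
  ultimately have "(\<lambda>n. measure lebesgue (A n)) \<longlonglongrightarrow> 0"
    using C2 by (simp add: negligible_imp_measure0)
  then obtain n where n: "measure lebesgue (A n) < e"
    using \<open>0 < e\<close> by (metis (no_types, lifting) eventually_happens order_tendstoD(2) sequentially_bot)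
  define D where "D = C \<inter> from_nat_into C ` {..<n}"
  have D: "finite D" "D \<subseteq> C" by (auto simp: D_def)
  show ?thesis
  proof (rule that[of "(\<lambda>i. {fst i..snd i}) ` D"])
    show "measure lebesgue (E - \<Union>((\<lambda>i. {fst i..snd i}) ` D)) < e"
      using n by (simp add: A_def F_def D_def)
  qed (use iv[OF D] Rk[OF _ D(2)] in auto)
qed

section \<open>Differentiability almost everywhere\<close>

text \<open>By Vitali, up to small measure \<open>E\<close> is covered by finitely many disjoint intervals \<open>P\<close> of slope below
  \<open>p\<close>, and by intervals \<open>Q\<close> of slope above \<open>q\<close> inside them. The increments of \<open>g\<close> over \<open>P\<close> and over \<open>Q\<close>
  differ only by those over the gaps, which are small by absolute continuity.\<close>

lemma straddling_slopes_null:
  assumes ac: "absolutely_continuous_real g" and "p < q" and E: "E \<in> lmeasurable"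
    and L: "\<And>x d. x \<in> E \<Longrightarrow> 0 < d \<Longrightarrow> \<exists>u v. u < x \<and> x < v \<and> v - u < d \<and> g v - g u < p * (v - u)"
    and U: "\<And>x d. x \<in> E \<Longrightarrow> 0 < d \<Longrightarrow> \<exists>u v. u < x \<and> x < v \<and> v - u < d \<and> g v - g u > q * (v - u)"
  shows "measure lebesgue E = 0"
proof (rule ccontr)
  define s where "s = measure lebesgue E"
  assume "measure lebesgue E \<noteq> 0"
  then have s: "s > 0" by (simp add: s_def zero_less_measure_iff)
  \<comment> \<open>The constants are set for a final contradiction between \<open>2 * e\<close> and
    \<open>7 / 4 * e\<close>: the gaps have length at most \<open>3 * \<delta>\<close>, so
    \<open>g\<close> changes by less than \<open>e\<close> over them and \<open>q\<close> times
    their length is at most \<open>3 / 4 * e\<close>, while the intervals of \<open>P\<close> keep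
    at least half of the length \<open>s\<close>.\<close>
  define e where "e = (q - p) * s / 4"
  have e: "e > 0" using s \<open>p < q\<close> by (simp add: e_def)
  obtain d where d: "d > 0"
    and ac: "\<And>G. intervals G \<Longrightarrow> (\<Sum>K\<in>G. incr (\<lambda>x. x) K) < d \<Longrightarrow> (\<Sum>K\<in>G. \<bar>incr g K\<bar>) < e"
    using absolutely_continuous_intervals[OF ac e] by blast
  define \<delta> where "\<delta> = min (d / 4) (min (s / 4) (e / (4 * (\<bar>q\<bar> + 1))))"
  have \<delta>: "\<delta> > 0" "\<delta> \<le> d / 4" "\<delta> \<le> s / 4" "\<delta> \<le> e / (4 * (\<bar>q\<bar> + 1))"
    using d s e unfolding \<delta>_def by (simp add: add_nonneg_pos, linarith+)
  have "\<delta> * (\<bar>q\<bar> + 1) \<le> e / (4 * (\<bar>q\<bar> + 1)) * (\<bar>q\<bar> + 1)"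
    using \<delta>(4) by (intro mult_right_mono) auto
  also have "\<dots> = e / 4" by (simp add: field_simps add_pos_nonneg add_nonneg_pos)
  finally have q\<delta>: "\<bar>q\<bar> * \<delta> \<le> e / 4" using \<delta>(1) by (simp add: algebra_simps)
  obtain W where W: "open W" "E \<subseteq> W" "W - E \<in> lmeasurable" "emeasure lebesgue (W - E) < ennreal \<delta>"
    using sets_lebesgue_outer_open[of E \<delta>] E \<delta>(1) by blast
  have WE: "measure lebesgue (W - E) < \<delta>"
    using W(3,4) \<delta>(1) by (simp add: emeasure_eq_measure2 ennreal_less_iff)
  have Wm: "W \<in> lmeasurable"
    using fmeasurable.Un[OF E W(3)] W(2) by (simp add: Un_absorb1)
  have WE2: "measure lebesgue W \<le> s + \<delta>"
    using measure_Un_le[of E lebesgue "W - E"] E W WE by (simp add: Un_absorb1 s_def fmeasurableD)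
  obtain P where P: "intervals P"
    "\<And>K. K \<in> P \<Longrightarrow> \<exists>u v. u < v \<and> K = {u..v} \<and> {u..v} \<subseteq> W \<and> g v - g u < p * (v - u)"
    "measure lebesgue (E - \<Union>P) < \<delta>"
  proof (rule Vitali_intervals[OF E \<delta>(1), of "\<lambda>u v. {u..v} \<subseteq> W \<and> g v - g u < p * (v - u)"])
    fix x and r :: real assume x: "x \<in> E" "0 < r"
    then obtain \<rho> where \<rho>: "\<rho> > 0" "ball x \<rho> \<subseteq> W" using W(1,2) openE by blast
    obtain u v where uv: "u < x" "x < v" "v - u < min r \<rho>" "g v - g u < p * (v - u)"
      using L[OF x(1), of "min r \<rho>"] x(2) \<rho>(1) by auto
    then have "{u..v} \<subseteq> ball x \<rho>" by (auto simp: dist_real_def)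
    then show "\<exists>u v. u < v \<and> x \<in> {u..v} \<and> v - u < r \<and> {u..v} \<subseteq> W \<and> g v - g u < p * (v - u)"
      using uv \<rho> by (intro exI[of _ u] exI[of _ v]) auto
  qed (use that in auto)
  have finP: "finite P" using P(1) by (simp add: intervals_def)
  \<comment> \<open>Only an interior point of a member of \<open>P\<close> has small neighbourhoods
    inside that member, which keeps the second covering \<open>Q\<close> within \<open>P\<close>.
    The endpoints given up are finitely many.\<close>
  define I where "I = (\<Union>K\<in>P. interior K)"
  define N where "N = (\<Union>K\<in>P. {Inf K, Sup K})"
  have N: "finite N" using finP by (auto simp: N_def)
  have "\<Union>P \<subseteq> I \<union> N"
  proof
    fix x assume "x \<in> \<Union>P"
    then obtain K where K: "K \<in> P" "x \<in> K" by blast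
    then obtain u v where uv: "u < v" "K = {u..v}" using P(2) by blast
    then have "x \<in> interior K \<or> x = Inf K \<or> x = Sup K" using K(2) by auto
    then show "x \<in> I \<union> N" using K(1) by (auto simp: I_def N_def)
  qed
  have Im: "open I" by (auto simp: I_def)
  define E' where "E' = E \<inter> I"
  have E'm: "E' \<in> lmeasurable" unfolding E'_def by (intro fmeasurable_Int_fmeasurable E) (use Im in auto)
  have "s \<le> measure lebesgue ((E - \<Union>P) \<union> E' \<union> N)"
    unfolding s_def
  proof (rule measure_mono_fmeasurable)
    show "E \<subseteq> E - \<Union> P \<union> E' \<union> N" using \<open>\<Union>P \<subseteq> I \<union> N\<close> by (auto simp: E'_def)
    show "E \<in> sets lebesgue" using E by blast
    show "E - \<Union> P \<union> E' \<union> N \<in> lmeasurable"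
      using E E'm intervals_measure(2)[OF P(1)] negligible_finite[OF N]
      by (intro fmeasurable.Un fmeasurable_Diff) (auto simp: negligible_iff_measure)
  qed
  also have "\<dots> \<le> measure lebesgue ((E - \<Union>P) \<union> E') + measure lebesgue N"
    using E E'm intervals_measure(2)[OF P(1)] N
    by (intro measure_Un_le) (auto intro!: sets.Un sets.Diff simp: fmeasurableD finite_imp_closed)
  also have "measure lebesgue N = 0" using N by (simp add: negligible_imp_measure0 negligible_finite)
  also have "measure lebesgue ((E - \<Union>P) \<union> E') \<le> measure lebesgue (E - \<Union>P) + measure lebesgue E'"
    using E E'm intervals_measure(2)[OF P(1)]
    by (intro measure_Un_le) (auto intro!: sets.Un sets.Diff simp: fmeasurableD)
  finally have E's: "s - \<delta> \<le> measure lebesgue E'" using P(3) by linarith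
  obtain Q where Q: "intervals Q"
    "\<And>J. J \<in> Q \<Longrightarrow> \<exists>u v. u < v \<and> J = {u..v} \<and> (\<exists>K\<in>P. {u..v} \<subseteq> K) \<and> g v - g u > q * (v - u)"
    "measure lebesgue (E' - \<Union>Q) < \<delta>"
  proof (rule Vitali_intervals[OF E'm \<delta>(1), of "\<lambda>u v. (\<exists>K\<in>P. {u..v} \<subseteq> K) \<and> g v - g u > q * (v - u)"])
    fix x and r :: real assume x: "x \<in> E'" "0 < r"
    then obtain K where K: "K \<in> P" "x \<in> interior K" by (auto simp: E'_def I_def)
    then obtain \<rho> where \<rho>: "\<rho> > 0" "ball x \<rho> \<subseteq> K" by (meson mem_interior)
    have "x \<in> E" using x by (simp add: E'_def)
    then obtain u v where uv: "u < x" "x < v" "v - u < min r \<rho>" "g v - g u > q * (v - u)"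
      using U[of x "min r \<rho>"] x(2) \<rho>(1) by auto
    then have "{u..v} \<subseteq> ball x \<rho>" by (auto simp: dist_real_def)
    then show "\<exists>u v. u < v \<and> x \<in> {u..v} \<and> v - u < r \<and> (\<exists>K\<in>P. {u..v} \<subseteq> K) \<and> g v - g u > q * (v - u)"
      using uv \<rho> K by (intro exI[of _ u] exI[of _ v]) auto
  qed (use that in auto)
  have finQ: "finite Q" using Q(1) by (simp add: intervals_def)
  define QK where "QK K = {J \<in> Q. J \<subseteq> K}" for K
  have "\<exists>G. intervals G \<and> \<Union>G \<subseteq> K \<and> (\<forall>h. incr h K = (\<Sum>J\<in>QK K. incr h J) + (\<Sum>J\<in>G. incr h J))"
    if K: "K \<in> P" for K
  proof -
    obtain u v where uv: "u < v" "K = {u..v}" using P(2)[OF K] by blast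
    have "intervals (QK K)" using intervals_subset[OF Q(1)] by (auto simp: QK_def)
    moreover have "\<Union>(QK K) \<subseteq> {u..v}" using uv by (auto simp: QK_def)
    ultimately obtain G where "intervals G" "\<Union>G \<subseteq> {u..v}"
      "\<And>h. incr h {u..v} = (\<Sum>J\<in>QK K. incr h J) + (\<Sum>J\<in>G. incr h J)"
      using fill_gaps[of "QK K" u v] uv(1) by blast
    then show ?thesis using uv(2) by blast
  qed
  then obtain G where G: "\<And>K. K \<in> P \<Longrightarrow> intervals (G K)" "\<And>K. K \<in> P \<Longrightarrow> \<Union>(G K) \<subseteq> K"
    "\<And>K h. K \<in> P \<Longrightarrow> incr h K = (\<Sum>J\<in>QK K. incr h J) + (\<Sum>J\<in>G K. incr h J)"
    by metis
  have disj: "interior J \<inter> interior J' = {}" if "K \<in> P" "K' \<in> P" "K \<noteq> K'" "J \<subseteq> K" "J' \<subseteq> K'" for J J' K K'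
  proof -
    have "interior K \<inter> interior K' = {}" using P(1) that(1-3) by (simp add: intervals_def)
    then show ?thesis using interior_mono[OF that(4)] interior_mono[OF that(5)] by blast
  qed
  have ne: "interior J \<noteq> {}" if H: "intervals H" "J \<in> H" for J H
  proof -
    obtain u v where "u < v" "J = {u..v}" by (rule intervalsE[OF H])
    then show ?thesis by simp
  qed
  have sumQ: "(\<Sum>J\<in>Q. incr h J) = (\<Sum>K\<in>P. \<Sum>J\<in>QK K. incr h J)" for h
  proof -
    have "\<exists>K\<in>P. J \<subseteq> K" if "J \<in> Q" for J using Q(2)[OF that] by auto
    then have "Q = (\<Union>K\<in>P. QK K)" unfolding QK_def by blast
    moreover have "(\<Sum>J\<in>(\<Union>K\<in>P. QK K). incr h J) = (\<Sum>K\<in>P. \<Sum>J\<in>QK K. incr h J)"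
    proof (rule sum.UNION_disjoint[OF finP])
      show "\<forall>K\<in>P. finite (QK K)" using finQ by (simp add: QK_def)
      show "\<forall>K\<in>P. \<forall>K'\<in>P. K \<noteq> K' \<longrightarrow> QK K \<inter> QK K' = {}"
      proof (intro ballI impI)
        fix K K' assume K: "K \<in> P" "K' \<in> P" "K \<noteq> K'"
        have "J \<notin> QK K \<inter> QK K'" for J
          using disj[OF K, of J J] ne[OF Q(1), of J] by (auto simp: QK_def)
        then show "QK K \<inter> QK K' = {}" by blast
      qed
    qed
    ultimately show ?thesis by simp
  qed
  define H where "H = (\<Union>K\<in>P. G K)"
  have finG: "\<forall>K\<in>P. finite (G K)" using G(1) by (simp add: intervals_def)
  have sumH: "(\<Sum>J\<in>H. incr h J) = (\<Sum>K\<in>P. \<Sum>J\<in>G K. incr h J)" for h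
    unfolding H_def
  proof (rule sum.UNION_disjoint[OF finP finG])
    show "\<forall>K\<in>P. \<forall>K'\<in>P. K \<noteq> K' \<longrightarrow> G K \<inter> G K' = {}"
    proof (intro ballI impI)
      fix K K' assume K: "K \<in> P" "K' \<in> P" "K \<noteq> K'"
      show "G K \<inter> G K' = {}"
      proof (rule ccontr)
        assume "G K \<inter> G K' \<noteq> {}"
        then obtain J where J: "J \<in> G K" "J \<in> G K'" by blast
        then have "J \<subseteq> K" "J \<subseteq> K'" using G(2) K by blast+
        then show False using disj[OF K] ne[OF G(1)[OF K(1)] J(1)] by blast
      qed
    qed
  qed
  have iH: "intervals H"
    unfolding intervals_def
  proof (intro conjI ballI impI)
    show "finite H" using finP finG by (auto simp: H_def)
    show "\<exists>u v. u < v \<and> J = {u..v}" if "J \<in> H" for J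
      using that G(1) by (auto simp: H_def intervals_def)
    fix J J' assume J: "J \<in> H" "J' \<in> H" "J \<noteq> J'"
    then obtain K K' where K: "K \<in> P" "K' \<in> P" "J \<in> G K" "J' \<in> G K'" by (auto simp: H_def)
    show "interior J \<inter> interior J' = {}"
    proof (cases "K = K'")
      case True
      then show ?thesis using G(1)[OF K(1)] K J(3) by (simp add: intervals_def)
    next
      case False
      moreover have "J \<subseteq> K" "J' \<subseteq> K'" using G(2) K by blast+
      ultimately show ?thesis using disj K(1,2) by blast
    qed
  qed
  have tot: "(\<Sum>K\<in>P. incr h K) = (\<Sum>J\<in>Q. incr h J) + (\<Sum>J\<in>H. incr h J)" for h
    unfolding sumQ sumH using G(3) by (simp add: sum.distrib)
  define LP where "LP = (\<Sum>K\<in>P. incr (\<lambda>x. x) K)"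
  define LQ where "LQ = (\<Sum>K\<in>Q. incr (\<lambda>x. x) K)"
  define LH where "LH = (\<Sum>K\<in>H. incr (\<lambda>x. x) K)"
  have "LP = measure lebesgue (\<Union>P)" using intervals_measure[OF P(1)] by (simp add: LP_def)
  also have "\<dots> \<le> measure lebesgue W"
    using P(2) intervals_measure(2)[OF P(1)] Wm by (intro measure_mono_fmeasurable) (blast, auto)
  finally have LP: "LP \<le> s + \<delta>" using WE2 by linarith
  have "measure lebesgue E' \<le> measure lebesgue ((E' - \<Union>Q) \<union> \<Union>Q)"
    using E'm intervals_measure(2)[OF Q(1)] by (intro measure_mono_fmeasurable) (auto intro!: fmeasurable.Un fmeasurable_Diff)
  also have "\<dots> \<le> measure lebesgue (E' - \<Union>Q) + measure lebesgue (\<Union>Q)"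
    using E'm intervals_measure(2)[OF Q(1)] by (intro measure_Un_le) (auto simp: fmeasurableD)
  also have "measure lebesgue (\<Union>Q) = LQ" using intervals_measure[OF Q(1)] by (simp add: LQ_def)
  finally have LQ: "s - 2 * \<delta> \<le> LQ" using E's Q(3) by linarith
  have LPQH: "LP = LQ + LH" using tot[of "\<lambda>x. x"] by (simp add: LP_def LQ_def LH_def)
  have LH: "LH \<le> 3 * \<delta>" using LP LQ LPQH by linarith
  have LH0: "LH \<ge> 0" using iH unfolding LH_def by (intro sum_nonneg) (auto simp: intervals_def)
  have "(\<Sum>K\<in>H. \<bar>incr g K\<bar>) < e"
    using ac[OF iH] LH \<delta>(1,2) d by (simp add: LH_def)
  then have Hg: "(\<Sum>K\<in>H. incr g K) > - e"
    using sum_abs[of "incr g" H] by linarith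
  have Pg: "(\<Sum>K\<in>P. incr g K) \<le> p * LP"
    unfolding LP_def sum_distrib_left
  proof (rule sum_mono)
    fix K assume "K \<in> P"
    from P(2)[OF this] show "incr g K \<le> p * incr (\<lambda>x. x) K" by auto
  qed
  have Qg: "(\<Sum>K\<in>Q. incr g K) \<ge> q * LQ"
    unfolding LQ_def sum_distrib_left
  proof (rule sum_mono)
    fix K assume "K \<in> Q"
    from Q(2)[OF this] show "q * incr (\<lambda>x. x) K \<le> incr g K" by auto
  qed
  have "q * LH \<le> \<bar>q\<bar> * LH" using LH0 by (intro mult_right_mono) auto
  also have "\<dots> \<le> \<bar>q\<bar> * (3 * \<delta>)" using LH by (intro mult_left_mono) auto
  also have "\<dots> \<le> 3 * (e / 4)" using q\<delta> by linarith
  finally have qLH: "q * LH \<le> 3 * (e / 4)" .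
  have "q * LP = q * LQ + q * LH" using LPQH by (simp add: algebra_simps)
  then have up: "(q - p) * LP \<le> e + 3 * (e / 4)"
    using tot[of g] Hg Pg Qg qLH by (simp add: algebra_simps)
  have "LP \<ge> s - 2 * \<delta>" using LQ LPQH LH0 by linarith
  then have "LP \<ge> s / 2" using \<delta>(3) by linarith
  then have "(q - p) * LP \<ge> (q - p) * (s / 2)" using \<open>p < q\<close> by (intro mult_left_mono) auto
  also have "(q - p) * (s / 2) = 2 * e" by (simp add: e_def)
  finally show False using up e by linarith
qed

text \<open>Let \<open>d\<close> belong to increments below 1. If \<open>E\<close> had measure
  \<open>s > 0\<close> inside a window shorter than \<open>d\<close>, disjoint intervals in the
  window of slope above \<open>2 / s\<close> and total length at least \<open>s / 2\<close> would
  carry an increment of at least 1.\<close>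

lemma steep_slopes_null:
  assumes ac: "absolutely_continuous_real g" and E: "E \<in> sets lebesgue"
    and U: "\<And>q x d. x \<in> E \<Longrightarrow> 0 < d \<Longrightarrow> \<exists>u v. u < x \<and> x < v \<and> v - u < d \<and> g v - g u > q * (v - u)"
  shows "negligible E"
proof -
  obtain d where d: "d > 0"
    and ac: "\<And>G. intervals G \<Longrightarrow> (\<Sum>K\<in>G. incr (\<lambda>x. x) K) < d \<Longrightarrow> (\<Sum>K\<in>G. \<bar>incr g K\<bar>) < 1"
    using absolutely_continuous_intervals[OF ac zero_less_one] by blast
  have main: "negligible (E \<inter> {a<..<a + d / 2})" for a
  proof (rule ccontr)
    define F where "F = E \<inter> {a<..<a + d / 2}"
    have F: "F \<in> lmeasurable" unfolding F_def by (subst Int_commute, rule fmeasurable_Int_fmeasurable) (use E in auto)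
    assume "\<not> negligible (E \<inter> {a<..<a + d / 2})"
    then have s: "measure lebesgue F > 0"
      using F by (auto simp: F_def negligible_iff_measure zero_less_measure_iff)
    define s where "s = measure lebesgue F"
    obtain Q where Q: "intervals Q"
      "\<And>J. J \<in> Q \<Longrightarrow> \<exists>u v. u < v \<and> J = {u..v} \<and> {u..v} \<subseteq> {a<..<a + d / 2} \<and> g v - g u > 2 / s * (v - u)"
      "measure lebesgue (F - \<Union>Q) < s / 2"
    proof (rule Vitali_intervals[OF F, of "s / 2" "\<lambda>u v. {u..v} \<subseteq> {a<..<a + d / 2} \<and> g v - g u > 2 / s * (v - u)"])
      show "0 < s / 2" using s by (simp add: s_def)
      fix x and r :: real assume x: "x \<in> F" "0 < r"
      then obtain \<rho> where \<rho>: "\<rho> > 0" "ball x \<rho> \<subseteq> {a<..<a + d / 2}"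
        using openE[of "{a<..<a + d / 2}" x] by (auto simp: F_def)
      have "x \<in> E" using x by (simp add: F_def)
      then obtain u v where uv: "u < x" "x < v" "v - u < min r \<rho>" "g v - g u > 2 / s * (v - u)"
        using U[of x "min r \<rho>" "2 / s"] x(2) \<rho>(1) by auto
      then have "{u..v} \<subseteq> ball x \<rho>" by (auto simp: dist_real_def)
      then show "\<exists>u v. u < v \<and> x \<in> {u..v} \<and> v - u < r \<and> {u..v} \<subseteq> {a<..<a + d / 2} \<and> g v - g u > 2 / s * (v - u)"
        using uv \<rho> by (intro exI[of _ u] exI[of _ v]) auto
    qed (use that in auto)
    define LQ where "LQ = (\<Sum>K\<in>Q. incr (\<lambda>x. x) K)"
    have LQm: "LQ = measure lebesgue (\<Union>Q)" using intervals_measure[OF Q(1)] by (simp add: LQ_def)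
    also have "\<dots> \<le> measure lebesgue {a<..<a + d / 2}"
      using Q(2) intervals_measure(2)[OF Q(1)] by (intro measure_mono_fmeasurable) (blast, auto)
    finally have "LQ < d" using d by simp
    then have small: "(\<Sum>K\<in>Q. \<bar>incr g K\<bar>) < 1" using ac[OF Q(1)] by (simp add: LQ_def)
    have "s \<le> measure lebesgue ((F - \<Union>Q) \<union> \<Union>Q)"
      unfolding s_def using F intervals_measure(2)[OF Q(1)]
      by (intro measure_mono_fmeasurable) (auto intro!: fmeasurable.Un fmeasurable_Diff)
    also have "\<dots> \<le> measure lebesgue (F - \<Union>Q) + measure lebesgue (\<Union>Q)"
      using F intervals_measure(2)[OF Q(1)] by (intro measure_Un_le) (auto simp: fmeasurableD)
    finally have "s / 2 \<le> LQ" using Q(3) LQm by linarith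
    moreover have "2 / s * LQ \<le> (\<Sum>K\<in>Q. incr g K)"
      unfolding LQ_def sum_distrib_left
    proof (rule sum_mono)
      fix K assume "K \<in> Q"
      from Q(2)[OF this] show "2 / s * incr (\<lambda>x. x) K \<le> incr g K" by auto
    qed
    moreover have "(\<Sum>K\<in>Q. incr g K) < 1" using small sum_abs[of "incr g" Q] by linarith
    ultimately have "2 / s * LQ < 1" by linarith
    moreover have "1 \<le> 2 / s * LQ" using \<open>s / 2 \<le> LQ\<close> s by (simp add: s_def field_simps)
    ultimately show False by linarith
  qed
  \<comment> \<open>Windows of length \<open>d / 2\<close> starting at the multiples of
    \<open>d / 4\<close> overlap, so these open windows miss no point.\<close>
  have "E \<subseteq> (\<Union>k\<in>\<int>. E \<inter> {k * (d / 4)<..<k * (d / 4) + d / 2})"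
  proof
    fix x assume x: "x \<in> E"
    define k :: real where "k = of_int (\<lceil>x / (d / 4)\<rceil> - 1)"
    have "k < x / (d / 4)" "x / (d / 4) \<le> k + 1"
      unfolding k_def by linarith+
    then have "k * (d / 4) < x" "x \<le> k * (d / 4) + d / 4"
      using d by (simp_all add: field_simps)
    then have "x \<in> {k * (d / 4)<..<k * (d / 4) + d / 2}" using d by simp
    moreover have "k \<in> \<int>" by (simp add: k_def)
    ultimately show "x \<in> (\<Union>k\<in>\<int>. E \<inter> {k * (d / 4)<..<k * (d / 4) + d / 2})" using x by blast
  qed
  moreover have "negligible (\<Union>k\<in>\<int>. E \<inter> {k * (d / 4)<..<k * (d / 4) + d / 2})"
  proof (rule negligible_countable_Union)
    show "countable ((\<lambda>k. E \<inter> {k * (d / 4)<..<k * (d / 4) + d / 2}) ` \<int>)"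
      by (intro countable_image countable_subset[OF _ countable_rat]) (auto intro: Ints_subset_Rats[THEN subsetD])
  qed (use main in auto)
  ultimately show ?thesis using negligible_subset by blast
qed

lemma absolutely_continuous_imp_continuous:
  assumes "absolutely_continuous_real g"
  shows "isCont g x"
  unfolding continuous_at_eps_delta
proof (intro allI impI)
  fix e :: real assume "e > 0"
  obtain d where d: "d > 0"
    and ac: "\<And>G. intervals G \<Longrightarrow> (\<Sum>K\<in>G. incr (\<lambda>x. x) K) < d \<Longrightarrow> (\<Sum>K\<in>G. \<bar>incr g K\<bar>) < e"
    using absolutely_continuous_intervals[OF assms \<open>e > 0\<close>] by blast
  have step: "\<bar>g v - g u\<bar> < e" if "u < v" "v - u < d" for u v
    using ac[of "{{u..v}}"] that by (simp add: intervals_def)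
  have "dist (g y) (g x) < e" if "dist y x < d" for y
    using step[of x y] step[of y x] that \<open>e > 0\<close> by (cases y x rule: linorder_cases) (auto simp: dist_real_def abs_minus_commute)
  then show "\<exists>d>0. \<forall>x'. dist x' x < d \<longrightarrow> dist (g x') (g x) < e" using d by blast
qed

lemma absolutely_continuous_real_uminus:
  "absolutely_continuous_real g \<Longrightarrow> absolutely_continuous_real (\<lambda>x. - g x)"
  unfolding absolutely_continuous_real_def by (simp add: abs_minus_commute)

text \<open>Slopes over short intervals with \<open>x\<close> strictly inside replace difference
  quotients based at \<open>x\<close>. Such an interval is a witness for all its interior points, so
  the set is a countable intersection of open sets, hence Borel, whatever \<open>R\<close>
  is.\<close>

definition straddled :: "(real \<Rightarrow> real \<Rightarrow> bool) \<Rightarrow> real set" where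
  "straddled R = {x. \<forall>n::nat. \<exists>u v. u < x \<and> x < v \<and> v - u < 1 / Suc n \<and> R u v}"

lemma straddledD:
  assumes "x \<in> straddled R" "0 < d"
  shows "\<exists>u v. u < x \<and> x < v \<and> v - u < d \<and> R u v"
proof -
  obtain n :: nat where n: "1 / Suc n < d" using \<open>0 < d\<close> nat_approx_posE by blast
  moreover obtain u v where "u < x" "x < v" "v - u < 1 / Suc n" "R u v"
    using assms(1) unfolding straddled_def by blast
  ultimately show ?thesis by (intro exI[of _ u] exI[of _ v]) auto
qed

lemma straddledI:
  assumes "\<And>d. 0 < d \<Longrightarrow> \<exists>u v. u < x \<and> x < v \<and> v - u < d \<and> R u v"
  shows "x \<in> straddled R"
  unfolding straddled_def using assms by simp

lemma straddled_sets [measurable]: "straddled R \<in> sets borel"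
proof -
  have "straddled R = (\<Inter>n::nat. \<Union>{{u<..<v} | u v. v - u < 1 / Suc n \<and> R u v})"
  proof (intro set_eqI iffI)
    fix x assume "x \<in> straddled R"
    then have "\<exists>u v. u < x \<and> x < v \<and> v - u < 1 / Suc n \<and> R u v" for n :: nat
      unfolding straddled_def by blast
    then have "\<exists>u v. x \<in> {u<..<v} \<and> v - u < 1 / Suc n \<and> R u v" for n :: nat
      by (simp add: conj_assoc)
    then show "x \<in> (\<Inter>n::nat. \<Union>{{u<..<v} | u v. v - u < 1 / Suc n \<and> R u v})"
      by blast
  next
    fix x assume x: "x \<in> (\<Inter>n::nat. \<Union>{{u<..<v} | u v. v - u < 1 / Suc n \<and> R u v})"
    have "\<exists>u v. x \<in> {u<..<v} \<and> v - u < 1 / Suc n \<and> R u v" for n :: nat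
      using INT_D[OF x UNIV_I[of n]] by blast
    then show "x \<in> straddled R" unfolding straddled_def by (simp add: conj_assoc)
  qed
  also have "\<dots> \<in> sets borel"
  proof (rule sets.countable_INT)
    have "open (\<Union>{{u<..<v} | u v. v - u < 1 / Suc n \<and> R u v})" for n :: nat
      by (intro open_Union) auto
    then show "range (\<lambda>n::nat. \<Union>{{u<..<v} | u v. v - u < 1 / Suc n \<and> R u v}) \<subseteq> sets borel"
      using borel_open by blast
  qed auto
  finally show ?thesis .
qed

text \<open>Let \<open>s\<close> be the infimum of the \<open>q\<close> that bound all sufficiently
  short slopes around \<open>x\<close> from above. Slopes above \<open>s - e / 2\<close> occur at
  every scale, so by \<open>L\<close> slopes below \<open>s - e\<close> do not, and the slopes
  converge to \<open>s\<close>. Continuity of \<open>g\<close> then lets one endpoint move to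
  \<open>x\<close>, which gives the one-sided difference quotients.\<close>

lemma differentiable_if_slopes_converge:
  fixes g :: "real \<Rightarrow> real"
  assumes cont: "isCont g x"
    and L: "\<And>p q. p < q \<Longrightarrow> x \<notin> straddled (\<lambda>u v. g v - g u < p * (v - u)) \<or> x \<notin> straddled (\<lambda>u v. g v - g u > q * (v - u))"
    and up: "\<exists>q. x \<notin> straddled (\<lambda>u v. g v - g u > q * (v - u))"
    and lo: "\<exists>p. x \<notin> straddled (\<lambda>u v. g v - g u < p * (v - u))"
  shows "g differentiable at x"
proof -
  define A where "A = {q. x \<notin> straddled (\<lambda>u v. g v - g u > q * (v - u))}"
  have A: "\<exists>d>0. \<forall>u v. u < x \<and> x < v \<and> v - u < d \<longrightarrow> g v - g u \<le> q * (v - u)" if "q \<in> A" for q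
    using that straddledI[of x "\<lambda>u v. g v - g u > q * (v - u)"] unfolding A_def by force
  have B: "\<exists>d>0. \<forall>u v. u < x \<and> x < v \<and> v - u < d \<longrightarrow> g v - g u \<ge> p * (v - u)"
    if "x \<notin> straddled (\<lambda>u v. g v - g u < p * (v - u))" for p
    using that straddledI[of x "\<lambda>u v. g v - g u < p * (v - u)"] by force
  obtain p0 where p0: "x \<notin> straddled (\<lambda>u v. g v - g u < p0 * (v - u))" using lo by blast
  obtain d0 where d0: "d0 > 0" "\<And>u v. u < x \<Longrightarrow> x < v \<Longrightarrow> v - u < d0 \<Longrightarrow> g v - g u \<ge> p0 * (v - u)"
    using B[OF p0] by blast
  have bdd: "p0 \<le> q" if qA: "q \<in> A" for q
  proof -
    obtain d where d: "d > 0" "\<And>u v. u < x \<Longrightarrow> x < v \<Longrightarrow> v - u < d \<Longrightarrow> g v - g u \<le> q * (v - u)"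
      using A[OF qA] by blast
    define h where "h = min d d0 / 4"
    have h: "h > 0" "x - h < x" "x < x + h" "(x + h) - (x - h) < d" "(x + h) - (x - h) < d0"
      using d(1) d0(1) by (auto simp: h_def)
    have "p0 * ((x + h) - (x - h)) \<le> q * ((x + h) - (x - h))"
      using d(2)[OF h(2,3,4)] d0(2)[OF h(2,3,5)] by linarith
    then show ?thesis using h(1) by simp
  qed
  then have bA: "bdd_below A" by (rule bdd_belowI)
  have neA: "A \<noteq> {}" using up by (auto simp: A_def)
  define s where "s = Inf A"
  have slope: "\<exists>d>0. \<forall>u v. u < x \<and> x < v \<and> v - u < d \<longrightarrow> \<bar>g v - g u - s * (v - u)\<bar> \<le> e * (v - u)"
    if e: "e > 0" for e
  proof -
    obtain q where q: "q \<in> A" "q < s + e"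
      using e cInf_lessD[OF neA, of "s + e"] by (auto simp: s_def)
    obtain d where d: "d > 0" "\<And>u v. u < x \<Longrightarrow> x < v \<Longrightarrow> v - u < d \<Longrightarrow> g v - g u \<le> q * (v - u)"
      using A[OF q(1)] by blast
    have "s - e / 2 \<notin> A" using e cInf_lower[OF _ bA, of "s - e / 2"] by (auto simp: s_def)
    then have "x \<in> straddled (\<lambda>u v. g v - g u > (s - e / 2) * (v - u))" by (simp add: A_def)
    then have "x \<notin> straddled (\<lambda>u v. g v - g u < (s - e) * (v - u))"
      using L[of "s - e" "s - e / 2"] e by auto
    from B[OF this] obtain d' where d': "d' > 0"
      "\<And>u v. u < x \<Longrightarrow> x < v \<Longrightarrow> v - u < d' \<Longrightarrow> g v - g u \<ge> (s - e) * (v - u)"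
      by blast
    show ?thesis
    proof (intro exI[of _ "min d d'"] conjI allI impI)
      show "0 < min d d'" using d(1) d'(1) by simp
      fix u v assume uv: "u < x \<and> x < v \<and> v - u < min d d'"
      have "q * (v - u) \<le> (s + e) * (v - u)" using uv q(2) by (intro mult_right_mono) auto
      moreover have "g v - g u \<le> q * (v - u)" using d(2)[of u v] uv by auto
      ultimately have "g v - g u \<le> (s + e) * (v - u)" by linarith
      moreover have "g v - g u \<ge> (s - e) * (v - u)" using d'(2)[of u v] uv by auto
      ultimately show "\<bar>g v - g u - s * (v - u)\<bar> \<le> e * (v - u)" by (auto simp: abs_le_iff algebra_simps)
    qed
  qed
  have "(g has_derivative (\<lambda>h. s * h)) (at x)"
    unfolding has_derivative_at_alt
  proof (intro conjI allI impI)
    show "bounded_linear ((*) s)" by (rule bounded_linear_mult_right)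
    fix e :: real assume "e > 0"
    then obtain d where d: "d > 0" "\<And>u v. u < x \<Longrightarrow> x < v \<Longrightarrow> v - u < d \<Longrightarrow> \<bar>g v - g u - s * (v - u)\<bar> \<le> e * (v - u)"
      using slope by blast
    have gx: "(g \<longlongrightarrow> g x) (at x within S)" for S
      using cont continuous_at_imp_continuous_within continuous_within by blast
    have right: "\<bar>g v - g x - s * (v - x)\<bar> \<le> e * (v - x)" if v: "x < v" "v - x < d" for v
    proof (rule tendsto_le[of "at_left x" "\<lambda>u. e * (v - u)" _ "\<lambda>u. \<bar>g v - g u - s * (v - u)\<bar>"])
      show "((\<lambda>u. e * (v - u)) \<longlongrightarrow> e * (v - x)) (at_left x)" by (intro tendsto_intros)
      show "((\<lambda>u. \<bar>g v - g u - s * (v - u)\<bar>) \<longlongrightarrow> \<bar>g v - g x - s * (v - x)\<bar>) (at_left x)"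
        by (intro tendsto_intros gx)
      have "\<forall>\<^sub>F u in at_left x. u \<in> {v - d<..<x}" using v by (intro eventually_at_left_real) auto
      then show "\<forall>\<^sub>F u in at_left x. \<bar>g v - g u - s * (v - u)\<bar> \<le> e * (v - u)"
        by (rule eventually_mono) (use v d in auto)
    qed auto
    have left: "\<bar>g x - g u - s * (x - u)\<bar> \<le> e * (x - u)" if u: "u < x" "x - u < d" for u
    proof (rule tendsto_le[of "at_right x" "\<lambda>v. e * (v - u)" _ "\<lambda>v. \<bar>g v - g u - s * (v - u)\<bar>"])
      show "((\<lambda>v. e * (v - u)) \<longlongrightarrow> e * (x - u)) (at_right x)" by (intro tendsto_intros)
      show "((\<lambda>v. \<bar>g v - g u - s * (v - u)\<bar>) \<longlongrightarrow> \<bar>g x - g u - s * (x - u)\<bar>) (at_right x)"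
        by (intro tendsto_intros gx)
      have "\<forall>\<^sub>F v in at_right x. v \<in> {x<..<u + d}" using u by (intro eventually_at_right_real) auto
      then show "\<forall>\<^sub>F v in at_right x. \<bar>g v - g u - s * (v - u)\<bar> \<le> e * (v - u)"
        by (rule eventually_mono) (use u d in auto)
    qed auto
    show "\<exists>d>0. \<forall>y. norm (y - x) < d \<longrightarrow> norm (g y - g x - s * (y - x)) \<le> e * norm (y - x)"
    proof (intro exI[of _ d] conjI allI impI d(1))
      fix y assume y: "norm (y - x) < d"
      consider "x < y" | "y = x" | "y < x" by linarith
      then show "norm (g y - g x - s * (y - x)) \<le> e * norm (y - x)"
      proof cases
        case 3
        then show ?thesis using left[of y] y by (simp add: abs_le_iff algebra_simps)
      qed (use right[of y] y in auto)
    qed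
  qed
  then show ?thesis unfolding differentiable_def by blast
qed

text \<open>Slopes can fail to converge in three ways: they accumulate on both sides of a gap
  (\<open>N1\<close>), exceed every bound (\<open>N2\<close>), or fall below every bound
  (\<open>N3\<close>). Gaps with rational ends suffice for the first, which makes it a countable
  union of null sets; the third is the second for \<open>- g\<close>.\<close>

theorem absolutely_continuous_differentiable_AE:
  assumes ac: "absolutely_continuous_real g"
  shows "AE x in lebesgue. g differentiable at x"
proof -
  define Lo where "Lo p = straddled (\<lambda>u v. g v - g u < p * (v - u))" for p
  define Up where "Up q = straddled (\<lambda>u v. g v - g u > q * (v - u))" for q
  have neg1: "negligible (Lo p \<inter> Up q)" if "p < q" for p q
    unfolding negligible_on_intervals[of "Lo p \<inter> Up q"]
  proof (intro allI)
    fix a b :: real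
    have m: "Lo p \<inter> Up q \<inter> cbox a b \<in> lmeasurable"
      by (subst Int_commute, rule fmeasurable_Int_fmeasurable) (auto simp: Lo_def Up_def)
    have "measure lebesgue (Lo p \<inter> Up q \<inter> cbox a b) = 0"
    proof (rule straddling_slopes_null[OF ac \<open>p < q\<close> m])
      fix x d :: real assume x: "x \<in> Lo p \<inter> Up q \<inter> cbox a b" "0 < d"
      then show "\<exists>u v. u < x \<and> x < v \<and> v - u < d \<and> g v - g u < p * (v - u)"
        using straddledD[of x _ d] unfolding Lo_def by blast
      show "\<exists>u v. u < x \<and> x < v \<and> v - u < d \<and> g v - g u > q * (v - u)"
        using straddledD[of x _ d] x unfolding Up_def by blast
    qed
    then show "negligible (Lo p \<inter> Up q \<inter> cbox a b)" using m negligible_iff_measure by blast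
  qed
  define N1 where "N1 = (\<Union>i\<in>{(p, q). p \<in> \<rat> \<and> q \<in> \<rat> \<and> p < q}. Lo (fst i) \<inter> Up (snd i))"
  define N2 where "N2 = (\<Inter>n::nat. Up (real n))"
  define N3 where "N3 = (\<Inter>n::nat. Lo (- real n))"
  have "negligible N1"
    unfolding N1_def
  proof (rule negligible_countable_Union)
    have "countable (\<rat> \<times> \<rat> :: (real \<times> real) set)" by (intro countable_SIGMA countable_rat)
    then show "countable ((\<lambda>i. Lo (fst i) \<inter> Up (snd i)) ` {(p, q). p \<in> \<rat> \<and> q \<in> \<rat> \<and> p < q})"
      by (intro countable_image) (rule countable_subset, auto)
  qed (use neg1 in auto)
  moreover have "negligible N2"
  proof (rule steep_slopes_null[OF ac])
    show "N2 \<in> sets lebesgue" unfolding N2_def Up_def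
      by (intro sets.countable_INT) (auto intro: sets_completionI_sets)
    fix q x d :: real assume x: "x \<in> N2" "0 < d"
    obtain n :: nat where n: "q \<le> real n" using real_arch_simple by blast
    have "x \<in> Up (real n)" using x by (simp add: N2_def)
    then obtain u v where uv: "u < x" "x < v" "v - u < d" "g v - g u > real n * (v - u)"
      using straddledD[of x _ d] x(2) unfolding Up_def by blast
    moreover have "q * (v - u) \<le> real n * (v - u)" using n uv by (intro mult_right_mono) auto
    ultimately show "\<exists>u v. u < x \<and> x < v \<and> v - u < d \<and> g v - g u > q * (v - u)"
      by (intro exI[of _ u] exI[of _ v] conjI; linarith)
  qed
  moreover have "negligible N3"
  proof (rule steep_slopes_null[OF absolutely_continuous_real_uminus[OF ac]])
    show "N3 \<in> sets lebesgue" unfolding N3_def Lo_def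
      by (intro sets.countable_INT) (auto intro: sets_completionI_sets)
    fix q x d :: real assume x: "x \<in> N3" "0 < d"
    obtain n :: nat where n: "q \<le> real n" using real_arch_simple by blast
    have "x \<in> Lo (- real n)" using x by (simp add: N3_def)
    then obtain u v where uv: "u < x" "x < v" "v - u < d" "g v - g u < - real n * (v - u)"
      using straddledD[of x _ d] x(2) unfolding Lo_def by blast
    moreover have "q * (v - u) \<le> real n * (v - u)" using n uv by (intro mult_right_mono) auto
    ultimately show "\<exists>u v. u < x \<and> x < v \<and> v - u < d \<and> - g v - - g u > q * (v - u)"
      by (intro exI[of _ u] exI[of _ v] conjI; linarith)
  qed
  ultimately have N: "negligible (N1 \<union> N2 \<union> N3)" by simp
  have "g differentiable at x" if x: "x \<notin> N1 \<union> N2 \<union> N3" for x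
  proof (rule differentiable_if_slopes_converge)
    show "isCont g x" using absolutely_continuous_imp_continuous[OF ac] .
    show "\<exists>q. x \<notin> straddled (\<lambda>u v. g v - g u > q * (v - u))" using x by (auto simp: N2_def Up_def)
    obtain n where "x \<notin> Lo (- real n)" using x by (auto simp: N3_def)
    then show "\<exists>p. x \<notin> straddled (\<lambda>u v. g v - g u < p * (v - u))" unfolding Lo_def by blast
    fix p q :: real assume "p < q"
    then obtain p' where p': "p' \<in> \<rat>" "p < p'" "p' < q" using Rats_dense_in_real by blast
    obtain q' where q': "q' \<in> \<rat>" "p' < q'" "q' < q" using Rats_dense_in_real p'(3) by blast
    have "x \<notin> Lo p' \<inter> Up q'" using x p' q' by (auto simp: N1_def)
    moreover have "x \<in> Lo p'" if xp: "x \<in> Lo p"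
      unfolding Lo_def
    proof (rule straddledI)
      fix d :: real assume "d > 0"
      then obtain u v where uv: "u < x" "x < v" "v - u < d" "g v - g u < p * (v - u)"
        using straddledD[OF xp[unfolded Lo_def]] by blast
      moreover have "p * (v - u) \<le> p' * (v - u)" using p' uv by (intro mult_right_mono) auto
      ultimately show "\<exists>u v. u < x \<and> x < v \<and> v - u < d \<and> g v - g u < p' * (v - u)"
        by (intro exI[of _ u] exI[of _ v] conjI; linarith)
    qed
    moreover have "x \<in> Up q'" if xq: "x \<in> Up q"
      unfolding Up_def
    proof (rule straddledI)
      fix d :: real assume "d > 0"
      then obtain u v where uv: "u < x" "x < v" "v - u < d" "g v - g u > q * (v - u)"
        using straddledD[OF xq[unfolded Up_def]] by blast
      moreover have "q' * (v - u) \<le> q * (v - u)" using q' uv by (intro mult_right_mono) auto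
      ultimately show "\<exists>u v. u < x \<and> x < v \<and> v - u < d \<and> g v - g u > q' * (v - u)"
        by (intro exI[of _ u] exI[of _ v] conjI; linarith)
    qed
    ultimately show "x \<notin> straddled (\<lambda>u v. g v - g u < p * (v - u)) \<or> x \<notin> straddled (\<lambda>u v. g v - g u > q * (v - u))"
      by (auto simp: Lo_def Up_def)
  qed
  then have "{x. \<not> g differentiable at x} \<subseteq> N1 \<union> N2 \<union> N3" by blast
  then show ?thesis using N unfolding eventually_ae_filter_negligible by blast
qed

text \<open>Intervals \<open>[x, x + h]\<close> of slope at most \<open>C + e\<close> in modulus,
  starting where the derivative is at most \<open>C\<close> in modulus, fill \<open>[a, b]\<close>
  up to length \<open>d\<close> by Vitali, and absolute continuity makes the increments over the
  gaps less than \<open>e\<close>. This takes the place of integrating the derivative.\<close>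

theorem absolutely_continuous_bounded_deriv_imp_lipschitz:
  assumes ac: "absolutely_continuous_real g"
    and bd: "AE x in lebesgue. g differentiable at x \<and> \<bar>deriv g x\<bar> \<le> C"
  shows "\<bar>g y - g x\<bar> \<le> C * \<bar>y - x\<bar>"
proof -
  obtain N where N: "negligible N" "{x. \<not> (g differentiable at x \<and> \<bar>deriv g x\<bar> \<le> C)} \<subseteq> N"
    using bd unfolding eventually_ae_filter_negligible by auto
  have main: "\<bar>g b - g a\<bar> \<le> (C + e) * (b - a) + e" if ab: "a < b" and e: "e > 0" for a b e
  proof -
    obtain d where d: "d > 0"
      and ac: "\<And>G. intervals G \<Longrightarrow> (\<Sum>K\<in>G. incr (\<lambda>x. x) K) < d \<Longrightarrow> (\<Sum>K\<in>G. \<bar>incr g K\<bar>) < e"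
      using absolutely_continuous_intervals[OF ac e] by blast
    define E where "E = {a<..<b} - N"
    have E: "E \<in> lmeasurable" unfolding E_def by (intro fmeasurable_Diff) (use N negligible_iff_measure in auto)
    have Em: "measure lebesgue E = b - a"
      unfolding E_def using ab measure_Diff_null_set[of "{a<..<b}" lebesgue N] N(1)
      by (simp add: negligible_iff_null_sets)
    obtain Q where Q: "intervals Q"
      "\<And>J. J \<in> Q \<Longrightarrow> \<exists>u v. u < v \<and> J = {u..v} \<and> {u..v} \<subseteq> {a<..<b} \<and> \<bar>g v - g u\<bar> \<le> (C + e) * (v - u)"
      "measure lebesgue (E - \<Union>Q) < d"
    proof (rule Vitali_intervals[OF E d, of "\<lambda>u v. {u..v} \<subseteq> {a<..<b} \<and> \<bar>g v - g u\<bar> \<le> (C + e) * (v - u)"])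
      fix x and r :: real assume x: "x \<in> E" "0 < r"
      then obtain \<rho> where \<rho>: "\<rho> > 0" "ball x \<rho> \<subseteq> {a<..<b}"
        using openE[of "{a<..<b}" x] by (auto simp: E_def)
      have gd: "g differentiable at x" "\<bar>deriv g x\<bar> \<le> C" using x N(2) by (auto simp: E_def)
      then have "(g has_derivative (*) (deriv g x)) (at x)"
        using DERIV_deriv_iff_real_differentiable has_field_derivative_def by blast
      then obtain \<eta> where \<eta>: "\<eta> > 0" "\<And>y. norm (y - x) < \<eta> \<Longrightarrow> norm (g y - g x - deriv g x * (y - x)) \<le> e * norm (y - x)"
        unfolding has_derivative_at_alt using e by blast
      define h where "h = min r (min \<rho> \<eta>) / 2"
      have h: "h > 0" "h < r" "h < \<rho>" "h < \<eta>" using x(2) \<rho>(1) \<eta>(1) by (auto simp: h_def)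
      have "\<bar>g (x + h) - g x\<bar> \<le> (C + e) * h"
      proof -
        have "\<bar>g (x + h) - g x - deriv g x * h\<bar> \<le> e * h" using \<eta>(2)[of "x + h"] h by simp
        moreover have "\<bar>deriv g x * h\<bar> \<le> C * h" using gd h by (simp add: abs_mult mult_right_mono)
        ultimately show ?thesis by (simp add: algebra_simps)
      qed
      moreover have "{x..x + h} \<subseteq> ball x \<rho>" using h by (auto simp: dist_real_def)
      ultimately show "\<exists>u v. u < v \<and> x \<in> {u..v} \<and> v - u < r \<and> {u..v} \<subseteq> {a<..<b} \<and> \<bar>g v - g u\<bar> \<le> (C + e) * (v - u)"
        using \<rho> h by (intro exI[of _ x] exI[of _ "x + h"]) auto
    qed (use that in auto)
    have Qsub: "\<Union>Q \<subseteq> {a..b}" using Q(2) by fastforce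
    obtain G where G: "intervals G" "\<Union>G \<subseteq> {a..b}"
      "\<And>g. incr g {a..b} = (\<Sum>K\<in>Q. incr g K) + (\<Sum>K\<in>G. incr g K)"
      using fill_gaps[OF Q(1) Qsub ab] by blast
    define LQ where "LQ = (\<Sum>K\<in>Q. incr (\<lambda>x. x) K)"
    define LG where "LG = (\<Sum>K\<in>G. incr (\<lambda>x. x) K)"
    have LQm: "LQ = measure lebesgue (\<Union>Q)" using intervals_measure[OF Q(1)] by (simp add: LQ_def)
    have "b - a \<le> measure lebesgue ((E - \<Union>Q) \<union> \<Union>Q)"
      unfolding Em[symmetric] using E intervals_measure(2)[OF Q(1)]
      by (intro measure_mono_fmeasurable) (auto intro!: fmeasurable.Un fmeasurable_Diff)
    also have "\<dots> \<le> measure lebesgue (E - \<Union>Q) + measure lebesgue (\<Union>Q)"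
      using E intervals_measure(2)[OF Q(1)] by (intro measure_Un_le) (auto simp: fmeasurableD)
    finally have "b - a < d + LQ" using Q(3) LQm by linarith
    moreover have tot: "b - a = LQ + LG" using G(3)[of "\<lambda>x. x"] ab by (simp add: LQ_def LG_def)
    ultimately have "LG < d" by linarith
    then have small: "(\<Sum>K\<in>G. \<bar>incr g K\<bar>) < e" using ac[OF G(1)] by (simp add: LG_def)
    have LG0: "LG \<ge> 0" using G(1) unfolding LG_def by (intro sum_nonneg) (auto simp: intervals_def)
    have "(\<Sum>K\<in>Q. \<bar>incr g K\<bar>) \<le> (C + e) * LQ"
      unfolding LQ_def sum_distrib_left
    proof (rule sum_mono)
      fix K assume "K \<in> Q"
      from Q(2)[OF this] show "\<bar>incr g K\<bar> \<le> (C + e) * incr (\<lambda>x. x) K" by auto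
    qed
    moreover have C0: "C \<ge> 0"
    proof -
      have "E \<noteq> {}" using Em ab by auto
      then show ?thesis using N(2) by (fastforce simp: E_def)
    qed
    then have "(C + e) * LQ \<le> (C + e) * (b - a)"
      using tot LG0 e by (intro mult_left_mono) auto
    moreover have "\<bar>g b - g a\<bar> \<le> (\<Sum>K\<in>Q. \<bar>incr g K\<bar>) + (\<Sum>K\<in>G. \<bar>incr g K\<bar>)"
      using G(3)[of g] ab sum_abs[of "incr g" Q] sum_abs[of "incr g" G] by (simp; linarith)
    ultimately show ?thesis using small by linarith
  qed
  have main2: "\<bar>g b - g a\<bar> \<le> C * (b - a)" if ab: "a < b" for a b
  proof (rule field_le_epsilon)
    fix e :: real assume e: "e > 0"
    define k where "k = e / (b - a + 1)"
    have k: "k > 0" "e = k * (b - a + 1)" using e ab by (auto simp: k_def)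
    have "\<bar>g b - g a\<bar> \<le> (C + k) * (b - a) + k" using main[OF ab k(1)] .
    also have "\<dots> = C * (b - a) + e" using k(2) by (simp add: algebra_simps)
    finally show "\<bar>g b - g a\<bar> \<le> C * (b - a) + e" .
  qed
  consider "x < y" | "x = y" | "y < x" by linarith
  then show ?thesis
    using main2[of x y] main2[of y x] by cases (auto simp: abs_minus_commute)
qed

section \<open>Jets and the trace seminorm\<close>

text \<open>\<open>jet n C D\<close> says that \<open>D 0\<close> lies in \<open>L_inf (n + 1)\<close> with seminorm at most \<open>C\<close>, with
  successive derivatives \<open>D 0, \<dots>, D n\<close>.\<close>

definition jet :: "nat \<Rightarrow> real \<Rightarrow> (nat \<Rightarrow> real \<Rightarrow> real) \<Rightarrow> bool" where
  "jet n C D \<longleftrightarrow> (\<forall>k<n. \<forall>x. (D k has_real_derivative D (Suc k) x) (at x)) \<and>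
     (\<forall>x y. \<bar>D n x - D n y\<bar> \<le> C * \<bar>x - y\<bar>)"

lemma lipschitz_imp_absolutely_continuous:
  assumes "\<And>x y. \<bar>g x - g y\<bar> \<le> C * \<bar>x - y\<bar>"
  shows "absolutely_continuous_real g"
  unfolding absolutely_continuous_real_def
proof (intro allI impI)
  fix e :: real assume e: "e > 0"
  have C: "C \<ge> 0" using assms[of 0 1] by (auto intro: order_trans[OF abs_ge_zero])
  show "\<exists>d>0. \<forall>(n::nat) a b. (\<forall>i<n. a i \<le> b i) \<and> disjoint_family_on (\<lambda>i. {a i<..<b i}) {..<n} \<and>
        (\<Sum>i<n. b i - a i) < d \<longrightarrow> (\<Sum>i<n. \<bar>g (b i) - g (a i)\<bar>) < e"
  \<comment> \<open>\<open>C + 1\<close> in place of \<open>C\<close> avoids a division by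
    zero.\<close>
  proof (intro exI[of _ "e / (C + 1)"] conjI allI impI)
    show "0 < e / (C + 1)" using e C by simp
    fix n :: nat and a b :: "nat \<Rightarrow> real"
    assume h: "(\<forall>i<n. a i \<le> b i) \<and> disjoint_family_on (\<lambda>i. {a i<..<b i}) {..<n} \<and> (\<Sum>i<n. b i - a i) < e / (C + 1)"
    have "(\<Sum>i<n. \<bar>g (b i) - g (a i)\<bar>) \<le> (\<Sum>i<n. (C + 1) * (b i - a i))"
    proof (rule sum_mono)
      fix i assume "i \<in> {..<n}"
      then have i: "a i \<le> b i" using h by auto
      then have "\<bar>g (b i) - g (a i)\<bar> \<le> C * (b i - a i)" using assms[of "b i" "a i"] by simp
      then show "\<bar>g (b i) - g (a i)\<bar> \<le> (C + 1) * (b i - a i)" using i by (simp add: algebra_simps)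
    qed
    also have "\<dots> = (C + 1) * (\<Sum>i<n. b i - a i)" by (simp add: sum_distrib_left)
    also have "\<dots> < (C + 1) * (e / (C + 1))" using h C by (intro mult_strict_left_mono) auto
    also have "\<dots> = e" using C by simp
    finally show "(\<Sum>i<n. \<bar>g (b i) - g (a i)\<bar>) < e" .
  qed
qed

text \<open>Where \<open>g\<close> is differentiable, \<open>deriv g\<close> is the limit of the
  difference quotients with increments \<open>1 / Suc n\<close>, and \<open>lim\<close> of Borel
  functions is Borel even where the sequence diverges. Equality almost everywhere is enough since
  Lebesgue measure is complete. Without measurability \<open>esssup\<close> would be
  infinite.\<close>

lemma deriv_measurable_lebesgue:
  fixes g :: "real \<Rightarrow> real"
  assumes cont: "continuous_on UNIV g" and ae: "AE x in lebesgue. g differentiable at x"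
  shows "deriv g \<in> borel_measurable lebesgue"
proof -
  have gm: "g \<in> borel_measurable borel" using cont by (rule borel_measurable_continuous_onI)
  define h where "h x = lim (\<lambda>n. (g (x + 1 / real (Suc n)) - g x) / (1 / real (Suc n)))" for x
  have hm: "h \<in> borel_measurable borel" unfolding h_def using gm by measurable
  then have "h \<in> borel_measurable lborel" by (metis measurable_lborel2)
  then have hm': "h \<in> borel_measurable lebesgue" by (rule measurable_completion)
  have eq: "deriv g x = h x" if "g differentiable at x" for x
  proof -
    have "(g has_real_derivative deriv g x) (at x)"
      using that DERIV_deriv_iff_real_differentiable by blast
    then have "((\<lambda>k. (g (x + k) - g x) / k) \<longlongrightarrow> deriv g x) (at 0)" by (simp add: DERIV_def)
    moreover have "filterlim (\<lambda>n. 1 / real (Suc n)) (at 0) sequentially"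
      using LIMSEQ_inverse_real_of_nat by (intro filterlim_atI) (auto simp: inverse_eq_divide)
    ultimately have "(\<lambda>n. (g (x + 1 / real (Suc n)) - g x) / (1 / real (Suc n))) \<longlonglongrightarrow> deriv g x"
      by (rule filterlim_compose)
    then show ?thesis unfolding h_def by (rule limI[symmetric])
  qed
  show ?thesis
  proof (rule measurableI)
    fix A :: "real set" assume A: "A \<in> sets borel"
    have "h -` A \<inter> space lebesgue \<in> sets lebesgue" using hm' A by (rule measurable_sets)
    then show "deriv g -` A \<inter> space lebesgue \<in> sets lebesgue"
    proof (rule completion.in_sets_AE[rotated])
      show "AE x in lebesgue. (x \<in> h -` A \<inter> space lebesgue) = (x \<in> deriv g -` A \<inter> space lebesgue)"
        using ae by (rule AE_mp) (auto simp: eq)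
    qed auto
  qed auto
qed

lemma jet_nonneg:
  assumes "jet n C D"
  shows "0 \<le> C"
proof -
  have "\<bar>D n 1 - D n 0\<bar> \<le> C * \<bar>1 - 0\<bar>" using assms unfolding jet_def by blast
  then show ?thesis by simp
qed

lemma jet_funpow_deriv:
  assumes "jet n C D" "k \<le> n"
  shows "(deriv ^^ k) (D 0) = D k"
  using \<open>k \<le> n\<close>
proof (induction k)
  case (Suc k)
  then have "(deriv ^^ k) (D 0) = D k" by simp
  moreover have "deriv (D k) = D (Suc k)"
    using assms(1) Suc.prems by (intro ext DERIV_imp_deriv) (auto simp: jet_def)
  ultimately show ?case by simp
qed simp

lemma jet_in_L_inf:
  assumes j: "jet n C D"
  shows "D 0 \<in> L_inf (Suc n)" "L_inf_seminorm (Suc n) (D 0) \<le> ereal C"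
proof -
  have D: "(deriv ^^ k) (D 0) = D k" if "k \<le> n" for k using jet_funpow_deriv[OF j that] .
  have lip: "\<bar>D n x - D n y\<bar> \<le> C * \<bar>x - y\<bar>" for x y using j by (simp add: jet_def)
  have ac: "absolutely_continuous_real (D n)"
    using lipschitz_imp_absolutely_continuous[of "D n" C] lip by blast
  have ae: "AE x in lebesgue. D n differentiable at x"
    by (rule absolutely_continuous_differentiable_AE[OF ac])
  have bd: "\<bar>deriv (D n) x\<bar> \<le> C" if "D n differentiable at x" for x
  proof -
    have "(D n has_real_derivative deriv (D n) x) (at x)"
      using that DERIV_deriv_iff_real_differentiable by blast
    then have "((\<lambda>y. (D n y - D n x) / (y - x)) \<longlongrightarrow> deriv (D n) x) (at x)"
      by (simp add: has_field_derivative_iff)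
    then have "((\<lambda>y. \<bar>(D n y - D n x) / (y - x)\<bar>) \<longlongrightarrow> \<bar>deriv (D n) x\<bar>) (at x)"
      by (rule tendsto_rabs)
    moreover have "\<forall>\<^sub>F y in at x. \<bar>(D n y - D n x) / (y - x)\<bar> \<le> C"
    proof -
      have "\<bar>(D n y - D n x) / (y - x)\<bar> \<le> C" if "y \<noteq> x" for y
        using lip[of y x] that by (simp add: abs_divide divide_le_eq)
      then show ?thesis by (auto simp: eventually_at intro!: exI[of _ 1])
    qed
    ultimately show ?thesis by (intro tendsto_upperbound) auto
  qed
  have cont: "continuous_on UNIV (D n)"
    using absolutely_continuous_imp_continuous[OF ac] by (simp add: continuous_at_imp_continuous_on)
  have m: "(\<lambda>x. ereal \<bar>deriv (D n) x\<bar>) \<in> borel_measurable lebesgue"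
    using deriv_measurable_lebesgue[OF cont ae] by measurable
  show s: "L_inf_seminorm (Suc n) (D 0) \<le> ereal C"
    unfolding L_inf_seminorm_def
  proof (rule esssup_I)
    show "(\<lambda>x. ereal \<bar>(deriv ^^ Suc n) (D 0) x\<bar>) \<in> borel_measurable lebesgue" using m D[of n] by simp
    show "AE x in lebesgue. ereal \<bar>(deriv ^^ Suc n) (D 0) x\<bar> \<le> ereal C"
      using ae by (rule AE_mp) (auto simp: D[of n] bd)
  qed
  show "D 0 \<in> L_inf (Suc n)"
    unfolding L_inf_def
  proof (intro CollectI conjI allI impI)
    show "absolutely_continuous_real ((deriv ^^ (Suc n - 1)) (D 0))" using ac D[of n] by simp
    show "L_inf_seminorm (Suc n) (D 0) < \<infinity>" using s by (rule order.strict_trans1) simp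
    fix k x assume "k < Suc n - 1"
    then have k: "k < n" by simp
    then have "(D k has_real_derivative D (Suc k) x) (at x)" using j by (simp add: jet_def)
    then show "(deriv ^^ k) (D 0) differentiable at x"
      using D[of k] k real_differentiable_def by force
  qed
qed

lemma L_inf_imp_jet:
  assumes F: "F \<in> L_inf (Suc n)" and s: "L_inf_seminorm (Suc n) F \<le> ereal C"
  shows "jet n C (\<lambda>k. (deriv ^^ k) F)"
  unfolding jet_def
proof (intro conjI allI impI)
  fix k x assume "k < n"
  then have "(deriv ^^ k) F differentiable at x" using F by (simp add: L_inf_def)
  then show "((deriv ^^ k) F has_real_derivative (deriv ^^ Suc k) F x) (at x)"
    using DERIV_deriv_iff_real_differentiable by fastforce
next
  fix x y
  let ?g = "(deriv ^^ n) F"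
  have ac: "absolutely_continuous_real ?g" using F by (simp add: L_inf_def)
  have "AE x in lebesgue. ereal \<bar>(deriv ^^ Suc n) F x\<bar> \<le> L_inf_seminorm (Suc n) F"
    unfolding L_inf_seminorm_def by (rule esssup_AE)
  then have "AE x in lebesgue. \<bar>deriv ?g x\<bar> \<le> C"
    by (rule AE_mp) (use s order_trans in \<open>fastforce intro!: AE_I2\<close>)
  then have "AE x in lebesgue. ?g differentiable at x \<and> \<bar>deriv ?g x\<bar> \<le> C"
    using absolutely_continuous_differentiable_AE[OF ac] by eventually_elim simp
  then show "\<bar>?g x - ?g y\<bar> \<le> C * \<bar>x - y\<bar>"
    using absolutely_continuous_bounded_deriv_imp_lipschitz[OF ac, of C x y] by blast
qed

lemma trace_seminorm_le_jet:
  assumes "jet n C D" "\<And>x. x \<in> E \<Longrightarrow> D 0 x = f x"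
  shows "trace_seminorm (Suc n) E f \<le> ereal C"
  unfolding trace_seminorm_def
  by (rule Inf_lower2[OF _ jet_in_L_inf(2)[OF assms(1)]]) (use jet_in_L_inf(1)[OF assms(1)] assms(2) in auto)

text \<open>The trace seminorm is an infimum that need not be attained at this stage, so an
  extension is available only for constants strictly above it; hence the slack in later
  uses.\<close>

lemma trace_seminorm_less_imp_jet:
  assumes "trace_seminorm (Suc n) E f < ereal C"
  obtains D where "jet n C D" "\<And>x. x \<in> E \<Longrightarrow> D 0 x = f x"
proof -
  obtain F where "F \<in> L_inf (Suc n)" "\<forall>x\<in>E. F x = f x" "L_inf_seminorm (Suc n) F < ereal C"
    using assms unfolding trace_seminorm_def Inf_less_iff by blast
  then show ?thesis
    using that[of "\<lambda>k. (deriv ^^ k) F"] L_inf_imp_jet[of F n C] by auto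
qed

lemma trace_seminorm_nonneg: "0 \<le> trace_seminorm (Suc n) E f"
proof (rule ccontr)
  assume "\<not> 0 \<le> trace_seminorm (Suc n) E f"
  then have "trace_seminorm (Suc n) E f < ereal 0" by (simp add: zero_ereal_def)
  then obtain C where C: "trace_seminorm (Suc n) E f < ereal C" "C < 0"
    using ereal_dense2 by (metis ereal_less(2) ereal_less_eq(3) less_ereal.simps(1) zero_ereal_def)
  obtain D where "jet n C D" using trace_seminorm_less_imp_jet[OF C(1)] by blast
  from jet_nonneg[OF this] C(2) show False by simp
qed

lemma L_inf_traceE:
  assumes "f \<in> L_inf_trace (Suc n) E"
  obtains D C where "jet n C D" "\<And>x. x \<in> E \<Longrightarrow> D 0 x = f x"
proof -
  obtain F where F: "F \<in> L_inf (Suc n)" "\<forall>x\<in>E. F x = f x" using assms by (auto simp: L_inf_trace_def)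
  have "L_inf_seminorm (Suc n) F < \<infinity>" using F(1) by (simp add: L_inf_def)
  then obtain C where "L_inf_seminorm (Suc n) F \<le> ereal C"
    by (metis ereal_dense2 less_imp_le less_ereal.simps(4) not_less_iff_gr_or_eq)
  from L_inf_imp_jet[OF F(1) this] show ?thesis using that[of C "\<lambda>k. (deriv ^^ k) F"] F(2) by simp
qed

section \<open>Divided differences\<close>

definition lagrange_poly :: "real set \<Rightarrow> (real \<Rightarrow> real) \<Rightarrow> real poly" where
  "lagrange_poly S f = (\<Sum>x\<in>S. smult (f x / (\<Prod>y\<in>S - {x}. x - y)) (\<Prod>y\<in>S - {x}. [:- y, 1:]))"

text \<open>Lagrange's formula for the leading coefficient of the interpolating polynomial. Taking
  the nodes as a set makes symmetry in the nodes automatic.\<close>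

definition divided_difference :: "real set \<Rightarrow> (real \<Rightarrow> real) \<Rightarrow> real" where
  "divided_difference S f = (\<Sum>x\<in>S. f x / (\<Prod>y\<in>S - {x}. x - y))"

lemma coeff_prod_linear:
  fixes S :: "real set"
  assumes "finite S"
  shows "coeff (\<Prod>y\<in>S. [:- y, 1:]) (card S) = 1" "i > card S \<Longrightarrow> coeff (\<Prod>y\<in>S. [:- y, 1:]) i = 0"
proof -
  have d: "degree (\<Prod>y\<in>S. [:- y, 1:]) = card S"
    by (subst degree_prod_eq_sum_degree) auto
  have "lead_coeff (\<Prod>y\<in>S. [:- y, 1:]) = 1" by (simp add: lead_coeff_prod)
  then show "coeff (\<Prod>y\<in>S. [:- y, 1:]) (card S) = 1" by (simp add: d)
  show "coeff (\<Prod>y\<in>S. [:- y, 1:]) i = 0" if "i > card S" using that d by (simp add: coeff_eq_0)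
qed

lemma poly_lagrange_poly:
  assumes "finite S" "x \<in> S"
  shows "poly (lagrange_poly S f) x = f x"
proof -
  have "poly (lagrange_poly S f) x = (\<Sum>z\<in>S. f z / (\<Prod>y\<in>S - {z}. z - y) * (\<Prod>y\<in>S - {z}. x - y))"
    by (simp add: lagrange_poly_def poly_sum poly_prod)
  also have "\<dots> = (\<Sum>z\<in>S. if z = x then f x else 0)"
  proof (rule sum.cong)
    fix z assume z: "z \<in> S"
    show "f z / (\<Prod>y\<in>S - {z}. z - y) * (\<Prod>y\<in>S - {z}. x - y) = (if z = x then f x else 0)"
    proof (cases "z = x")
      case True
      have "(\<Prod>y\<in>S - {x}. x - y) \<noteq> 0" using assms(1) by (auto simp: prod_zero_iff)
      then show ?thesis using True by simp
    next
      case False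
      then have "(\<Prod>y\<in>S - {z}. x - y) = 0" using assms by (auto simp: prod_zero_iff)
      then show ?thesis using False by simp
    qed
  qed simp
  also have "\<dots> = f x" using assms by simp
  finally show ?thesis .
qed

lemma coeff_lagrange_poly:
  assumes "finite S"
  shows "i \<ge> card S \<Longrightarrow> coeff (lagrange_poly S f) i = 0"
    "coeff (lagrange_poly S f) (card S - 1) = divided_difference S f"
proof -
  have c: "card (S - {x}) = card S - 1" if "x \<in> S" for x using that assms by simp
  have p: "card S > 0" if "x \<in> S" for x using that assms card_gt_0_iff by blast
  have "coeff (\<Prod>y\<in>S - {x}. [:- y, 1:]) i = 0" if "i \<ge> card S" "x \<in> S" for x
    using coeff_prod_linear(2)[of "S - {x}" i] assms c[OF that(2)] p[OF that(2)] that by simp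
  then show "coeff (lagrange_poly S f) i = 0" if "i \<ge> card S"
    using that by (simp add: lagrange_poly_def coeff_sum)
  have "coeff (\<Prod>y\<in>S - {x}. [:- y, 1:]) (card S - 1) = 1" if "x \<in> S" for x
    using coeff_prod_linear(1)[of "S - {x}"] assms c[OF that] by simp
  then show "coeff (lagrange_poly S f) (card S - 1) = divided_difference S f"
    by (simp add: lagrange_poly_def divided_difference_def coeff_sum)
qed

text \<open>Agreement of the coefficients from degree \<open>card S\<close> on gives
  \<open>p - q\<close> more zeros than its degree, while \<open>p\<close> and \<open>q\<close>
  themselves may have larger degree.\<close>

lemma interpolation_unique:
  fixes p q :: "real poly"
  assumes "finite S" "\<And>i. i \<ge> card S \<Longrightarrow> coeff p i = coeff q i" "\<And>x. x \<in> S \<Longrightarrow> poly p x = poly q x"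
  shows "p = q"
proof (rule ccontr)
  define r where "r = p - q"
  assume "p \<noteq> q"
  then have r: "r \<noteq> 0" by (simp add: r_def)
  have "degree r < card S"
  proof (rule ccontr)
    assume "\<not> degree r < card S"
    then have "lead_coeff r = 0" using assms(2) by (simp add: r_def)
    then show False using r by simp
  qed
  moreover have "card S \<le> card {x. poly r x = 0}"
    using assms(3) poly_roots_finite[OF r] by (intro card_mono) (auto simp: r_def)
  moreover have "card {x. poly r x = 0} \<le> degree r" using card_poly_roots_bound[OF r] .
  ultimately show False by simp
qed

text \<open>Subtracting the multiple of the node polynomial removes the coefficient of degree
  \<open>card S - 1\<close> and changes no value at the remaining nodes, so uniqueness identifies
  the result.\<close>

lemma lagrange_poly_Newton:
  assumes "finite S" "b \<in> S"
  shows "lagrange_poly S f = lagrange_poly (S - {b}) f + smult (divided_difference S f) (\<Prod>y\<in>S - {b}. [:- y, 1:])"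
proof -
  have c: "card S = Suc (card (S - {b}))" using assms by (metis card.remove)
  have "lagrange_poly S f - smult (divided_difference S f) (\<Prod>y\<in>S - {b}. [:- y, 1:]) = lagrange_poly (S - {b}) f"
  proof (rule interpolation_unique[of "S - {b}"])
    show "finite (S - {b})" using assms by simp
    fix i assume i: "i \<ge> card (S - {b})"
    have z: "coeff (lagrange_poly (S - {b}) f) i = 0"
      using coeff_lagrange_poly(1)[of "S - {b}" i] assms i by simp
    show "coeff (lagrange_poly S f - smult (divided_difference S f) (\<Prod>y\<in>S - {b}. [:- y, 1:])) i
      = coeff (lagrange_poly (S - {b}) f) i"
    proof (cases "i = card (S - {b})")
      case True
      have "coeff (lagrange_poly S f) i = divided_difference S f"
        using coeff_lagrange_poly(2)[OF assms(1), of f] c True by simp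
      moreover have "coeff (\<Prod>y\<in>S - {b}. [:- y, 1:]) i = 1"
        unfolding True using assms(1) by (intro coeff_prod_linear(1)) simp
      ultimately show ?thesis using z by simp
    next
      case False
      then have "i > card (S - {b})" using i by simp
      then have "coeff (lagrange_poly S f) i = 0" "coeff (\<Prod>y\<in>S - {b}. [:- y, 1:]) i = 0"
        using coeff_lagrange_poly(1)[OF assms(1), of i f] c coeff_prod_linear(2)[of "S - {b}" i] assms(1) by simp_all
      then show ?thesis using z by simp
    qed
  next
    fix x assume x: "x \<in> S - {b}"
    then have "(\<Prod>y\<in>S - {b}. x - y) = 0" using assms by (auto simp: prod_zero_iff)
    then show "poly (lagrange_poly S f - smult (divided_difference S f) (\<Prod>y\<in>S - {b}. [:- y, 1:])) x
      = poly (lagrange_poly (S - {b}) f) x"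
      using x assms by (simp add: poly_prod poly_lagrange_poly)
  qed
  then show ?thesis by (simp add: algebra_simps)
qed

text \<open>Newton's formula with \<open>a\<close> and with \<open>b\<close> as the last node
  expresses the same polynomial twice, and the two node polynomials differ by the factor
  \<open>(x - a) - (x - b) = b - a\<close>. This factor later compensates for differentiating a step
  of length \<open>b - a\<close>.\<close>

lemma lagrange_poly_exchange:
  assumes "finite S" "a \<in> S" "b \<in> S" "a \<noteq> b"
  shows "lagrange_poly (S - {a}) f - lagrange_poly (S - {b}) f
    = smult (divided_difference S f * (b - a)) (\<Prod>y\<in>S - {a, b}. [:- y, 1:])"
proof -
  let ?M = "\<Prod>y\<in>S - {a, b}. [:- y, 1:]"
  have 1: "(\<Prod>y\<in>S - {b}. [:- y, 1:]) = [:- a, 1:] * ?M"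
    using prod.remove[of "S - {b}" a "\<lambda>y. [:- y, 1:]"] assms by (simp add: Diff_insert2[symmetric] insert_commute)
  have 2: "(\<Prod>y\<in>S - {a}. [:- y, 1:]) = [:- b, 1:] * ?M"
    using prod.remove[of "S - {a}" b "\<lambda>y. [:- y, 1:]"] assms by (simp add: Diff_insert2[symmetric])
  have "lagrange_poly (S - {a}) f - lagrange_poly (S - {b}) f
    = smult (divided_difference S f) (\<Prod>y\<in>S - {b}. [:- y, 1:]) - smult (divided_difference S f) (\<Prod>y\<in>S - {a}. [:- y, 1:])"
    using lagrange_poly_Newton[OF assms(1,2), of f] lagrange_poly_Newton[OF assms(1,3), of f] by (simp add: algebra_simps)
  also have "\<dots> = smult (divided_difference S f) (([:- a, 1:] - [:- b, 1:]) * ?M)"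
    unfolding 1 2 by (simp only: smult_diff_right left_diff_distrib)
  also have "[:- a, 1:] - [:- b, 1:] = [:b - a:]" by simp
  finally show ?thesis by simp
qed

text \<open>The half-open range drives the induction: without the largest zero there are zeros of
  \<open>f'\<close> strictly left of \<open>Max Z0\<close>, and Rolle's theorem between
  \<open>Max Z0\<close> and \<open>Max Z\<close> adds one strictly to the right of it, hence a new
  one.\<close>

lemma Rolle_zeros:
  fixes f f' :: "real \<Rightarrow> real"
  assumes "finite Z" "card Z = Suc k" "\<And>z. z \<in> Z \<Longrightarrow> f z = 0" "\<And>x. (f has_real_derivative f' x) (at x)"
  shows "\<exists>Z'. finite Z' \<and> card Z' = k \<and> (\<forall>z\<in>Z'. f' z = 0 \<and> Min Z \<le> z \<and> z < Max Z)"
  using assms(1-3)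
proof (induction k arbitrary: Z)
  case 0
  then show ?case by (intro exI[of _ "{}"]) simp
next
  case (Suc k)
  define M where "M = Max Z"
  define Z0 where "Z0 = Z - {M}"
  have ne: "Z \<noteq> {}" using Suc.prems by auto
  have M: "M \<in> Z" using Suc.prems(1) ne by (simp add: M_def)
  have Z0: "finite Z0" "card Z0 = Suc k" using Suc.prems M by (auto simp: Z0_def)
  then have ne0: "Z0 \<noteq> {}" by auto
  obtain Z0' where Z0': "finite Z0'" "card Z0' = k" "\<forall>z\<in>Z0'. f' z = 0 \<and> Min Z0 \<le> z \<and> z < Max Z0"
    using Suc.IH[OF Z0] Suc.prems(3) by (auto simp: Z0_def)
  have M0: "Max Z0 \<in> Z" "Max Z0 \<noteq> M" using Max_in[OF Z0(1) ne0] by (auto simp: Z0_def)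
  then have lt: "Max Z0 < M" using Max_ge[OF Suc.prems(1)] by (force simp: M_def)
  have mn: "Min Z \<le> Min Z0" using Min_antimono[of Z0 Z] ne0 Suc.prems(1) by (auto simp: Z0_def)
  have "\<exists>z>Max Z0. z < M \<and> DERIV f z :> 0"
  proof (rule Rolle[OF lt])
    show "f (Max Z0) = f M" using Suc.prems(3) M M0 by simp
    show "continuous_on {Max Z0..M} f"
      using assms(4) by (meson DERIV_isCont continuous_at_imp_continuous_on)
    show "f differentiable at x" for x using assms(4) real_differentiable_def by blast
  qed
  then obtain z where z: "Max Z0 < z" "z < M" "DERIV f z :> 0" by blast
  then have "f' z = 0" using assms(4) DERIV_unique by blast
  moreover have "Min Z0 \<le> Max Z0" using Z0(1) ne0 by simp
  moreover have "z \<notin> Z0'" using Z0'(3) z(1) by fastforce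
  moreover have "Min Z \<le> y \<and> y < M" if "y \<in> Z0'" for y
  proof -
    have "Min Z0 \<le> y" "y < Max Z0" using Z0'(3) that by auto
    then show ?thesis using mn lt by linarith
  qed
  ultimately show ?case
    using Z0' z mn by (intro exI[of _ "insert z Z0'"]) (auto simp: M_def[symmetric])
qed

lemma iterated_Rolle_zeros:
  fixes D :: "nat \<Rightarrow> real \<Rightarrow> real"
  assumes D: "\<And>k x. k < n \<Longrightarrow> (D k has_real_derivative D (Suc k) x) (at x)"
    and Z: "finite Z" "Z \<subseteq> {a..b}" "\<And>z. z \<in> Z \<Longrightarrow> D 0 z = 0"
    and "k \<le> n" "k < card Z"
  shows "\<exists>Z'. finite Z' \<and> card Z' = card Z - k \<and> Z' \<subseteq> {a..b} \<and> (\<forall>z\<in>Z'. D k z = 0)"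
  using \<open>k \<le> n\<close> \<open>k < card Z\<close>
proof (induction k)
  case 0
  then show ?case using Z by (intro exI[of _ Z]) auto
next
  case (Suc k)
  then obtain Z' where Z': "finite Z'" "card Z' = card Z - k" "Z' \<subseteq> {a..b}" "\<forall>z\<in>Z'. D k z = 0" by auto
  have "card Z' = Suc (card Z - Suc k)" using Z'(2) Suc.prems by simp
  from Rolle_zeros[OF Z'(1) this, of "D k" "D (Suc k)"] Z'(4) D[of k] Suc.prems
  obtain Y where Y: "finite Y" "card Y = card Z - Suc k" "\<forall>z\<in>Y. D (Suc k) z = 0 \<and> Min Z' \<le> z \<and> z < Max Z'"
    by auto
  have "Z' \<noteq> {}" using Z'(2) Suc.prems by auto
  then have "Min Z' \<ge> a" "Max Z' \<le> b" using Z'(1,3) by (auto simp: subset_iff)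
  then show ?case using Y by (intro exI[of _ Y]) (force)
qed

lemma poly_higher_pderiv_affine:
  fixes p :: "real poly"
  assumes "\<And>i. i > Suc n \<Longrightarrow> coeff p i = 0"
  shows "poly ((pderiv ^^ n) p) x - poly ((pderiv ^^ n) p) y = fact (Suc n) * coeff p (Suc n) * (x - y)"
proof -
  have c: "coeff ((pderiv ^^ n) p) i = pochhammer (of_nat (Suc i)) n * coeff p (i + n)" for i
    by (rule coeff_higher_pderiv)
  have "pochhammer (1::real) (Suc n) = 1 * pochhammer (1 + 1) n" by (rule pochhammer_rec)
  then have "pochhammer (2::real) n = fact (Suc n)" by (simp add: pochhammer_fact)
  then have c1: "coeff ((pderiv ^^ n) p) 1 = fact (Suc n) * coeff p (Suc n)" using c[of 1] by simp
  have "(pderiv ^^ n) p = [:coeff ((pderiv ^^ n) p) 0, coeff ((pderiv ^^ n) p) 1:]"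
  proof (rule poly_eqI)
    fix i :: nat
    consider "i = 0" | "i = 1" | "i \<ge> 2" by linarith
    then show "coeff ((pderiv ^^ n) p) i = coeff [:coeff ((pderiv ^^ n) p) 0, coeff ((pderiv ^^ n) p) 1:] i"
    proof cases
      case 3
      then have "coeff ((pderiv ^^ n) p) i = 0" using c[of i] assms[of "i + n"] by simp
      then show ?thesis using 3 by (auto simp: coeff_pCons split: nat.splits)
    qed (auto simp: coeff_pCons)
  qed
  then have "poly ((pderiv ^^ n) p) z = coeff ((pderiv ^^ n) p) 0 + z * coeff ((pderiv ^^ n) p) 1" for z
    by (metis add.right_neutral mult_zero_right poly_0 poly_pCons)
  then show ?thesis using c1 by (simp add: algebra_simps)
qed

lemma DERIV_higher_pderiv:
  fixes p :: "real poly"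
  shows "(poly ((pderiv ^^ k) p) has_real_derivative poly ((pderiv ^^ Suc k) p) x) (at x)"
  using poly_DERIV[of "(pderiv ^^ k) p" x] by simp

lemma jet_poly:
  fixes p :: "real poly"
  assumes "\<And>i. i > Suc n \<Longrightarrow> coeff p i = 0"
  shows "jet n (fact (Suc n) * \<bar>coeff p (Suc n)\<bar>) (\<lambda>k. poly ((pderiv ^^ k) p))"
  unfolding jet_def using DERIV_higher_pderiv poly_higher_pderiv_affine[of n p, OF assms]
  by (auto simp: abs_mult)

text \<open>\<open>D 0\<close> minus its interpolating polynomial has \<open>n + 2\<close> zeros, so
  its derivative of order \<open>n\<close> still has two. Between them \<open>D n\<close> has the
  increment of an affine function of slope \<open>fact (Suc n)\<close> times the divided difference,
  and the Lipschitz bound applies. Stopping at order \<open>n\<close> avoids the derivative that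
  exists only almost everywhere.\<close>

lemma divided_difference_le_jet:
  assumes j: "jet n C D" and S: "card S = n + 2"
  shows "fact (Suc n) * \<bar>divided_difference S (D 0)\<bar> \<le> C"
proof -
  have fin: "finite S" using S by (intro card_ge_0_finite) simp
  define p where "p = lagrange_poly S (D 0)"
  have p0: "coeff p i = 0" if "i > Suc n" for i
    using coeff_lagrange_poly(1)[OF fin, of i] that S by (simp add: p_def)
  have p1: "coeff p (Suc n) = divided_difference S (D 0)"
    using coeff_lagrange_poly(2)[OF fin, of "D 0"] S by (simp add: p_def)
  define E where "E k x = D k x - poly ((pderiv ^^ k) p) x" for k x
  have "\<exists>Z'. finite Z' \<and> card Z' = card S - n \<and> Z' \<subseteq> {Min S..Max S} \<and> (\<forall>z\<in>Z'. E n z = 0)"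
  proof (rule iterated_Rolle_zeros[of n E])
    show "(E k has_real_derivative E (Suc k) x) (at x)" if "k < n" for k x
      unfolding E_def using j that by (intro DERIV_diff DERIV_higher_pderiv) (auto simp: jet_def)
    show "E 0 z = 0" if "z \<in> S" for z
      using poly_lagrange_poly[OF fin that] by (simp add: E_def p_def)
    show "S \<subseteq> {Min S..Max S}" using fin by auto
  qed (use fin S in auto)
  then obtain Z' where Z': "card Z' = 2" "\<forall>z\<in>Z'. E n z = 0" using S by auto
  then obtain x y where xy: "x \<in> Z'" "y \<in> Z'" "x \<noteq> y" by (metis card_2_iff')
  have "D n x - D n y = fact (Suc n) * coeff p (Suc n) * (x - y)"
    using Z'(2) xy poly_higher_pderiv_affine[of n p x y, OF p0] by (auto simp: E_def)
  moreover have "\<bar>D n x - D n y\<bar> \<le> C * \<bar>x - y\<bar>" using j by (simp add: jet_def)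
  ultimately have "fact (Suc n) * \<bar>coeff p (Suc n)\<bar> * \<bar>x - y\<bar> \<le> C * \<bar>x - y\<bar>"
    by (simp add: abs_mult)
  then show ?thesis using xy(3) p1 by simp
qed

lemma divided_difference_cong:
  "(\<And>x. x \<in> S \<Longrightarrow> f x = g x) \<Longrightarrow> divided_difference S f = divided_difference S g"
  by (simp add: divided_difference_def)

text \<open>The interpolating polynomial is the extension: its derivative of order \<open>n\<close>
  is affine.\<close>

lemma trace_seminorm_le_divided_difference:
  assumes S: "card S = n + 2"
  shows "trace_seminorm (Suc n) S f \<le> ereal (fact (Suc n) * \<bar>divided_difference S f\<bar>)"
proof -
  have fin: "finite S" using S by (intro card_ge_0_finite) simp
  have "coeff (lagrange_poly S f) i = 0" if "i > Suc n" for i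
    using coeff_lagrange_poly(1)[OF fin, of i] that S by simp
  from jet_poly[OF this] have "trace_seminorm (Suc n) S f \<le> ereal (fact (Suc n) * \<bar>coeff (lagrange_poly S f) (Suc n)\<bar>)"
    by (rule trace_seminorm_le_jet) (auto simp: poly_lagrange_poly[OF fin])
  then show ?thesis using coeff_lagrange_poly(2)[OF fin, of f] S by simp
qed

lemma divided_difference_le_trace_seminorm:
  assumes S: "card S = n + 2" and "trace_seminorm (Suc n) S f \<le> ereal C"
  shows "fact (Suc n) * \<bar>divided_difference S f\<bar> \<le> C"
proof (rule field_le_epsilon)
  fix e :: real assume "e > 0"
  then have "trace_seminorm (Suc n) S f < ereal (C + e)" using assms(2) by (simp add: order.strict_trans1)
  then obtain D where D: "jet n (C + e) D" "\<And>x. x \<in> S \<Longrightarrow> D 0 x = f x" using trace_seminorm_less_imp_jet by blast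
  have "fact (Suc n) * \<bar>divided_difference S (D 0)\<bar> \<le> C + e" by (rule divided_difference_le_jet[OF D(1) S])
  moreover have "divided_difference S (D 0) = divided_difference S f"
    by (rule divided_difference_cong) (rule D(2))
  ultimately show "fact (Suc n) * \<bar>divided_difference S f\<bar> \<le> C + e" by simp
qed

text \<open>The largest of \<open>k\<close> distinct positive integers is at least \<open>k\<close>;
  remove it and induct.\<close>

lemma fact_card_le_prod:
  assumes "finite T" "0 \<notin> T"
  shows "fact (card T) \<le> (\<Prod>T :: nat)"
  using assms
proof (induction "card T" arbitrary: T)
  case 0
  then show ?case by simp
next
  case (Suc k)
  define M where "M = Max T"
  have M: "M \<in> T" using Suc by (metis M_def Max_in card.empty nat.distinct(1))
  have "T \<subseteq> {1..M}" using Suc.prems Max_ge[OF Suc.prems(1)] by (auto simp: M_def Suc_le_eq intro: gr0I)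
  then have le: "card T \<le> M" by (metis card_atLeastAtMost card_mono diff_Suc_1 finite_atLeastAtMost)
  have "k = card (T - {M})" using Suc.hyps(2) Suc.prems M by simp
  then have IH: "fact k \<le> \<Prod>(T - {M})" using Suc.hyps(1)[of "T - {M}"] Suc.prems by simp
  have "fact (card T) = card T * fact k" using Suc.hyps(2)[symmetric] by simp
  also have "\<dots> \<le> M * \<Prod>(T - {M})" by (intro mult_mono le IH) auto
  also have "\<dots> = \<Prod>T" using prod.remove[OF Suc.prems(1) M, of "\<lambda>x. x"] by simp
  finally show ?case .
qed

lemma fact_card_le_prod_Ints:
  fixes T :: "real set"
  assumes "finite T" "T \<subseteq> \<int>" "\<And>t. t \<in> T \<Longrightarrow> t > 0"
  shows "fact (card T) \<le> \<Prod>T"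
proof -
  define N where "N = (\<lambda>t. nat \<lfloor>t\<rfloor>) ` T"
  have r: "real (nat \<lfloor>t\<rfloor>) = t" if "t \<in> T" for t
    using that assms(2,3) by (force simp: Ints_def)
  have inj: "inj_on (\<lambda>t. nat \<lfloor>t\<rfloor>) T"
  proof (rule inj_onI)
    fix s t assume st: "s \<in> T" "t \<in> T" and eq: "nat \<lfloor>s\<rfloor> = nat \<lfloor>t\<rfloor>"
    from r[OF st(1)] r[OF st(2)] show "s = t" unfolding eq by (rule trans[OF sym])
  qed
  have "0 \<notin> N" using r assms(3) by (force simp: N_def)
  then have "fact (card N) \<le> \<Prod>N" using assms(1) by (intro fact_card_le_prod) (auto simp: N_def)
  then have "real (fact (card N)) \<le> real (\<Prod>N)" by (simp only: of_nat_le_iff)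
  moreover have "card N = card T" using inj by (simp add: N_def card_image)
  moreover have "real (\<Prod>N) = (\<Prod>t\<in>T. real (nat \<lfloor>t\<rfloor>))"
    unfolding N_def of_nat_prod by (subst prod.reindex[OF inj]) (simp only: comp_def)
  moreover have "\<dots> = \<Prod>T" by (intro prod.cong refl) (rule r)
  ultimately show ?thesis by (simp only: of_nat_fact)
qed

text \<open>Consecutive integers are the worst case. A node with \<open>j x\<close> nodes below it
  has that many distinct positive integer distances downwards and \<open>N - j x\<close> upwards, so
  its weight is at most \<open>1 / (fact (j x) * fact (N - j x))\<close>. The ranks
  \<open>j x\<close> run through \<open>0, ..., N\<close>, and these bounds add up to
  \<open>2 ^ N / fact N\<close>.\<close>

lemma divided_difference_Ints_le:
  assumes S: "finite S" "S \<subseteq> \<int>" "card S = Suc N" and f: "\<And>x. x \<in> S \<Longrightarrow> \<bar>f x\<bar> \<le> 1"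
  shows "fact N * \<bar>divided_difference S f\<bar> \<le> 2 ^ N"
proof -
  define j where "j x = card {y \<in> S. y < x}" for x
  have lower: "fact (j x) * fact (N - j x) \<le> \<bar>\<Prod>y\<in>S - {x}. x - y\<bar>" if x: "x \<in> S" for x
  proof -
    let ?A = "{y \<in> S. y < x}" and ?B = "{y \<in> S. x < y}"
    have u: "S - {x} = ?A \<union> ?B" "?A \<inter> ?B = {}" by auto
    have cB: "card ?B = N - j x"
    proof -
      have "card (S - {x}) = card ?A + card ?B"
        unfolding u(1) using S u(2) by (intro card_Un_disjoint) auto
      then show ?thesis using S x by (simp add: j_def)
    qed
    have ints: "S \<subseteq> \<int>" "x \<in> \<int>" using S x by auto
    have A: "fact (j x) \<le> (\<Prod>y\<in>?A. x - y)"
    proof -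
      have inj: "inj_on (\<lambda>y. x - y) ?A" by (simp add: inj_on_def)
      have "fact (card ((\<lambda>y. x - y) ` ?A)) \<le> \<Prod>((\<lambda>y. x - y) ` ?A)"
        using S ints by (intro fact_card_le_prod_Ints) auto
      then show ?thesis by (simp add: card_image[OF inj] prod.reindex[OF inj] j_def)
    qed
    have B: "fact (N - j x) \<le> (\<Prod>y\<in>?B. y - x)"
    proof -
      have inj: "inj_on (\<lambda>y. y - x) ?B" by (simp add: inj_on_def)
      have "fact (card ((\<lambda>y. y - x) ` ?B)) \<le> \<Prod>((\<lambda>y. y - x) ` ?B)"
        using S ints by (intro fact_card_le_prod_Ints) auto
      then show ?thesis by (simp add: card_image[OF inj] prod.reindex[OF inj] cB)
    qed
    have "\<bar>\<Prod>y\<in>S - {x}. x - y\<bar> = (\<Prod>y\<in>S - {x}. \<bar>x - y\<bar>)" by (simp add: abs_prod)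
    also have "\<dots> = (\<Prod>y\<in>?A. \<bar>x - y\<bar>) * (\<Prod>y\<in>?B. \<bar>x - y\<bar>)"
      unfolding u(1) using S by (intro prod.union_disjoint) auto
    also have "(\<Prod>y\<in>?A. \<bar>x - y\<bar>) = (\<Prod>y\<in>?A. x - y)" by (intro prod.cong) auto
    also have "(\<Prod>y\<in>?B. \<bar>x - y\<bar>) = (\<Prod>y\<in>?B. y - x)" by (intro prod.cong) auto
    moreover have "0 \<le> (\<Prod>y\<in>?A. x - y)" by (intro prod_nonneg) auto
    ultimately show ?thesis using mult_mono[OF A B] by simp
  qed
  have inj: "inj_on j S"
  proof (rule inj_onI)
    have lt: "j x < j y" if "x \<in> S" "x < y" for x y
      unfolding j_def using S that by (intro psubset_card_mono) auto
    fix x y assume "x \<in> S" "y \<in> S" "j x = j y"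
    then show "x = y" using lt[of x y] lt[of y x] by (cases x y rule: linorder_cases) auto
  qed
  have "j ` S \<subseteq> {..N}"
  proof
    fix i assume "i \<in> j ` S"
    then obtain x where x: "x \<in> S" "i = j x" by blast
    have "j x \<le> card (S - {x})" unfolding j_def using S by (intro card_mono) auto
    then show "i \<in> {..N}" using x S by simp
  qed
  then have img: "j ` S = {..N}"
    using S by (intro card_subset_eq) (auto simp: card_image[OF inj])
  have "\<bar>divided_difference S f\<bar> \<le> (\<Sum>x\<in>S. \<bar>f x / (\<Prod>y\<in>S - {x}. x - y)\<bar>)"
    unfolding divided_difference_def by (rule sum_abs)
  also have "\<dots> \<le> (\<Sum>x\<in>S. 1 / (fact (j x) * fact (N - j x)))"
  proof (rule sum_mono)
    fix x assume x: "x \<in> S"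
    have "\<bar>f x\<bar> / \<bar>\<Prod>y\<in>S - {x}. x - y\<bar> \<le> 1 / (fact (j x) * fact (N - j x))"
      using lower[OF x] f[OF x] by (intro frac_le) auto
    then show "\<bar>f x / (\<Prod>y\<in>S - {x}. x - y)\<bar> \<le> 1 / (fact (j x) * fact (N - j x))"
      by (simp only: abs_divide)
  qed
  also have "\<dots> = (\<Sum>i\<le>N. 1 / (fact i * fact (N - i)))"
    unfolding img[symmetric] by (simp add: sum.reindex[OF inj])
  finally have le: "\<bar>divided_difference S f\<bar> \<le> (\<Sum>i\<le>N. 1 / (fact i * fact (N - i)))" .
  have "fact N * (\<Sum>i\<le>N. 1 / (fact i * fact (N - i))) = (\<Sum>i\<le>N. real (N choose i))"
    unfolding sum_distrib_left by (intro sum.cong) (auto simp: binomial_fact)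
  also have "\<dots> = 2 ^ N"
    using arg_cong[OF choose_row_sum[of N], of real] by simp
  finally have "fact N * (\<Sum>i\<le>N. 1 / (fact i * fact (N - i))) = (2 :: real) ^ N" .
  then show ?thesis
    using mult_left_mono[OF le, of "fact N"] by simp
qed

section \<open>Compactness\<close>

lemma jet_DERIV: "jet n C D \<Longrightarrow> k < n \<Longrightarrow> (D k has_real_derivative D (Suc k) x) (at x)"
  by (simp add: jet_def)

lemma jet_lipschitz: "jet n C D \<Longrightarrow> \<bar>D n x - D n y\<bar> \<le> C * \<bar>x - y\<bar>"
  by (simp add: jet_def)

text \<open>Bounds pass from order \<open>n\<close> down to order 0 by the mean value theorem:
  \<open>b j\<close> bounds the derivative of order \<open>n - j\<close>. What matters is the order
  of the quantifiers: one \<open>B\<close> serves all jets with the given \<open>C\<close> and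
  \<open>M\<close>.\<close>

lemma jet_local_bound:
  assumes "0 \<le> R"
  shows "\<exists>B\<ge>0. \<forall>D. jet n C D \<longrightarrow> (\<forall>k\<le>n. \<bar>D k 0\<bar> \<le> M) \<longrightarrow> (\<forall>k\<le>n. \<forall>x. \<bar>x\<bar> \<le> R \<longrightarrow> \<bar>D k x\<bar> \<le> B)"
proof -
  define b where "b = rec_nat (\<bar>M\<bar> + \<bar>C\<bar> * R) (\<lambda>j b. \<bar>M\<bar> + b * R)"
  have b0: "b 0 = \<bar>M\<bar> + \<bar>C\<bar> * R" and bS: "b (Suc j) = \<bar>M\<bar> + b j * R" for j by (simp_all add: b_def)
  have bpos: "b j \<ge> 0" for j using \<open>0 \<le> R\<close> by (induction j) (auto simp: b0 bS)
  have main: "\<bar>D (n - j) x\<bar> \<le> b j"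
    if J: "jet n C D" and D0: "\<forall>k\<le>n. \<bar>D k 0\<bar> \<le> M" and "\<bar>x\<bar> \<le> R" "j \<le> n" for D x j
    using \<open>\<bar>x\<bar> \<le> R\<close> \<open>j \<le> n\<close>
  proof (induction j arbitrary: x)
    case 0
    have "\<bar>D n x - D n 0\<bar> \<le> C * \<bar>x - 0\<bar>" by (rule jet_lipschitz[OF J])
    also have "\<dots> \<le> \<bar>C\<bar> * R" using 0 by (intro mult_mono) auto
    finally have "\<bar>D n x - D n 0\<bar> \<le> \<bar>C\<bar> * R" .
    moreover have "\<bar>D n 0\<bar> \<le> M" using D0 by simp
    ultimately show ?case by (simp add: b0)
  next
    case (Suc j)
    have k: "n - Suc j < n" "Suc (n - Suc j) = n - j" using Suc.prems by auto
    have "norm (D (n - Suc j) x - D (n - Suc j) 0) \<le> b j * norm (x - 0)"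
    proof (rule field_differentiable_bound[of "{-R..R}" _ "D (n - j)"])
      fix z assume "z \<in> {-R..R}"
      show "(D (n - Suc j) has_real_derivative D (n - j) z) (at z within {-R..R})"
        using jet_DERIV[OF J k(1), of z] unfolding k(2) by (rule has_field_derivative_at_within)
      show "norm (D (n - j) z) \<le> b j" using Suc \<open>z \<in> {-R..R}\<close> by auto
    qed (use Suc.prems \<open>0 \<le> R\<close> in auto)
    also have "\<dots> \<le> b j * R" using bpos Suc.prems by (intro mult_left_mono) auto
    finally have "\<bar>D (n - Suc j) x - D (n - Suc j) 0\<bar> \<le> b j * R" by simp
    moreover have "\<bar>D (n - Suc j) 0\<bar> \<le> M" using D0 by simp
    ultimately show ?case by (simp add: bS)
  qed
  show ?thesis
  proof (intro exI[of _ "\<Sum>j\<le>n. b j"] conjI allI impI)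
    show "0 \<le> sum b {..n}" using bpos by (intro sum_nonneg) auto
    fix D k x assume h: "jet n C D" "\<forall>k\<le>n. \<bar>D k 0\<bar> \<le> M" "k \<le> n" "\<bar>x\<bar> \<le> R"
    have "\<bar>D k x\<bar> \<le> b (n - k)" using main[OF h(1,2,4), of "n - k"] h(3) by simp
    also have "\<dots> \<le> sum b {..n}" using bpos by (intro member_le_sum) auto
    finally show "\<bar>D k x\<bar> \<le> sum b {..n}" .
  qed
qed

text \<open>\<open>B\<close> is a Lipschitz constant below order \<open>n\<close> and
  \<open>C\<close> at order \<open>n\<close>; the sum serves both.\<close>

lemma jet_local_lipschitz:
  assumes J: "jet n C D" and B: "\<And>k x. k \<le> n \<Longrightarrow> \<bar>x\<bar> \<le> R \<Longrightarrow> \<bar>D k x\<bar> \<le> B"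
    and "k \<le> n" "\<bar>x\<bar> \<le> R" "\<bar>y\<bar> \<le> R"
  shows "\<bar>D k x - D k y\<bar> \<le> (B + C) * \<bar>x - y\<bar>"
proof -
  have C: "0 \<le> C" by (rule jet_nonneg[OF J])
  have Bp: "0 \<le> B" using B[OF assms(3,4)] by linarith
  show ?thesis
  proof (cases "k = n")
    case True
    have "\<bar>D n x - D n y\<bar> \<le> C * \<bar>x - y\<bar>" by (rule jet_lipschitz[OF J])
    also have "\<dots> \<le> (B + C) * \<bar>x - y\<bar>" using Bp by (intro mult_right_mono) auto
    finally show ?thesis using True by simp
  next
    case False
    then have k: "k < n" using assms(3) by simp
    have "norm (D k x - D k y) \<le> B * norm (x - y)"
    proof (rule field_differentiable_bound[of "{-R..R}" _ "D (Suc k)"])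
      fix z assume "z \<in> {-R..R}"
      show "(D k has_real_derivative D (Suc k) z) (at z within {-R..R})"
        using jet_DERIV[OF J k] by (rule has_field_derivative_at_within)
      show "norm (D (Suc k) z) \<le> B" using B[of "Suc k" z] k \<open>z \<in> {-R..R}\<close> by (simp add: abs_le_iff)
    qed (use assms(4,5) in auto)
    also have "\<dots> \<le> (B + C) * norm (x - y)" using C by (intro mult_right_mono) auto
    finally show ?thesis by simp
  qed
qed

text \<open>Differentiability with an explicit error term: in this form it survives pointwise
  limits.\<close>

lemma taylor_quadratic:
  fixes f f' :: "real \<Rightarrow> real"
  assumes f: "\<And>z. (f has_real_derivative f' z) (at z)"
    and L: "\<And>z. \<bar>z\<bar> \<le> R \<Longrightarrow> \<bar>f' z - f' x\<bar> \<le> L * \<bar>z - x\<bar>" "0 \<le> L" and "\<bar>x\<bar> \<le> R" "\<bar>y\<bar> \<le> R"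
  shows "\<bar>f y - f x - f' x * (y - x)\<bar> \<le> L * \<bar>y - x\<bar> * \<bar>y - x\<bar>"
proof -
  have "norm ((f y - f' x * y) - (f x - f' x * x)) \<le> (L * \<bar>y - x\<bar>) * norm (y - x)"
  proof (rule field_differentiable_bound[of "{min x y..max x y}" "\<lambda>z. f z - f' x * z" "\<lambda>z. f' z - f' x"])
    fix z assume z: "z \<in> {min x y..max x y}"
    show "((\<lambda>z. f z - f' x * z) has_real_derivative f' z - f' x) (at z within {min x y..max x y})"
    proof -
      have "((\<lambda>z. f z - f' x * z) has_real_derivative f' z - f' x * 1) (at z)"
        by (intro DERIV_diff f DERIV_cmult DERIV_ident)
      then show ?thesis by (simp add: has_field_derivative_at_within)
    qed
    have "\<bar>f' z - f' x\<bar> \<le> L * \<bar>z - x\<bar>" using z assms(4,5) by (intro L(1)) auto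
    also have "\<dots> \<le> L * \<bar>y - x\<bar>" using z L(2) by (intro mult_left_mono) auto
    finally show "norm (f' z - f' x) \<le> L * \<bar>y - x\<bar>" by simp
  qed auto
  then show ?thesis by (simp add: algebra_simps)
qed

text \<open>The Arzela-Ascoli argument for all orders at once. A diagonal subsequence converges at
  every rational for every \<open>k \<le> n\<close>, and uniform local Lipschitz bounds extend this
  to all reals. The Lipschitz bound at order \<open>n\<close> and the quadratic Taylor estimates
  below it pass to the limit, so \<open>G\<close> is a jet with the same \<open>C\<close>.\<close>

lemma jet_subsequence_limit:
  assumes J: "\<And>j. jet n C (D j)" and M: "\<And>j k. k \<le> n \<Longrightarrow> \<bar>D j k 0\<bar> \<le> M"
  shows "\<exists>r G. strict_mono (r :: nat \<Rightarrow> nat) \<and> jet n C G \<and> (\<forall>k\<le>n. \<forall>x. (\<lambda>j. D (r j) k x) \<longlonglongrightarrow> G k x)"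
proof -
  have C: "0 \<le> C" by (rule jet_nonneg[OF J[of 0]])
  have "\<exists>B. 0 \<le> R \<longrightarrow> 0 \<le> B \<and> (\<forall>j. \<forall>k\<le>n. \<forall>x. \<bar>x\<bar> \<le> R \<longrightarrow> \<bar>D j k x\<bar> \<le> B)" for R
  proof (cases "0 \<le> R")
    case True
    obtain B where B: "0 \<le> B"
      "\<forall>D. jet n C D \<longrightarrow> (\<forall>k\<le>n. \<bar>D k 0\<bar> \<le> M) \<longrightarrow> (\<forall>k\<le>n. \<forall>x. \<bar>x\<bar> \<le> R \<longrightarrow> \<bar>D k x\<bar> \<le> B)"
      using jet_local_bound[OF True, of n C M] by (elim exE conjE) (rule that)
    have "\<forall>k\<le>n. \<bar>D j k 0\<bar> \<le> M" for j using M by simp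
    then show ?thesis
      using B(2)[THEN spec, THEN mp, OF J, THEN mp] B(1) by (intro exI[of _ B] impI conjI allI) simp_all
  qed simp
  then have "\<forall>R. \<exists>B. 0 \<le> R \<longrightarrow> 0 \<le> B \<and> (\<forall>j. \<forall>k\<le>n. \<forall>x. \<bar>x\<bar> \<le> R \<longrightarrow> \<bar>D j k x\<bar> \<le> B)" by (rule allI)
  from choice[OF this] obtain B where B0: "\<forall>R. 0 \<le> R \<longrightarrow> 0 \<le> B R \<and> (\<forall>j. \<forall>k\<le>n. \<forall>x. \<bar>x\<bar> \<le> R \<longrightarrow> \<bar>D j k x\<bar> \<le> B R)"
    by (rule exE)
  then have B: "\<And>R. 0 \<le> R \<Longrightarrow> 0 \<le> B R" "\<And>R j k x. 0 \<le> R \<Longrightarrow> k \<le> n \<Longrightarrow> \<bar>x\<bar> \<le> R \<Longrightarrow> \<bar>D j k x\<bar> \<le> B R"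
    by simp_all
  \<comment> \<open>\<open>N\<close> codes a pair of an order and a rational; \<open>min n\<close>
    makes every code an admissible order.\<close>
  define ek where "ek N = min n (fst (prod_decode N))" for N
  define eq where "eq N = real_of_rat (from_nat (snd (prod_decode N)))" for N
  define P where "P N s \<longleftrightarrow> convergent (\<lambda>j. D (s j) (ek N) (eq N))" for N and s :: "nat \<Rightarrow> nat"
  interpret subseqs P
  proof
    fix N and s :: "nat \<Rightarrow> nat"
    have "\<bar>D (s j) (ek N) (eq N)\<bar> \<le> B \<bar>eq N\<bar>" for j by (rule B(2)) (auto simp: ek_def)
    then have "bounded (range (\<lambda>j. D (s j) (ek N) (eq N)))" by (intro boundedI[of _ "B \<bar>eq N\<bar>"]) auto
    from bounded_imp_convergent_subsequence[OF this] obtain l r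
      where "strict_mono r" "((\<lambda>j. D (s j) (ek N) (eq N)) \<circ> r) \<longlonglongrightarrow> l" by blast
    then show "\<exists>r'. strict_mono r' \<and> P N (s \<circ> r')"
      by (auto simp: P_def o_def convergent_def)
  qed
  define r where "r = diagseq"
  have r: "strict_mono r" unfolding r_def by (rule subseq_diagseq)
  have conv_e: "convergent (\<lambda>j. D (r j) (ek N) (eq N))" for N
  proof -
    have "P N (diagseq \<circ> ((+) (Suc N)))"
    proof (rule diagseq_holds)
      fix q s :: "nat \<Rightarrow> nat" and N assume "strict_mono q" "P N s"
      then show "P N (s \<circ> q)" using convergent_subseq_convergent by (fastforce simp: P_def o_def)
    qed
    then have "convergent (\<lambda>j. D (r (j + Suc N)) (ek N) (eq N))" by (simp add: P_def o_def r_def add.commute)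
    then show ?thesis using convergent_ignore_initial_segment[of "\<lambda>j. D (r j) (ek N) (eq N)" "Suc N"] by simp
  qed
  have convQ: "convergent (\<lambda>j. D (r j) k q)" if kq: "k \<le> n" "q \<in> \<rat>" for k q
  proof -
    obtain p where p: "q = real_of_rat p" using kq(2) by (auto elim: Rats_cases)
    have "ek (prod_encode (k, to_nat p)) = k" "eq (prod_encode (k, to_nat p)) = q"
      using kq(1) p by (simp_all add: ek_def eq_def)
    then show ?thesis using conv_e[of "prod_encode (k, to_nat p)"] by simp
  qed
  have conv: "convergent (\<lambda>j. D (r j) k x)" if k: "k \<le> n" for k x
  proof -
    define R where "R = \<bar>x\<bar> + 1"
    define L where "L = B R + C"
    have R: "0 \<le> R" by (simp add: R_def)
    have L: "0 \<le> L" using B(1)[OF R] C by (simp add: L_def)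
    have lip: "\<bar>D j k u - D j k v\<bar> \<le> L * \<bar>u - v\<bar>" if "\<bar>u\<bar> \<le> R" "\<bar>v\<bar> \<le> R" for j u v
      unfolding L_def by (rule jet_local_lipschitz[OF J B(2)[OF R] k that])
    have "Cauchy (\<lambda>j. D (r j) k x)"
      unfolding Cauchy_def
    proof (intro allI impI)
      fix e :: real assume e: "e > 0"
      define d where "d = min 1 (e / (3 * (L + 1)))"
      have d: "d > 0" "d \<le> 1" using e L by (auto simp: d_def)
      have "L * d \<le> (L + 1) * (e / (3 * (L + 1)))" using L d e by (intro mult_mono) (auto simp: d_def)
      also have "\<dots> = e / 3" using L by (simp add: field_simps add_nonneg_pos)
      finally have Ld: "L * d \<le> e / 3" .
      obtain q where q: "q \<in> \<rat>" "x < q" "q < x + d" using Rats_dense_in_real[of x "x + d"] d by auto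
      have qR: "\<bar>x\<bar> \<le> R" "\<bar>q\<bar> \<le> R" using q d by (auto simp: R_def)
      have xq: "\<bar>D j k x - D j k q\<bar> \<le> e / 3" for j
      proof -
        have "\<bar>D j k x - D j k q\<bar> \<le> L * \<bar>x - q\<bar>" by (rule lip[OF qR])
        also have "\<dots> \<le> L * d" using q L by (intro mult_left_mono) auto
        finally show ?thesis using Ld by linarith
      qed
      have "Cauchy (\<lambda>j. D (r j) k q)" using convQ[OF k q(1)] by (simp add: Cauchy_convergent_iff)
      then have "\<exists>N. \<forall>m\<ge>N. \<forall>m'\<ge>N. norm (D (r m) k q - D (r m') k q) < e / 3"
        using e by (intro CauchyD) auto
      then obtain N where N: "\<forall>m\<ge>N. \<forall>m'\<ge>N. norm (D (r m) k q - D (r m') k q) < e / 3" ..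
      show "\<exists>N. \<forall>m\<ge>N. \<forall>m'\<ge>N. dist (D (r m) k x) (D (r m') k x) < e"
      proof (intro exI[of _ N] allI impI)
        fix m m' assume m: "N \<le> m" "N \<le> m'"
        show "dist (D (r m) k x) (D (r m') k x) < e"
          using N[rule_format, OF m] xq[of "r m"] xq[of "r m'"]
          unfolding dist_real_def real_norm_def by linarith
      qed
    qed
    then show ?thesis by (simp add: Cauchy_convergent_iff)
  qed
  define G where "G k x = lim (\<lambda>j. D (r j) k x)" for k x
  have lim: "(\<lambda>j. D (r j) k x) \<longlonglongrightarrow> G k x" if "k \<le> n" for k x
    using conv[OF that, of x] unfolding G_def by (rule convergent_LIMSEQ_iff[THEN iffD1])
  have "jet n C G"
    unfolding jet_def
  proof (intro conjI allI impI)
    fix x y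
    have "(\<lambda>j. \<bar>D (r j) n x - D (r j) n y\<bar>) \<longlonglongrightarrow> \<bar>G n x - G n y\<bar>" by (intro tendsto_intros lim) auto
    then show "\<bar>G n x - G n y\<bar> \<le> C * \<bar>x - y\<bar>"
      by (rule LIMSEQ_le_const2) (use J in \<open>auto simp: jet_def\<close>)
  next
    fix k and x :: real assume k: "k < n"
    define R where "R = \<bar>x\<bar> + 1"
    define L where "L = B R + C"
    have R: "0 \<le> R" by (simp add: R_def)
    have L: "0 \<le> L" using B(1)[OF R] C by (simp add: L_def)
    have quad: "\<bar>G k y - G k x - G (Suc k) x * (y - x)\<bar> \<le> L * \<bar>y - x\<bar> * \<bar>y - x\<bar>" if y: "\<bar>y\<bar> \<le> R" for y
    proof (rule LIMSEQ_le_const2)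
      show "(\<lambda>j. \<bar>D (r j) k y - D (r j) k x - D (r j) (Suc k) x * (y - x)\<bar>) \<longlonglongrightarrow> \<bar>G k y - G k x - G (Suc k) x * (y - x)\<bar>"
        using k by (intro tendsto_intros lim) auto
      have "\<bar>D j k y - D j k x - D j (Suc k) x * (y - x)\<bar> \<le> L * \<bar>y - x\<bar> * \<bar>y - x\<bar>" for j
      proof (rule taylor_quadratic[of _ _ R])
        show "(D j k has_real_derivative D j (Suc k) z) (at z)" for z using J[of j] k by (simp add: jet_def)
        show "\<bar>D j (Suc k) z - D j (Suc k) x\<bar> \<le> L * \<bar>z - x\<bar>" if "\<bar>z\<bar> \<le> R" for z
          unfolding L_def using k by (intro jet_local_lipschitz[OF J B(2)[OF R] _ that]) (auto simp: R_def)
      qed (use L y in \<open>auto simp: R_def\<close>)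
      then show "\<exists>N. \<forall>j\<ge>N. \<bar>D (r j) k y - D (r j) k x - D (r j) (Suc k) x * (y - x)\<bar> \<le> L * \<bar>y - x\<bar> * \<bar>y - x\<bar>"
        by blast
    qed
    have "(G k has_derivative (\<lambda>h. G (Suc k) x * h)) (at x)"
      unfolding has_derivative_at_alt
    proof (intro conjI allI impI)
      show "bounded_linear ((*) (G (Suc k) x))" by (rule bounded_linear_mult_right)
      fix e :: real assume e: "e > 0"
      define d where "d = min 1 (e / (L + 1))"
      have d: "d > 0" "d \<le> 1" using e L by (auto simp: d_def)
      have "L * d \<le> (L + 1) * (e / (L + 1))" using L d e by (intro mult_mono) (auto simp: d_def)
      then have Ld: "L * d \<le> e" using L by simp
      show "\<exists>d>0. \<forall>y. norm (y - x) < d \<longrightarrow> norm (G k y - G k x - G (Suc k) x * (y - x)) \<le> e * norm (y - x)"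
      proof (intro exI[of _ d] conjI allI impI d(1))
        fix y assume y: "norm (y - x) < d"
        then have "\<bar>y\<bar> \<le> R" using d by (auto simp: R_def)
        from quad[OF this] have "norm (G k y - G k x - G (Suc k) x * (y - x)) \<le> L * \<bar>y - x\<bar> * \<bar>y - x\<bar>" by simp
        also have "\<dots> \<le> L * d * \<bar>y - x\<bar>" using y L by (intro mult_right_mono mult_left_mono) auto
        also have "\<dots> \<le> e * \<bar>y - x\<bar>" using Ld by (intro mult_right_mono) auto
        finally show "norm (G k y - G k x - G (Suc k) x * (y - x)) \<le> e * norm (y - x)" by simp
      qed
    qed
    then show "(G k has_real_derivative G (Suc k) x) (at x)" by (simp add: has_field_derivative_def)
  qed
  then show ?thesis using r lim by blast
qed

text \<open>The compactness argument needs bounds on all derivatives at one point, and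
  \<open>n + 1\<close> prescribed values provide them: after subtraction of the interpolating
  polynomial every derivative up to order \<open>n\<close> has a zero in \<open>[-R, R]\<close>.
  That polynomial has a constant derivative of order \<open>n\<close>, so the difference inherits
  the Lipschitz bound, and each step down costs a factor \<open>2 * R\<close>.\<close>

lemma interpolating_jets_bounded:
  assumes S: "finite S" "card S = Suc n"
  shows "\<exists>M. \<forall>D. jet n C D \<longrightarrow> (\<forall>x\<in>S. D 0 x = f x) \<longrightarrow> (\<forall>k\<le>n. \<bar>D k 0\<bar> \<le> M)"
proof -
  define p where "p = lagrange_poly S f"
  obtain R where R: "0 \<le> R" "\<And>x. x \<in> S \<Longrightarrow> \<bar>x\<bar> \<le> R"
  proof
    show "0 \<le> (\<Sum>x\<in>S. \<bar>x\<bar>)" by (intro sum_nonneg) auto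
    show "\<bar>x\<bar> \<le> (\<Sum>x\<in>S. \<bar>x\<bar>)" if "x \<in> S" for x using S that by (intro member_le_sum[of x S abs]) auto
  qed
  define b where "b k = \<bar>poly ((pderiv ^^ k) p) 0\<bar> + \<bar>C\<bar> * (2 * R) ^ Suc (n - k)" for k
  have b: "b k \<ge> 0" for k using R(1) by (simp add: b_def)
  have main: "\<bar>D k 0\<bar> \<le> b k" if J: "jet n C D" and f: "\<forall>x\<in>S. D 0 x = f x" and k: "k \<le> n" for D k
  proof -
    define E where "E k x = D k x - poly ((pderiv ^^ k) p) x" for k x
    have C: "0 \<le> C" by (rule jet_nonneg[OF J])
    have E: "(E k has_real_derivative E (Suc k) x) (at x)" if "k < n" for k x
      unfolding E_def using J that by (intro DERIV_diff DERIV_higher_pderiv) (auto simp: jet_def)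
    have zero: "\<exists>z. \<bar>z\<bar> \<le> R \<and> E k z = 0" if "k \<le> n" for k
    proof -
      have "\<exists>Z'. finite Z' \<and> card Z' = card S - k \<and> Z' \<subseteq> {-R..R} \<and> (\<forall>z\<in>Z'. E k z = 0)"
      proof (rule iterated_Rolle_zeros[of n E S])
        show "E 0 z = 0" if "z \<in> S" for z
          using poly_lagrange_poly[OF S(1) that, of f] f that by (simp add: E_def p_def)
        show "S \<subseteq> {-R..R}" using R(2) by (force simp: abs_le_iff)
      qed (use E S that in auto)
      then obtain Z' where Z': "card Z' = card S - k" "Z' \<subseteq> {-R..R}" "\<forall>z\<in>Z'. E k z = 0" by blast
      then have "Z' \<noteq> {}" using S that by auto
      then obtain z where "z \<in> Z'" by blast
      then have "z \<in> {-R..R}" "E k z = 0" using Z' by auto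
      then show ?thesis by (intro exI[of _ z]) (auto simp: abs_le_iff)
    qed
    have "\<bar>E (n - j) x\<bar> \<le> C * (2 * R) ^ Suc j" if "j \<le> n" "\<bar>x\<bar> \<le> R" for j x
      using that
    proof (induction j arbitrary: x)
      case 0
      obtain z where z: "\<bar>z\<bar> \<le> R" "E n z = 0" using zero[of n] by blast
      have "coeff p i = 0" if "i \<ge> Suc n" for i
        using coeff_lagrange_poly(1)[OF S(1), of i] S(2) that by (simp add: p_def)
      then have "poly ((pderiv ^^ n) p) x - poly ((pderiv ^^ n) p) z = 0"
        using poly_higher_pderiv_affine[of n p x z] by simp
      then have "E n x - E n z = D n x - D n z" by (simp add: E_def)
      moreover have "\<bar>D n x - D n z\<bar> \<le> C * \<bar>x - z\<bar>" by (rule jet_lipschitz[OF J])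
      moreover have "C * \<bar>x - z\<bar> \<le> C * (2 * R)" using z 0 C by (intro mult_left_mono) auto
      ultimately show ?case using z by simp
    next
      case (Suc j)
      obtain z where z: "\<bar>z\<bar> \<le> R" "E (n - Suc j) z = 0" using zero[of "n - Suc j"] by auto
      have k: "n - Suc j < n" "Suc (n - Suc j) = n - j" using Suc.prems by auto
      have "norm (E (n - Suc j) x - E (n - Suc j) z) \<le> (C * (2 * R) ^ Suc j) * norm (x - z)"
      proof (rule field_differentiable_bound[of "{-R..R}" _ "E (n - j)"])
        fix y assume y: "y \<in> {-R..R}"
        show "(E (n - Suc j) has_real_derivative E (n - j) y) (at y within {-R..R})"
          using E[OF k(1), of y] unfolding k(2) by (rule has_field_derivative_at_within)
        show "norm (E (n - j) y) \<le> C * (2 * R) ^ Suc j" using Suc.IH[of y] Suc.prems y by (simp add: abs_le_iff)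
      qed (use Suc.prems z in auto)
      also have "\<dots> \<le> (C * (2 * R) ^ Suc j) * (2 * R)" using z Suc.prems C R by (intro mult_left_mono) auto
      finally show ?case using z by (simp add: mult_ac)
    qed
    from this[of "n - k" 0] have "\<bar>E k 0\<bar> \<le> C * (2 * R) ^ Suc (n - k)" using k R(1) by simp
    then show ?thesis using C by (simp add: b_def E_def)
  qed
  show ?thesis
  proof (intro exI[of _ "\<Sum>k\<le>n. b k"] allI impI)
    fix D k assume h: "jet n C D" "\<forall>x\<in>S. D 0 x = f x" "k \<le> n"
    have "\<bar>D k 0\<bar> \<le> b k" by (rule main[OF h])
    also have "\<dots> \<le> (\<Sum>k\<le>n. b k)" using b h(3) by (intro member_le_sum) auto
    finally show "\<bar>D k 0\<bar> \<le> (\<Sum>k\<le>n. b k)" .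
  qed
qed

lemma jet_continuous:
  assumes "jet n C D" "k \<le> n"
  shows "isCont (D k) x"
proof (cases "k = n")
  case True
  have "absolutely_continuous_real (D n)"
    using assms(1) by (intro lipschitz_imp_absolutely_continuous[of _ C]) (simp add: jet_def)
  then show ?thesis using absolutely_continuous_imp_continuous True by blast
next
  case False
  then show ?thesis using assms jet_DERIV[OF assms(1), of k x] DERIV_isCont by simp
qed

text \<open>The finite sets all contain \<open>S\<close>, which bounds the extensions uniformly, and
  they exhaust a countable dense subset of \<open>E\<close>. A limit of the extensions agrees with
  \<open>f\<close> on this subset, and continuity does the rest.\<close>

lemma jet_extension_from_finite_subsets:
  assumes S: "finite S" "card S = Suc n" "S \<subseteq> E" and f: "continuous_on E f"
    and fin: "\<And>T. finite T \<Longrightarrow> S \<subseteq> T \<Longrightarrow> T \<subseteq> E \<Longrightarrow> \<exists>D. jet n C D \<and> (\<forall>x\<in>T. D 0 x = f x)"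
  shows "\<exists>D. jet n C D \<and> (\<forall>x\<in>E. D 0 x = f x)"
proof -
  obtain Q where Q: "countable Q" "Q \<subseteq> E" "E \<subseteq> closure Q" using separable by blast
  define T where "T j = S \<union> (Q \<inter> from_nat_into Q ` {..j})" for j :: nat
  have "\<exists>D. jet n C D \<and> (\<forall>x\<in>T j. D 0 x = f x)" for j
    using S Q by (intro fin) (auto simp: T_def)
  then obtain D where D: "\<And>j. jet n C (D j)" "\<And>j x. x \<in> T j \<Longrightarrow> D j 0 x = f x" by metis
  obtain M where M: "\<forall>D. jet n C D \<longrightarrow> (\<forall>x\<in>S. D 0 x = f x) \<longrightarrow> (\<forall>k\<le>n. \<bar>D k 0\<bar> \<le> M)"
    using interpolating_jets_bounded[OF S(1,2)] by blast
  have Mb: "\<bar>D j k 0\<bar> \<le> M" if "k \<le> n" for j k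
  proof -
    have "\<forall>x\<in>S. D j 0 x = f x" using D(2)[where j = j] by (simp add: T_def)
    then show ?thesis using M D(1)[of j] that by blast
  qed
  have "\<exists>r G. strict_mono (r :: nat \<Rightarrow> nat) \<and> jet n C G \<and> (\<forall>k\<le>n. \<forall>x. (\<lambda>j. D (r j) k x) \<longlonglongrightarrow> G k x)"
    using D(1) Mb by (rule jet_subsequence_limit)
  then obtain r G where r: "strict_mono (r :: nat \<Rightarrow> nat)" and G: "jet n C G"
    and lim: "\<forall>k\<le>n. \<forall>x. (\<lambda>j. D (r j) k x) \<longlonglongrightarrow> G k x"
    by (elim exE conjE)
  have GQ: "G 0 q = f q" if q: "q \<in> Q" for q
  proof -
    obtain i where i: "from_nat_into Q i = q" using from_nat_into_surj[OF Q(1) q] by blast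
    have "D (r j) 0 q = f q" if "j \<ge> i" for j
      using D(2)[of q "r j"] q i that seq_suble[OF r, of j] by (force simp: T_def)
    then have "(\<lambda>j. D (r j) 0 q) \<longlonglongrightarrow> f q"
      by (intro tendsto_eventually eventually_sequentiallyI[of i]) auto
    then show ?thesis using LIMSEQ_unique lim by blast
  qed
  have "G 0 x = f x" if x: "x \<in> E" for x
  proof -
    obtain q where q: "\<And>i :: nat. q i \<in> Q" "q \<longlonglongrightarrow> x" using Q(3) x closure_sequential by blast
    have "(\<lambda>i. G 0 (q i)) \<longlonglongrightarrow> G 0 x" using jet_continuous[OF G] q(2) isCont_tendsto_compose by blast
    moreover have "(\<lambda>i. f (q i)) \<longlonglongrightarrow> f x"
      using f q x Q(2) unfolding continuous_on_sequentially comp_def by blast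
    ultimately show ?thesis using GQ[OF q(1)] LIMSEQ_unique by fastforce
  qed
  then show ?thesis using G by blast
qed

section \<open>Extension from finite sets\<close>

text \<open>Induction on the number of exceptional points inside the interval. \<open>X\<close> is
  meant for the breakpoints of the piecewise polynomial steps for \<open>m = 1, 2\<close>.\<close>

lemma bounded_derivative_imp_lipschitz_off_finite:
  fixes f f' :: "real \<Rightarrow> real"
  assumes X: "finite X" and cont: "\<And>x. isCont f x"
    and der: "\<And>x. x \<notin> X \<Longrightarrow> (f has_real_derivative f' x) (at x)"
    and bd: "\<And>x. x \<notin> X \<Longrightarrow> \<bar>f' x\<bar> \<le> K"
  shows "\<bar>f x - f y\<bar> \<le> K * \<bar>x - y\<bar>"
proof -
  have main: "\<bar>f y - f x\<bar> \<le> K * (y - x)" if "x < y" for x y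
    using that
  proof (induction "card (X \<inter> {x<..<y})" arbitrary: x y rule: less_induct)
    case less
    show ?case
    proof (cases "X \<inter> {x<..<y} = {}")
      case True
      have "\<exists>l z. x < z \<and> z < y \<and> DERIV f z :> l \<and> f y - f x = (y - x) * l"
      proof (rule MVT[OF less.prems])
        show "continuous_on {x..y} f" using cont by (simp add: continuous_at_imp_continuous_on)
        fix z assume "x < z" "z < y"
        then have "z \<notin> X" using True by auto
        then show "f differentiable at z" using der real_differentiable_def by blast
      qed
      then obtain l z where z: "x < z" "z < y" "DERIV f z :> l" "f y - f x = (y - x) * l" by blast
      then have "z \<notin> X" using True by auto
      then have "l = f' z" "\<bar>f' z\<bar> \<le> K" using z(3) der DERIV_unique bd by blast+
      then show ?thesis using z(4) less.prems by (simp add: abs_mult mult.commute mult_right_mono)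
    next
      case False
      then obtain z where z: "z \<in> X" "x < z" "z < y" by auto
      have "card (X \<inter> {x<..<z}) < card (X \<inter> {x<..<y})" "card (X \<inter> {z<..<y}) < card (X \<inter> {x<..<y})"
        using X z by (auto intro!: psubset_card_mono)
      then have "\<bar>f z - f x\<bar> \<le> K * (z - x)" "\<bar>f y - f z\<bar> \<le> K * (y - z)"
        using less.hyps z by blast+
      moreover have "K * (y - x) = K * (z - x) + K * (y - z)" by (simp add: algebra_simps)
      ultimately show ?thesis by linarith
    qed
  qed
  consider "x < y" | "x = y" | "y < x" by linarith
  then show ?thesis using main[of x y] main[of y x] by cases (auto simp: abs_minus_commute)
qed

text \<open>The extension is \<open>P\<^sub>0 + (\<Sum>i. (P\<^sub>i\<^sub>+\<^sub>1 - P\<^sub>i) G\<^sub>i)\<close>, where \<open>P\<^sub>i\<close> interpolates \<open>f\<close> at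
  \<open>t\<^sub>i, \<dots>, t\<^sub>i\<^sub>+\<^sub>n\<close> and \<open>G\<^sub>i\<close> steps from 0 to 1 between \<open>t\<^sub>i\<close> and \<open>t\<^sub>i\<^sub>+\<^sub>n\<^sub>+\<^sub>1\<close>. Up to a constant factor,
  \<open>(P\<^sub>i\<^sub>+\<^sub>1 - P\<^sub>i) G\<^sub>i\<close> is the function \<open>\<phi> i 0\<close> below.\<close>

lemma blended_extension:
  fixes n N :: nat and t :: "nat \<Rightarrow> real" and \<phi> :: "nat \<Rightarrow> nat \<Rightarrow> real \<Rightarrow> real"
  defines "c \<equiv> \<lambda>i f. divided_difference (t ` {i..i + Suc n}) f * (t (i + Suc n) - t i)"
  assumes t: "\<And>i j. i < j \<Longrightarrow> j \<le> N \<Longrightarrow> t i < t j" and "n < N" and X: "finite X"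
    and d: "\<And>i k x. i + Suc n \<le> N \<Longrightarrow> k < n \<Longrightarrow> (\<phi> i k has_real_derivative \<phi> i (Suc k) x) (at x)"
    and dn: "\<And>i x. i + Suc n \<le> N \<Longrightarrow> x \<notin> X \<Longrightarrow> (\<phi> i n has_real_derivative \<phi> i (Suc n) x) (at x)"
    and cont: "\<And>i x. i + Suc n \<le> N \<Longrightarrow> isCont (\<phi> i n) x"
    and z: "\<And>i l. i + Suc n \<le> N \<Longrightarrow> l < i + Suc n \<Longrightarrow> \<phi> i 0 (t l) = 0"
    and r: "\<And>i l. i + Suc n \<le> l \<Longrightarrow> l \<le> N \<Longrightarrow> \<phi> i 0 (t l) = (\<Prod>y\<in>t ` {Suc i..i + n}. t l - y)"
    and bd: "\<And>x. x \<notin> X \<Longrightarrow> \<bar>\<Sum>i<N - n. c i f * \<phi> i (Suc n) x\<bar> \<le> K"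
  shows "\<exists>D. jet n K D \<and> (\<forall>l\<le>N. D 0 (t l) = f (t l))"
proof -
  define P where "P i = lagrange_poly (t ` {i..i + n}) f" for i
  define D where "D k x = poly ((pderiv ^^ k) (P 0)) x + (\<Sum>i<N - n. c i f * \<phi> i k x)" for k x
  have tinj: "inj_on t A" if "A \<subseteq> {..N}" for A
  proof (rule inj_onI)
    fix i j assume "i \<in> A" "j \<in> A" "t i = t j"
    then show "i = j" using t[of i j] t[of j i] that by (cases i j rule: linorder_cases) auto
  qed
  have Ps: "poly (P (Suc i)) x - poly (P i) x = c i f * (\<Prod>y\<in>t ` {Suc i..i + n}. x - y)" if i: "i + Suc n \<le> N" for i x
  proof -
    let ?S = "t ` {i..i + Suc n}"
    have inj: "inj_on t {i..i + Suc n}" using i by (intro tinj) auto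
    have ne: "t i \<noteq> t (i + Suc n)" using t[of i "i + Suc n"] i by simp
    have "?S - {t i} = t ` ({i..i + Suc n} - {i})"
      using inj by (subst inj_on_image_set_diff[OF inj]) auto
    also have "{i..i + Suc n} - {i} = {Suc i..Suc i + n}" by auto
    finally have S1: "?S - {t i} = t ` {Suc i..Suc i + n}" .
    have "?S - {t (i + Suc n)} = t ` ({i..i + Suc n} - {i + Suc n})"
      using inj by (subst inj_on_image_set_diff[OF inj]) auto
    also have "{i..i + Suc n} - {i + Suc n} = {i..i + n}" by auto
    finally have S2: "?S - {t (i + Suc n)} = t ` {i..i + n}" .
    have "?S - {t i, t (i + Suc n)} = t ` ({i..i + Suc n} - {i, i + Suc n})"
      using inj by (subst inj_on_image_set_diff[OF inj]) auto
    also have "{i..i + Suc n} - {i, i + Suc n} = {Suc i..i + n}" by auto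
    finally have S3: "?S - {t i, t (i + Suc n)} = t ` {Suc i..i + n}" .
    have "P (Suc i) - P i = smult (c i f) (\<Prod>y\<in>t ` {Suc i..i + n}. [:- y, 1:])"
      using lagrange_poly_exchange[of ?S "t i" "t (i + Suc n)" f] ne unfolding S1 S2 S3 P_def c_def by simp
    then have "poly (P (Suc i) - P i) x = poly (smult (c i f) (\<Prod>y\<in>t ` {Suc i..i + n}. [:- y, 1:])) x" by (rule arg_cong)
    then show ?thesis by (simp add: poly_prod)
  qed
  \<comment> \<open>At a node strictly inside the support of step \<open>i\<close> both interpolants
    agree with \<open>f\<close>, so their difference vanishes together with
    \<open>\<phi> i 0\<close>; at the other nodes the step is 0 or 1.\<close>
  have trm: "c i f * \<phi> i 0 (t l) = (if i < l then poly (P (Suc i)) (t l) - poly (P i) (t l) else 0)"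
    if i: "i + Suc n \<le> N" and l: "l \<le> N" for i l
  proof -
    consider "l \<le> i" | "i < l" "l < i + Suc n" | "i + Suc n \<le> l" by linarith
    then show ?thesis
    proof cases
      case 1
      then show ?thesis using z[OF i, of l] by simp
    next
      case 2
      then have "t l \<in> t ` {Suc i..i + n}" by auto
      then have "(\<Prod>y\<in>t ` {Suc i..i + n}. t l - y) = 0" by (auto simp: prod_zero_iff)
      then show ?thesis using 2 z[OF i, of l] Ps[OF i, of "t l"] by simp
    next
      case 3
      then show ?thesis using r[OF 3 l] Ps[OF i, of "t l"] by simp
    qed
  qed
  have interp: "D 0 (t l) = f (t l)" if l: "l \<le> N" for l
  proof -
    \<comment> \<open>The sum telescopes to \<open>P j\<close>. The cap \<open>N - n\<close> is the
      last index of an interpolant, and \<open>j \<le> l \<le> j + n\<close> makes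
      \<open>t l\<close> one of the nodes of \<open>P j\<close>.\<close>
    define j where "j = min l (N - n)"
    have "(\<Sum>i<N - n. c i f * \<phi> i 0 (t l)) = (\<Sum>i<N - n. if i < l then poly (P (Suc i)) (t l) - poly (P i) (t l) else 0)"
      using trm l by (intro sum.cong) auto
    also have "\<dots> = (\<Sum>i<j. poly (P (Suc i)) (t l) - poly (P i) (t l))"
      unfolding j_def by (intro sum.mono_neutral_cong_right) auto
    also have "\<dots> = poly (P j) (t l) - poly (P 0) (t l)" by (rule sum_lessThan_telescope)
    finally have "D 0 (t l) = poly (P j) (t l)" by (simp add: D_def)
    moreover have "l \<in> {j..j + n}" using l \<open>n < N\<close> by (auto simp: j_def)
    ultimately show ?thesis unfolding P_def by (simp add: poly_lagrange_poly)
  qed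
  have der: "(D k has_real_derivative D (Suc k) x) (at x)" if "k < n" for k x
    unfolding D_def using that d by (intro DERIV_add DERIV_higher_pderiv DERIV_sum DERIV_cmult) auto
  have P0: "poly ((pderiv ^^ Suc n) (P 0)) x = 0" for x
  proof -
    have "coeff (P 0) i = 0" if "i \<ge> Suc n" for i
      using coeff_lagrange_poly(1)[of "t ` {0..0 + n}" i f] that card_image[OF tinj[of "{0..n}"]] \<open>n < N\<close>
      by (simp add: P_def)
    then have "coeff ((pderiv ^^ Suc n) (P 0)) i = 0" for i
      by (subst coeff_higher_pderiv) simp
    then have "(pderiv ^^ Suc n) (P 0) = 0" by (intro poly_eqI) simp
    then show ?thesis by (simp only: poly_0)
  qed
  have dern: "(D n has_real_derivative (\<Sum>i<N - n. c i f * \<phi> i (Suc n) x)) (at x)" if "x \<notin> X" for x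
  proof -
    have "(D n has_real_derivative poly ((pderiv ^^ Suc n) (P 0)) x + (\<Sum>i<N - n. c i f * \<phi> i (Suc n) x)) (at x)"
      unfolding D_def using that dn by (intro DERIV_add DERIV_higher_pderiv DERIV_sum DERIV_cmult) auto
    then show ?thesis by (simp only: P0 add_0_left)
  qed
  have "isCont (D n) x" for x
    unfolding D_def using cont by (intro continuous_intros) auto
  then have "\<bar>D n x - D n y\<bar> \<le> K * \<bar>x - y\<bar>" for x y
    using bounded_derivative_imp_lipschitz_off_finite[OF X _ dern bd] by blast
  then have "jet n K D" using der by (simp add: jet_def)
  then show ?thesis using interp by blast
qed

text \<open>Only runs of \<open>n + 2\<close> consecutive nodes enter. The factor
  \<open>fact (Suc n)\<close> makes \<open>a\<close> a bound on trace seminorms, so that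
  \<open>K\<close> becomes an admissible finiteness constant.\<close>

definition finite_extension :: "nat \<Rightarrow> real \<Rightarrow> bool" where
  "finite_extension n K \<longleftrightarrow> (\<forall>N t f a. (\<forall>i j. i < j \<longrightarrow> j \<le> N \<longrightarrow> t i < t j) \<longrightarrow> n < N \<longrightarrow>
     (\<forall>i. i + Suc n \<le> N \<longrightarrow> fact (Suc n) * \<bar>divided_difference (t ` {i..i + Suc n}) f\<bar> \<le> a) \<longrightarrow>
     (\<exists>D. jet n (K * a) D \<and> (\<forall>l\<le>N. D 0 (t l) = f (t l))))"

section \<open>Optimal steps for orders one and two\<close>

definition pos_part :: "real \<Rightarrow> real" where "pos_part x = max 0 x"

lemma continuous_pos_part [continuous_intros]: "continuous F f \<Longrightarrow> continuous F (\<lambda>x. pos_part (f x))"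
  unfolding pos_part_def by (intro continuous_intros)

lemma DERIV_pos_part: "x \<noteq> 0 \<Longrightarrow> (pos_part has_real_derivative (if 0 < x then 1 else 0)) (at x)"
proof (cases "0 < x")
  case True
  then have "((\<lambda>x. x) has_real_derivative 1) (at x)" "\<forall>\<^sub>F y in nhds x. pos_part y = y"
    by (auto simp: pos_part_def intro!: eventually_mono[OF eventually_nhds_in_open[of "{0<..}" x]])
  then show ?thesis using True by (simp add: DERIV_cong_ev[OF refl, of _ "\<lambda>x. x"])
next
  case False
  assume "x \<noteq> 0"
  then have "((\<lambda>x. 0) has_real_derivative 0) (at x)" "\<forall>\<^sub>F y in nhds x. pos_part y = 0"
    using False by (auto simp: pos_part_def intro!: eventually_mono[OF eventually_nhds_in_open[of "{..<0}" x]])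
  then show ?thesis using False by (simp add: DERIV_cong_ev[OF refl, of _ "\<lambda>x. 0"])
qed

lemma DERIV_pos_part_shift:
  assumes "x \<noteq> u"
  shows "((\<lambda>x. pos_part (x - u)) has_real_derivative (if u < x then 1 else 0)) (at x)"
proof -
  have "(pos_part has_real_derivative (if 0 < x + - u then 1 else 0)) (at (x + - u))"
    using assms by (intro DERIV_pos_part) simp
  then show ?thesis unfolding DERIV_shift by simp
qed

text \<open>The exponent is at least 2, which smooths the kink, so the formula also holds at
  0.\<close>

lemma DERIV_pos_part_power:
  "((\<lambda>x. pos_part x ^ Suc (Suc k)) has_real_derivative real (Suc (Suc k)) * pos_part x ^ Suc k) (at x)"
proof (cases "x = 0")
  case False
  have "((\<lambda>x. pos_part x ^ Suc (Suc k)) has_real_derivative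
    real (Suc (Suc k)) * pos_part x ^ Suc k * (if 0 < x then 1 else 0)) (at x)"
    using DERIV_power_Suc[OF DERIV_pos_part[OF False], of "Suc k"] by (simp add: mult_ac)
  moreover have "real (Suc (Suc k)) * pos_part x ^ Suc k * (if 0 < x then 1 else 0) = real (Suc (Suc k)) * pos_part x ^ Suc k"
    using False by (simp add: pos_part_def)
  ultimately show ?thesis by (rule DERIV_cong)
next
  case True
  have "((\<lambda>h. pos_part h ^ Suc (Suc k) / h) \<longlongrightarrow> 0) (at 0)"
  proof (rule tendsto_rabs_zero_cancel, rule tendsto_sandwich[of "\<lambda>_. 0" _ _ "\<lambda>h. \<bar>h\<bar> ^ Suc k"])
    have "((\<lambda>h::real. \<bar>h\<bar> ^ Suc k) \<longlongrightarrow> \<bar>0\<bar> ^ Suc k) (at 0)" by (intro tendsto_intros)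
    then show "((\<lambda>h::real. \<bar>h\<bar> ^ Suc k) \<longlongrightarrow> 0) (at 0)" by simp
    show "\<forall>\<^sub>F h in at 0. \<bar>pos_part h ^ Suc (Suc k) / h\<bar> \<le> \<bar>h\<bar> ^ Suc k"
    proof (intro always_eventually allI)
      fix h :: real
      show "\<bar>pos_part h ^ Suc (Suc k) / h\<bar> \<le> \<bar>h\<bar> ^ Suc k"
      proof (cases "0 < h")
        case False
        then have "\<bar>pos_part h ^ Suc (Suc k) / h\<bar> = 0" by (simp add: pos_part_def)
        then show ?thesis using zero_le_power[OF abs_ge_zero, of h "Suc k"] by (simp only:)
      qed (simp add: pos_part_def abs_mult power_abs)
    qed
  qed auto
  then show ?thesis using True by (simp add: DERIV_def pos_part_def)
qed

text \<open>Each step is linear over one gap between neighbouring nodes, so the extension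
  interpolates piecewise linearly. The open gaps are disjoint, hence at most one term of the sum is
  nonzero at \<open>x\<close>.\<close>

lemma finite_extension_0: "finite_extension 0 1"
  unfolding finite_extension_def
proof (intro allI impI)
  fix N :: nat and t :: "nat \<Rightarrow> real" and f a
  assume t: "\<forall>i j. i < j \<longrightarrow> j \<le> N \<longrightarrow> t i < t j" and N: "0 < N"
    and a: "\<forall>i. i + Suc 0 \<le> N \<longrightarrow> fact (Suc 0) * \<bar>divided_difference (t ` {i..i + Suc 0}) f\<bar> \<le> a"
  define \<phi> where "\<phi> i k x = (if k = 0 then (pos_part (x - t i) - pos_part (x - t (Suc i))) / (t (Suc i) - t i)
    else (if t i < x \<and> x < t (Suc i) then 1 / (t (Suc i) - t i) else 0))" for i and k :: nat and x
  have lt: "t i < t (Suc i)" if "Suc i \<le> N" for i using t that by simp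
  have le: "t i \<le> t j" if "i \<le> j" "j \<le> N" for i j using t that by (cases "i = j") (auto intro: less_imp_le)
  define X where "X = t ` {..N}"
  show "\<exists>D. jet 0 (1 * a) D \<and> (\<forall>l\<le>N. D 0 (t l) = f (t l))"
  proof (rule blended_extension[of N t 0 X \<phi>])
    show "finite X" by (simp add: X_def)
    fix i x assume i: "i + Suc 0 \<le> N" and x: "x \<notin> X"
    have ne: "x \<noteq> t i" "x \<noteq> t (Suc i)" using x i by (auto simp: X_def)
    have "((\<lambda>x. (pos_part (x - t i) - pos_part (x - t (Suc i))) / (t (Suc i) - t i)) has_real_derivative
      ((if t i < x then 1 else 0) - (if t (Suc i) < x then 1 else 0)) / (t (Suc i) - t i)) (at x)"
      by (intro DERIV_cdivide DERIV_diff DERIV_pos_part_shift ne)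
    moreover have "((if t i < x then 1 else 0) - (if t (Suc i) < x then 1 else 0)) / (t (Suc i) - t i) = \<phi> i (Suc 0) x"
      using lt[of i] i ne by (auto simp: \<phi>_def)
    ultimately show "(\<phi> i 0 has_real_derivative \<phi> i (Suc 0) x) (at x)"
      by (simp add: \<phi>_def[abs_def])
  next
    fix i x assume "i + Suc 0 \<le> N"
    then show "isCont (\<phi> i 0) x" using lt[of i] unfolding \<phi>_def[abs_def] by (auto intro!: continuous_intros)
  next
    fix i l assume "i + Suc 0 \<le> N" "l < i + Suc 0"
    then show "\<phi> i 0 (t l) = 0" using le[of l i] lt[of i] by (simp add: \<phi>_def pos_part_def)
  next
    fix i l assume "i + Suc 0 \<le> l" "l \<le> N"
    then show "\<phi> i 0 (t l) = (\<Prod>y\<in>t ` {Suc i..i + 0}. t l - y)"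
      using le[of "Suc i" l] lt[of i] by (simp add: \<phi>_def pos_part_def)
  next
    fix x assume x: "x \<notin> X"
    let ?c = "\<lambda>i. divided_difference (t ` {i..i + Suc 0}) f * (t (i + Suc 0) - t i)"
    define A where "A = {i. i < N \<and> t i < x \<and> x < t (Suc i)}"
    have "(\<Sum>i<N. \<bar>?c i * \<phi> i (Suc 0) x\<bar>) = (\<Sum>i\<in>A. \<bar>?c i * \<phi> i (Suc 0) x\<bar>)"
      by (intro sum.mono_neutral_right) (auto simp: A_def \<phi>_def)
    also have "\<dots> \<le> (\<Sum>i\<in>A. a)"
    proof (rule sum_mono)
      fix i assume i: "i \<in> A"
      then have "\<bar>divided_difference (t ` {i..i + Suc 0}) f\<bar> \<le> a" using a by (auto simp: A_def)
      then show "\<bar>?c i * \<phi> i (Suc 0) x\<bar> \<le> a" using i lt[of i] by (simp add: A_def \<phi>_def)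
    qed
    also have "\<dots> \<le> a"
    proof (cases "A = {}")
      case True
      have "\<bar>divided_difference (t ` {0..0 + Suc 0}) f\<bar> \<le> a" using a[rule_format, of 0] N by simp
      then have "0 \<le> a" by (rule order_trans[OF abs_ge_zero])
      then show ?thesis using True by simp
    next
      case False
      then obtain r where r: "r \<in> A" by blast
      have "i = r" if i: "i \<in> A" for i
      proof (rule ccontr)
        assume "i \<noteq> r"
        then consider "Suc i \<le> r" | "Suc r \<le> i" by linarith
        then show False using i r le[of "Suc i" r] le[of "Suc r" i] by cases (auto simp: A_def)
      qed
      then have "A = {r}" using r by blast
      then show ?thesis by simp
    qed
    finally have "(\<Sum>i<N. \<bar>?c i * \<phi> i (Suc 0) x\<bar>) \<le> a" .
    then show "\<bar>\<Sum>i<N - 0. ?c i * \<phi> i (Suc 0) x\<bar> \<le> 1 * a"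
      by (simp only: minus_nat.diff_0 mult_1) (rule order_trans[OF sum_abs])
  qed (use t N in auto)
qed

text \<open>\<open>parabolic_bump a b c 0\<close> vanishes left of \<open>a\<close> and at \<open>b\<close>, and equals \<open>x - b\<close> right of \<open>c\<close>. Its
  second derivative is a multiple of \<open>-1, 3, 3, -1\<close> on the halves of \<open>[a, b]\<close> and \<open>[b, c]\<close>.\<close>

definition parabolic_bump :: "real \<Rightarrow> real \<Rightarrow> real \<Rightarrow> nat \<Rightarrow> real \<Rightarrow> real" where
  "parabolic_bump a b c k x = (let p = (a + b) / 2; q = (b + c) / 2 in
     if k = 0 then (- (pos_part (x - a) ^ 2) + 4 * pos_part (x - p) ^ 2 - 4 * pos_part (x - q) ^ 2 + pos_part (x - c) ^ 2) / (2 * (c - a))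
     else if k = 1 then (- pos_part (x - a) + 4 * pos_part (x - p) - 4 * pos_part (x - q) + pos_part (x - c)) / (c - a)
     else (if a < x \<and> x < p \<or> q < x \<and> x < c then -1 else if p < x \<and> x < q then 3 else 0) / (c - a))"

lemma DERIV_pos_part_shift_square:
  "((\<lambda>x. pos_part (x - u) ^ 2) has_real_derivative 2 * pos_part (x - u)) (at x)"
proof -
  have "((\<lambda>x. pos_part x ^ 2) has_real_derivative 2 * pos_part (x + - u)) (at (x + - u))"
    using DERIV_pos_part_power[of 0 "x + - u"] by (simp add: numeral_2_eq_2)
  then show ?thesis unfolding DERIV_shift by simp
qed

lemma DERIV_parabolic_bump_0:
  assumes "a < c"
  shows "(parabolic_bump a b c 0 has_real_derivative parabolic_bump a b c (Suc 0) x) (at x)"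
proof -
  let ?p = "(a + b) / 2" and ?q = "(b + c) / 2"
  have "((\<lambda>x. (- (pos_part (x - a) ^ 2) + 4 * pos_part (x - ?p) ^ 2 - 4 * pos_part (x - ?q) ^ 2 + pos_part (x - c) ^ 2) / (2 * (c - a)))
    has_real_derivative (- (2 * pos_part (x - a)) + 4 * (2 * pos_part (x - ?p)) - 4 * (2 * pos_part (x - ?q)) + 2 * pos_part (x - c)) / (2 * (c - a))) (at x)"
    by (intro DERIV_cdivide DERIV_add DERIV_diff DERIV_minus DERIV_cmult DERIV_pos_part_shift_square)
  moreover have "(- (2 * pos_part (x - a)) + 4 * (2 * pos_part (x - ?p)) - 4 * (2 * pos_part (x - ?q)) + 2 * pos_part (x - c)) / (2 * (c - a))
    = parabolic_bump a b c (Suc 0) x"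
    using assms by (simp add: parabolic_bump_def Let_def divide_simps) (simp add: algebra_simps)
  ultimately have "((\<lambda>x. (- (pos_part (x - a) ^ 2) + 4 * pos_part (x - ?p) ^ 2 - 4 * pos_part (x - ?q) ^ 2 + pos_part (x - c) ^ 2) / (2 * (c - a)))
    has_real_derivative parabolic_bump a b c (Suc 0) x) (at x)" by (rule DERIV_cong)
  then show ?thesis by (simp add: parabolic_bump_def[abs_def] Let_def)
qed

lemma DERIV_parabolic_bump_1:
  assumes "a < b" "b < c" "x \<notin> {a, (a + b) / 2, (b + c) / 2, c}"
  shows "(parabolic_bump a b c (Suc 0) has_real_derivative parabolic_bump a b c (Suc (Suc 0)) x) (at x)"
proof -
  let ?p = "(a + b) / 2" and ?q = "(b + c) / 2"
  have pq: "a < ?p" "?p < ?q" "?q < c" using assms by auto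
  have "((\<lambda>x. (- pos_part (x - a) + 4 * pos_part (x - ?p) - 4 * pos_part (x - ?q) + pos_part (x - c)) / (c - a))
    has_real_derivative (- (if a < x then 1 else 0) + 4 * (if ?p < x then 1 else 0) - 4 * (if ?q < x then 1 else 0) + (if c < x then 1 else 0)) / (c - a)) (at x)"
    using assms(3) by (intro DERIV_cdivide DERIV_add DERIV_diff DERIV_minus DERIV_cmult DERIV_pos_part_shift) auto
  moreover have "(- (if a < x then 1 else 0) + 4 * (if ?p < x then 1 else 0) - 4 * (if ?q < x then 1 else 0) + (if c < x then 1 else 0)) / (c - a)
    = parabolic_bump a b c (Suc (Suc 0)) x"
  proof -
    have "x \<noteq> a" "x \<noteq> ?p" "x \<noteq> ?q" "x \<noteq> c" using assms(3) by auto
    then consider "x < a" | "a < x" "x < ?p" | "?p < x" "x < ?q" | "?q < x" "x < c" | "c < x" by linarith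
    then show ?thesis using pq by cases (simp_all add: parabolic_bump_def Let_def)
  qed
  ultimately have "((\<lambda>x. (- pos_part (x - a) + 4 * pos_part (x - ?p) - 4 * pos_part (x - ?q) + pos_part (x - c)) / (c - a))
    has_real_derivative parabolic_bump a b c (Suc (Suc 0)) x) (at x)" by (rule DERIV_cong)
  then show ?thesis by (simp add: parabolic_bump_def[abs_def] Let_def)
qed

lemma parabolic_bump_values:
  assumes "a < b" "b < c"
  shows "x \<le> a \<Longrightarrow> parabolic_bump a b c 0 x = 0" "parabolic_bump a b c 0 b = 0"
    "c \<le> x \<Longrightarrow> parabolic_bump a b c 0 x = x - b"
proof -
  show "parabolic_bump a b c 0 x = 0" if "x \<le> a"
    using assms that by (simp add: parabolic_bump_def pos_part_def Let_def)
  have "pos_part (b - a) = b - a" "pos_part (b - (a + b) / 2) = (b - a) / 2"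
    "pos_part (b - (b + c) / 2) = 0" "pos_part (b - c) = 0"
    using assms by (auto simp: pos_part_def field_simps)
  then have "parabolic_bump a b c 0 b = (- ((b - a)^2) + 4 * ((b - a) / 2)^2 - 4 * 0^2 + 0^2) / (2 * (c - a))"
    by (simp only: parabolic_bump_def Let_def if_True refl)
  then show "parabolic_bump a b c 0 b = 0" by (simp add: power2_eq_square)
  show "parabolic_bump a b c 0 x = x - b" if "c \<le> x"
  proof -
    have "pos_part (x - a) = x - a" "pos_part (x - (a + b) / 2) = x - (a + b) / 2"
      "pos_part (x - (b + c) / 2) = x - (b + c) / 2" "pos_part (x - c) = x - c"
      using assms that by (auto simp: pos_part_def)
    then have "parabolic_bump a b c 0 x = (- ((x - a)^2) + 4 * (x - (a + b) / 2)^2 - 4 * (x - (b + c) / 2)^2 + (x - c)^2) / (2 * (c - a))"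
      by (simp add: parabolic_bump_def Let_def)
    also have "- ((x - a)^2) + 4 * (x - (a + b) / 2)^2 - 4 * (x - (b + c) / 2)^2 + (x - c)^2 = (x - b) * (2 * (c - a))"
      by (simp add: power2_eq_square field_simps)
    finally show ?thesis using assms by simp
  qed
qed

text \<open>In a gap between neighbouring nodes at most two bumps have a nonzero second derivative:
  the one whose support starts with this gap and the one whose support ends with it. Their weights
  are 1 and 3 on one half of the gap and 3 and 1 on the other, so they add up to at most 4. Divided
  differences are at most \<open>a / 2\<close>, which gives \<open>2 * a\<close>.\<close>

lemma finite_extension_1: "finite_extension 1 2"
  unfolding finite_extension_def
proof (intro allI impI)
  fix N :: nat and t :: "nat \<Rightarrow> real" and f a
  assume t: "\<forall>i j. i < j \<longrightarrow> j \<le> N \<longrightarrow> t i < t j" and N: "1 < N"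
    and a: "\<forall>i. i + Suc 1 \<le> N \<longrightarrow> fact (Suc 1) * \<bar>divided_difference (t ` {i..i + Suc 1}) f\<bar> \<le> a"
  define \<phi> where "\<phi> i = parabolic_bump (t i) (t (Suc i)) (t (Suc (Suc i)))" for i
  have lt: "t i < t (Suc i)" if "Suc i \<le> N" for i using t that by simp
  have le: "t i \<le> t j" if "i \<le> j" "j \<le> N" for i j using t that by (cases "i = j") (auto intro: less_imp_le)
  define h where "h i = (t i + t (Suc i)) / 2" for i
  define X where "X = t ` {..N} \<union> h ` {..N}"
  have lts: "t i < t (Suc i)" "t (Suc i) < t (Suc (Suc i))" if "i + Suc 1 \<le> N" for i
    using lt[of i] lt[of "Suc i"] that by auto
  show "\<exists>D. jet 1 (2 * a) D \<and> (\<forall>l\<le>N. D 0 (t l) = f (t l))"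
  proof (rule blended_extension[of N t 1 X \<phi>])
    show "finite X" by (simp add: X_def)
    fix i k x assume i: "i + Suc 1 \<le> N" and "k < (1::nat)"
    then have "k = 0" "t i < t (Suc (Suc i))" using lts[OF i] by auto
    then show "(\<phi> i k has_real_derivative \<phi> i (Suc k) x) (at x)"
      unfolding \<phi>_def using DERIV_parabolic_bump_0 by blast
  next
    fix i x assume i: "i + Suc 1 \<le> N" and x: "x \<notin> X"
    have "t i \<in> X" "h i \<in> X" "h (Suc i) \<in> X" "t (Suc (Suc i)) \<in> X" using i by (auto simp: X_def)
    then have "x \<notin> {t i, h i, h (Suc i), t (Suc (Suc i))}" using x by auto
    then show "(\<phi> i 1 has_real_derivative \<phi> i (Suc 1) x) (at x)"
      using DERIV_parabolic_bump_1[OF lts[OF i], of x] by (simp add: \<phi>_def h_def)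
  next
    fix i x assume i: "i + Suc 1 \<le> N"
    then have "t i < t (Suc (Suc i))" using lts[OF i] by auto
    then show "isCont (\<phi> i 1) x"
      unfolding \<phi>_def parabolic_bump_def[abs_def] Let_def by (auto intro!: continuous_intros)
  next
    fix i l assume i: "i + Suc 1 \<le> N" "l < i + Suc 1"
    then consider "l \<le> i" | "l = Suc i" by linarith
    then show "\<phi> i 0 (t l) = 0"
      using parabolic_bump_values(1,2)[OF lts[OF i(1)]] le[of l i] i by cases (auto simp: \<phi>_def)
  next
    fix i l assume i: "i + Suc 1 \<le> l" "l \<le> N"
    then have "i + Suc 1 \<le> N" by simp
    from parabolic_bump_values(3)[OF lts[OF this], of "t l"]
    show "\<phi> i 0 (t l) = (\<Prod>y\<in>t ` {Suc i..i + 1}. t l - y)"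
      using le[of "Suc (Suc i)" l] i by (simp add: \<phi>_def)
  next
    fix x assume x: "x \<notin> X"
    let ?c = "\<lambda>i. divided_difference (t ` {i..i + Suc 1}) f * (t (i + Suc 1) - t i)"
    obtain M where M: "N = Suc M" using N by (cases N) auto
    have a0: "0 \<le> a"
    proof -
      have "fact (Suc 1) * \<bar>divided_difference (t ` {0..0 + Suc 1}) f\<bar> \<le> a" using a N by (metis Suc_leI add_0 One_nat_def)
      moreover have "0 \<le> fact (Suc 1) * \<bar>divided_difference (t ` {0..0 + Suc 1}) f\<bar>" by simp
      ultimately show ?thesis by linarith
    qed
    \<comment> \<open>\<open>u j\<close> is the weight in gap \<open>j\<close> of the bump that
      starts at \<open>t j\<close>, and \<open>v j\<close> that of the bump that ends at
      \<open>t (Suc j)\<close>.\<close>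
    define u where "u j = (if t j < x \<and> x < h j then 1 else if h j < x \<and> x < t (Suc j) then 3 else 0 :: real)" for j
    define v where "v j = (if t j < x \<and> x < h j then 3 else if h j < x \<and> x < t (Suc j) then 1 else 0 :: real)" for j
    have uv0: "u j \<ge> 0" "v j \<ge> 0" for j by (auto simp: u_def v_def)
    have b: "\<bar>?c i * \<phi> i (Suc 1) x\<bar> \<le> a / 2 * (u i + v (Suc i))" if i: "i < M" for i
    proof -
      have iN: "i + Suc 1 \<le> N" using i M by simp
      note l = lts[OF iN]
      define H where "H = t (Suc (Suc i)) - t i"
      have H: "H > 0" using l by (simp add: H_def)
      have X: "t i \<in> X" "h i \<in> X" "t (Suc i) \<in> X" "h (Suc i) \<in> X" "t (Suc (Suc i)) \<in> X" using iN by (auto simp: X_def)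
      have "\<bar>\<phi> i (Suc 1) x\<bar> \<le> (u i + v (Suc i)) / H"
      proof -
        have pq: "t i < h i" "h i < t (Suc i)" "t (Suc i) < h (Suc i)" "h (Suc i) < t (Suc (Suc i))"
          using l by (auto simp: h_def)
        have "x \<noteq> t i" "x \<noteq> h i" "x \<noteq> t (Suc i)" "x \<noteq> h (Suc i)" "x \<noteq> t (Suc (Suc i))" using x X by auto
        then consider "x < t i" | "t i < x" "x < h i" | "h i < x" "x < t (Suc i)" | "t (Suc i) < x" "x < h (Suc i)"
          | "h (Suc i) < x" "x < t (Suc (Suc i))" | "t (Suc (Suc i)) < x" by linarith
        then show ?thesis
          using pq H by cases (simp_all add: \<phi>_def parabolic_bump_def Let_def u_def v_def h_def[symmetric] H_def[symmetric])
      qed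
      moreover have "\<bar>?c i\<bar> \<le> a / 2 * H"
      proof -
        have "fact (Suc 1) * \<bar>divided_difference (t ` {i..i + Suc 1}) f\<bar> \<le> a" using a iN by blast
        moreover have "fact (Suc 1) = (2 :: real)" by simp
        ultimately have "\<bar>divided_difference (t ` {i..i + Suc 1}) f\<bar> \<le> a / 2" by (simp only:)
        then have "\<bar>divided_difference (t ` {i..i + Suc 1}) f\<bar> * H \<le> a / 2 * H" using H by (intro mult_right_mono) auto
        then show ?thesis using H by (simp add: abs_mult H_def)
      qed
      ultimately have "\<bar>?c i\<bar> * \<bar>\<phi> i (Suc 1) x\<bar> \<le> (a / 2 * H) * ((u i + v (Suc i)) / H)"
        using a0 H by (intro mult_mono) auto
      then show ?thesis using H by (simp add: abs_mult)
    qed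
    have "(\<Sum>i<M. u i) \<le> (\<Sum>j<N. u j)" using uv0 M by simp
    moreover have "(\<Sum>i<M. v (Suc i)) \<le> (\<Sum>j<N. v j)" using uv0 unfolding M sum.lessThan_Suc_shift by simp
    ultimately have "(\<Sum>i<M. u i + v (Suc i)) \<le> (\<Sum>j<N. u j + v j)" by (simp add: sum.distrib)
    also have "\<dots> \<le> 4"
    proof -
      define A where "A = {j. j < N \<and> t j < x \<and> x < t (Suc j)}"
      have hj: "t j < h j" "h j < t (Suc j)" if "j < N" for j using lt[of j] that by (auto simp: h_def)
      have "(\<Sum>j<N. u j + v j) \<le> (\<Sum>j<N. if j \<in> A then 4 else 0)"
      proof (rule sum_mono)
        fix j assume "j \<in> {..<N}"
        then show "u j + v j \<le> (if j \<in> A then 4 else 0)" using hj[of j] by (auto simp: u_def v_def A_def)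
      qed
      also have "\<dots> = (\<Sum>j\<in>A. 4)" by (intro sum.mono_neutral_cong_right) (auto simp: A_def)
      also have "\<dots> \<le> 4"
      proof (cases "A = {}")
        case False
        then obtain r where r: "r \<in> A" by blast
        have "i = r" if i: "i \<in> A" for i
        proof (rule ccontr)
          assume "i \<noteq> r"
          then consider "Suc i \<le> r" | "Suc r \<le> i" by linarith
          then show False using i r le[of "Suc i" r] le[of "Suc r" i] by cases (auto simp: A_def)
        qed
        then have "A = {r}" using r by blast
        then show ?thesis by simp
      qed simp
      finally show ?thesis .
    qed
    finally have S: "(\<Sum>i<M. u i + v (Suc i)) \<le> 4" .
    have "\<bar>\<Sum>i<N - 1. ?c i * \<phi> i (Suc 1) x\<bar> \<le> (\<Sum>i<M. \<bar>?c i * \<phi> i (Suc 1) x\<bar>)"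
      unfolding M by (simp only: diff_Suc_1) (rule sum_abs)
    also have "\<dots> \<le> (\<Sum>i<M. a / 2 * (u i + v (Suc i)))" using b by (intro sum_mono) auto
    also have "\<dots> = a / 2 * (\<Sum>i<M. u i + v (Suc i))" by (simp only: sum_distrib_left)
    also have "\<dots> \<le> a / 2 * 4" using S a0 by (intro mult_left_mono) auto
    finally show "\<bar>\<Sum>i<N - 1. ?c i * \<phi> i (Suc 1) x\<bar> \<le> 2 * a" by simp
  qed (use t N in auto)
qed

section \<open>Smooth steps for general order\<close>

definition nabla :: "(real \<Rightarrow> real) \<Rightarrow> real \<Rightarrow> real" where
  "nabla g x = g x - g (x - 1)"

text \<open>The \<open>j\<close>-fold antiderivative, zero left of 0, of the ramp that rises
  linearly from 0 at 0 to 1 at \<open>\<theta>\<close>.\<close>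

definition ramp_antiderivative :: "real \<Rightarrow> nat \<Rightarrow> real \<Rightarrow> real" where
  "ramp_antiderivative \<theta> j x = (pos_part x ^ Suc j - pos_part (x - \<theta>) ^ Suc j) / (\<theta> * fact (Suc j))"

lemma DERIV_ramp_antiderivative:
  "(ramp_antiderivative \<theta> (Suc j) has_real_derivative ramp_antiderivative \<theta> j x) (at x)"
proof -
  have sh: "((\<lambda>x. pos_part (x - \<theta>) ^ Suc (Suc j)) has_real_derivative real (Suc (Suc j)) * pos_part (x - \<theta>) ^ Suc j) (at x)"
  proof -
    have "((\<lambda>x. pos_part x ^ Suc (Suc j)) has_real_derivative real (Suc (Suc j)) * pos_part (x + - \<theta>) ^ Suc j) (at (x + - \<theta>))"
      by (rule DERIV_pos_part_power)
    then show ?thesis unfolding DERIV_shift by simp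
  qed
  have "((\<lambda>x. (pos_part x ^ Suc (Suc j) - pos_part (x - \<theta>) ^ Suc (Suc j)) / (\<theta> * fact (Suc (Suc j)))) has_real_derivative
    (real (Suc (Suc j)) * pos_part x ^ Suc j - real (Suc (Suc j)) * pos_part (x - \<theta>) ^ Suc j) / (\<theta> * fact (Suc (Suc j)))) (at x)"
    by (intro DERIV_cdivide DERIV_diff DERIV_pos_part_power sh)
  moreover have "(real (Suc (Suc j)) * pos_part x ^ Suc j - real (Suc (Suc j)) * pos_part (x - \<theta>) ^ Suc j) / (\<theta> * fact (Suc (Suc j)))
    = ramp_antiderivative \<theta> j x"
  proof -
    have "(real (Suc (Suc j)) * pos_part x ^ Suc j - real (Suc (Suc j)) * pos_part (x - \<theta>) ^ Suc j) / (\<theta> * fact (Suc (Suc j)))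
      = (real (Suc (Suc j)) * (pos_part x ^ Suc j - pos_part (x - \<theta>) ^ Suc j)) / (real (Suc (Suc j)) * (\<theta> * fact (Suc j)))"
      by (simp only: fact_Suc right_diff_distrib mult.left_commute)
    also have "\<dots> = ramp_antiderivative \<theta> j x"
      unfolding ramp_antiderivative_def by (rule mult_divide_mult_cancel_left) simp
    finally show ?thesis .
  qed
  ultimately show ?thesis unfolding ramp_antiderivative_def[abs_def] by (rule DERIV_cong)
qed

lemma DERIV_nabla_funpow:
  assumes "\<And>x. (f has_real_derivative f' x) (at x)"
  shows "((nabla ^^ i) f has_real_derivative (nabla ^^ i) f' x) (at x)"
proof (induction i arbitrary: x)
  case (Suc i)
  have "((nabla ^^ i) f has_real_derivative (nabla ^^ i) f' (x + - 1)) (at (x + - 1))" by (rule Suc.IH)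
  then have "((\<lambda>x. (nabla ^^ i) f (x - 1)) has_real_derivative (nabla ^^ i) f' (x - 1)) (at x)"
    unfolding DERIV_shift by simp
  from DERIV_diff[OF Suc.IH this] show ?case by (simp add: nabla_def[abs_def])
qed (simp add: assms)

text \<open>The derivative of order \<open>k\<close> of the ramp averaged \<open>m\<close> times
  over unit intervals, that is, convolved with a cardinal B-spline. The averaging spreads the rise
  over \<open>[0, m + \<theta>]\<close>. A jump in place of the ramp would leave breakpoints at
  order \<open>m\<close>; with \<open>\<theta> > 0\<close> the derivatives up to order
  \<open>m\<close> exist everywhere.\<close>

definition smooth_step :: "real \<Rightarrow> nat \<Rightarrow> nat \<Rightarrow> real \<Rightarrow> real" where
  "smooth_step \<theta> m k = (nabla ^^ m) (ramp_antiderivative \<theta> (m - k))"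

lemma DERIV_smooth_step:
  assumes "k < m"
  shows "(smooth_step \<theta> m k has_real_derivative smooth_step \<theta> m (Suc k) x) (at x)"
proof -
  have "m - k = Suc (m - Suc k)" using assms by simp
  then show ?thesis unfolding smooth_step_def using DERIV_nabla_funpow[OF DERIV_ramp_antiderivative] by simp
qed

text \<open>\<open>smooth_step \<theta> (Suc m) 0 x\<close> is the mean value of \<open>smooth_step \<theta> m 0\<close> over \<open>[x - 1, x]\<close>.\<close>

lemma smooth_step_range:
  assumes \<theta>: "0 < \<theta>"
  shows "0 \<le> smooth_step \<theta> m 0 x" "smooth_step \<theta> m 0 x \<le> 1" "x \<le> 0 \<Longrightarrow> smooth_step \<theta> m 0 x = 0"
    "real m + \<theta> \<le> x \<Longrightarrow> smooth_step \<theta> m 0 x = 1"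
proof -
  have "0 \<le> smooth_step \<theta> m 0 x \<and> smooth_step \<theta> m 0 x \<le> 1 \<and> (x \<le> 0 \<longrightarrow> smooth_step \<theta> m 0 x = 0) \<and>
    (real m + \<theta> \<le> x \<longrightarrow> smooth_step \<theta> m 0 x = 1)"
  proof (induction m arbitrary: x)
    case 0
    show ?case using \<theta> by (auto simp: smooth_step_def ramp_antiderivative_def pos_part_def field_simps max_def)
  next
    case (Suc m)
    define A where "A = (nabla ^^ m) (ramp_antiderivative \<theta> (Suc m))"
    have A: "(A has_real_derivative smooth_step \<theta> m 0 y) (at y)" for y
      unfolding A_def smooth_step_def using DERIV_nabla_funpow[OF DERIV_ramp_antiderivative] by simp
    have "\<exists>z>x - 1. z < x \<and> A x - A (x - 1) = (x - (x - 1)) * smooth_step \<theta> m 0 z"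
      by (rule MVT2) (use A in auto)
    then obtain z where z: "x - 1 < z" "z < x" "A x - A (x - 1) = smooth_step \<theta> m 0 z" by auto
    have "smooth_step \<theta> (Suc m) 0 x = smooth_step \<theta> m 0 z"
      using z(3) by (simp add: smooth_step_def A_def nabla_def)
    then show ?case using Suc.IH[of z] z(1,2) by auto
  qed
  then show "0 \<le> smooth_step \<theta> m 0 x" "smooth_step \<theta> m 0 x \<le> 1" "x \<le> 0 \<Longrightarrow> smooth_step \<theta> m 0 x = 0"
    "real m + \<theta> \<le> x \<Longrightarrow> smooth_step \<theta> m 0 x = 1" by auto
qed

text \<open>The first difference of values in \<open>[0, 1]\<close> is at most 1; only the later
  ones double. The factor 2 saved here is why the weight estimate has \<open>m / 2\<close> and not
  \<open>m\<close>.\<close>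

lemma nabla_funpow_bound:
  assumes "\<And>x. 0 \<le> g x \<and> g x \<le> 1"
  shows "\<bar>(nabla ^^ Suc i) g x\<bar> \<le> 2 ^ i"
proof (induction i arbitrary: x)
  case 0
  show ?case using assms[of x] assms[of "x - 1"] by (auto simp: nabla_def)
next
  case (Suc i)
  have "\<bar>(nabla ^^ Suc (Suc i)) g x\<bar> \<le> \<bar>(nabla ^^ Suc i) g x\<bar> + \<bar>(nabla ^^ Suc i) g (x - 1)\<bar>"
    by (subst funpow.simps(2)) (simp only: comp_def nabla_def abs_triangle_ineq4)
  then show ?case using Suc.IH[of x] Suc.IH[of "x - 1"] by simp
qed

lemma nabla_funpow_0:
  assumes "\<And>x. x \<le> 0 \<Longrightarrow> g x = 0" "x \<le> 0"
  shows "(nabla ^^ i) g x = 0"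
  using assms(2) by (induction i arbitrary: x) (simp_all add: assms(1) nabla_def)

lemma nabla_funpow_1:
  assumes "\<And>x. s \<le> x \<Longrightarrow> g x = 1" "s + real (Suc i) \<le> x"
  shows "(nabla ^^ Suc i) g x = 0"
  using assms(2)
proof (induction i arbitrary: x)
  case 0
  then show ?case using assms(1)[of x] assms(1)[of "x - 1"] by (simp add: nabla_def)
next
  case (Suc i)
  have "(nabla ^^ Suc i) g x = 0" "(nabla ^^ Suc i) g (x - 1) = 0" using Suc by (simp_all del: funpow.simps)
  then show ?case by (subst funpow.simps(2)) (simp only: comp_def nabla_def diff_self)
qed

text \<open>Differentiation turns one averaging into one backward difference, so a derivative of the
  step is an iterated difference of a less averaged step, which still has values in
  \<open>[0, 1]\<close>.\<close>

lemma smooth_step_nabla: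
  assumes "k \<le> m"
  shows "smooth_step \<theta> m k = (nabla ^^ k) (smooth_step \<theta> (m - k) 0)"
  using assms by (simp add: smooth_step_def flip: funpow_add[THEN fun_cong, unfolded comp_def])

lemma smooth_step_derivative_bound:
  assumes "0 < \<theta>" "Suc k \<le> m"
  shows "\<bar>smooth_step \<theta> m (Suc k) x\<bar> \<le> 2 ^ k"
    "x \<le> 0 \<or> real m + \<theta> \<le> x \<Longrightarrow> smooth_step \<theta> m (Suc k) x = 0"
proof -
  note eq = smooth_step_nabla[OF assms(2), of \<theta>] and r = smooth_step_range[OF assms(1), where m = "m - Suc k"]
  show "\<bar>smooth_step \<theta> m (Suc k) x\<bar> \<le> 2 ^ k"
    unfolding eq using r(1,2) by (intro nabla_funpow_bound) auto
  assume "x \<le> 0 \<or> real m + \<theta> \<le> x"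
  then show "smooth_step \<theta> m (Suc k) x = 0"
  proof
    assume "x \<le> 0"
    then show ?thesis unfolding eq using r(3) by (intro nabla_funpow_0) auto
  next
    assume x: "real m + \<theta> \<le> x"
    show ?thesis unfolding eq
    proof (rule nabla_funpow_1[of "real (m - Suc k) + \<theta>"])
      show "smooth_step \<theta> (m - Suc k) 0 y = 1" if "real (m - Suc k) + \<theta> \<le> y" for y using r(4) that by simp
      show "real (m - Suc k) + \<theta> + real (Suc k) \<le> x" using x assms(2) by simp
    qed
  qed
qed

section \<open>Derivative bounds for the smooth blending\<close>

lemma DERIV_Leibniz:
  fixes f g :: "nat \<Rightarrow> real \<Rightarrow> real"
  assumes f: "\<And>j. j \<le> k \<Longrightarrow> (f j has_real_derivative f (Suc j) x) (at x)"
    and g: "\<And>j. j \<le> k \<Longrightarrow> (g j has_real_derivative g (Suc j) x) (at x)"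
  shows "((\<lambda>x. \<Sum>j\<le>k. real (k choose j) * (f (k - j) x * g j x)) has_real_derivative
    (\<Sum>j\<le>Suc k. real (Suc k choose j) * (f (Suc k - j) x * g j x))) (at x)"
proof -
  have "((\<lambda>x. \<Sum>j\<le>k. real (k choose j) * (f (k - j) x * g j x)) has_real_derivative
    (\<Sum>j\<le>k. real (k choose j) * (f (Suc (k - j)) x * g j x + g (Suc j) x * f (k - j) x))) (at x)"
    using f g by (intro DERIV_sum DERIV_cmult DERIV_mult) auto
  moreover have "(\<Sum>j\<le>k. real (k choose j) * (f (Suc (k - j)) x * g j x + g (Suc j) x * f (k - j) x))
    = (\<Sum>j\<le>Suc k. real (Suc k choose j) * (f (Suc k - j) x * g j x))"
  proof -
    have "(\<Sum>j\<le>Suc k. real (Suc k choose j) * (f (Suc k - j) x * g j x))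
      = f (Suc k) x * g 0 x + (\<Sum>j\<le>k. real (k choose j) * (f (k - j) x * g (Suc j) x))
        + (\<Sum>j\<le>k. real (k choose Suc j) * (f (k - j) x * g (Suc j) x))"
      by (subst sum.atMost_Suc_shift) (simp add: sum.distrib[symmetric] algebra_simps)
    also have "f (Suc k) x * g 0 x + (\<Sum>j\<le>k. real (k choose j) * (f (k - j) x * g (Suc j) x))
        + (\<Sum>j\<le>k. real (k choose Suc j) * (f (k - j) x * g (Suc j) x))
      = (\<Sum>j\<le>k. real (k choose j) * (f (k - j) x * g (Suc j) x))
        + (\<Sum>j\<le>Suc k. real (k choose j) * (f (Suc k - j) x * g j x))"
      by (subst sum.atMost_Suc_shift[of _ k]) simp
    also have "(\<Sum>j\<le>Suc k. real (k choose j) * (f (Suc k - j) x * g j x)) = (\<Sum>j\<le>k. real (k choose j) * (f (Suc (k - j)) x * g j x))"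
      by (simp add: Suc_diff_le)
    finally show ?thesis by (simp add: sum.distrib[symmetric] algebra_simps)
  qed
  ultimately show ?thesis by simp
qed

text \<open>Each differentiation removes one linear factor in all possible ways, which accounts for
  the falling factorial.\<close>

lemma higher_pderiv_prod_linear_bound:
  fixes A :: "real set"
  assumes "finite A" "\<And>y. y \<in> A \<Longrightarrow> \<bar>x - y\<bar> \<le> L" "k \<le> card A"
  shows "\<bar>poly ((pderiv ^^ k) (\<Prod>y\<in>A. [:- y, 1:])) x\<bar> \<le> fact (card A) / fact (card A - k) * L ^ (card A - k)"
  using assms
proof (induction k arbitrary: A)
  case 0
  have "\<bar>poly (\<Prod>y\<in>A. [:- y, 1:]) x\<bar> = (\<Prod>y\<in>A. \<bar>x - y\<bar>)" by (simp add: poly_prod abs_prod)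
  also have "\<dots> \<le> (\<Prod>y\<in>A. L)" using 0 by (intro prod_mono) auto
  finally show ?case by simp
next
  case (Suc k)
  define c where "c = card A - 1"
  have c: "card A = Suc c" "k \<le> c" using Suc.prems by (auto simp: c_def)
  have L: "0 \<le> L"
  proof -
    obtain y where "y \<in> A" using c by (metis card.empty ex_in_conv nat.distinct(1))
    then show ?thesis using Suc.prems(2)[of y] by linarith
  qed
  have "(pderiv ^^ Suc k) (\<Prod>y\<in>A. [:- y, 1:]) = (pderiv ^^ k) (\<Sum>a\<in>A. \<Prod>y\<in>A - {a}. [:- y, 1:])"
    by (simp add: funpow_Suc_right pderiv_prod pderiv_pCons del: funpow.simps)
  also have "\<dots> = (\<Sum>a\<in>A. (pderiv ^^ k) (\<Prod>y\<in>A - {a}. [:- y, 1:]))" by (rule higher_pderiv_sum)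
  finally have "\<bar>poly ((pderiv ^^ Suc k) (\<Prod>y\<in>A. [:- y, 1:])) x\<bar> = \<bar>\<Sum>a\<in>A. poly ((pderiv ^^ k) (\<Prod>y\<in>A - {a}. [:- y, 1:])) x\<bar>"
    by (simp only: poly_sum)
  also have "\<dots> \<le> (\<Sum>a\<in>A. \<bar>poly ((pderiv ^^ k) (\<Prod>y\<in>A - {a}. [:- y, 1:])) x\<bar>)" by (rule sum_abs)
  also have "\<dots> \<le> (\<Sum>a\<in>A. fact c / fact (c - k) * L ^ (c - k))"
  proof (rule sum_mono)
    fix a assume "a \<in> A"
    then have "card (A - {a}) = c" using Suc.prems c by simp
    then show "\<bar>poly ((pderiv ^^ k) (\<Prod>y\<in>A - {a}. [:- y, 1:])) x\<bar> \<le> fact c / fact (c - k) * L ^ (c - k)"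
      using Suc.IH[of "A - {a}"] Suc.prems c by simp
  qed
  also have "\<dots> = fact (card A) / fact (card A - Suc k) * L ^ (card A - Suc k)"
    by (simp add: c)
  finally show ?case .
qed

lemma power_le_fact_mult_exp:
  fixes x :: real
  assumes "0 \<le> x"
  shows "x ^ k \<le> fact k * exp x"
proof -
  have s: "(\<lambda>i. x ^ i /\<^sub>R fact i) sums exp x" by (rule exp_converges)
  have "x ^ k /\<^sub>R fact k = (\<Sum>i\<in>{k}. x ^ i /\<^sub>R fact i)" by simp
  also have "\<dots> \<le> (\<Sum>i. x ^ i /\<^sub>R fact i)"
    using assms s by (intro sum_le_suminf) (auto simp: sums_iff)
  also have "\<dots> = exp x" using s by (simp add: sums_iff)
  finally show ?thesis by (simp add: field_simps)
qed

text \<open>From \<open>exp y \<ge> 1 + y\<close> at \<open>y = - 1 / 17\<close>, that is,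
  \<open>exp 1 \<le> (17 / 16) ^ 17\<close>. The 3 is one of the two factors of 9, and
  \<open>21 / 20\<close> is the stretch caused by the smoothing width
  \<open>\<theta> = m / 20\<close>.\<close>

lemma exp_one_le: "21 / 20 * exp (1::real) \<le> 3"
proof -
  have "16 / 17 \<le> exp (- 1 / 17 :: real)" using exp_ge_add_one_self[of "- 1 / 17 :: real"] by simp
  then have "(16 / 17) ^ 17 \<le> exp (- 1 / 17 :: real) ^ 17" by (intro power_mono) auto
  also have "\<dots> = exp (- 1)" by (simp flip: exp_of_nat_mult)
  finally have "exp 1 * (16 / 17) ^ 17 \<le> exp 1 * exp (- 1 :: real)" by (intro mult_left_mono) auto
  also have "exp 1 * exp (- 1 :: real) = 1" by (simp flip: exp_add)
  finally have "exp 1 * (16 / 17) ^ 17 \<le> (1::real)" .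
  then have "exp (1::real) \<le> (17 / 16) ^ 17" by (simp add: field_simps)
  also have "21 / 20 * (17 / 16) ^ 17 \<le> (3::real)" by (simp add: power_divide)
  finally show ?thesis by simp
qed

text \<open>The Leibniz sum for the derivative of order \<open>Suc n\<close> of node product times
  step, without the common factor \<open>fact n / L i\<close>. In the summand for
  \<open>\<mu>\<close>, \<open>Suc \<mu>\<close> derivatives fall on the step, whose rise of length
  \<open>21 / 20 * Suc n\<close> is rescaled to \<open>L i\<close>, and \<open>\<mu>\<close> linear
  factors of the product remain.\<close>

definition extension_weight :: "nat \<Rightarrow> real" where
  "extension_weight n = (\<Sum>\<mu>\<le>n. real (Suc n choose Suc \<mu>) * (21 / 20 * real (Suc n)) ^ Suc \<mu> * 2 ^ \<mu> / fact \<mu>)"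

text \<open>The estimate \<open>m ^ \<nu> / fact \<nu> \<le> exp m\<close> bounds the weight by \<open>m / 2 * (\<Sum>\<nu>. (m choose \<nu>) * 2 ^ \<nu>) * 3 ^ m\<close>.\<close>

lemma extension_weight_le: "extension_weight n \<le> real (Suc n) / 2 * 9 ^ Suc n"
proof -
  define m where "m = Suc n"
  have trm: "real (m choose Suc \<mu>) * (21 / 20 * real m) ^ Suc \<mu> * 2 ^ \<mu> / fact \<mu>
    \<le> real m / 2 * 3 ^ m * (real (m choose Suc \<mu>) * 2 ^ Suc \<mu>)" if \<mu>: "\<mu> \<le> n" for \<mu>
  proof -
    have e: "real m ^ Suc \<mu> / fact (Suc \<mu>) \<le> exp 1 ^ m"
      using power_le_fact_mult_exp[of "real m" "Suc \<mu>"] exp_of_nat_mult[of m "1::real"]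
      by (subst pos_divide_le_eq) (simp_all add: mult.commute del: fact_Suc power_Suc)
    have "(21 / 20 :: real) ^ Suc \<mu> \<le> (21 / 20) ^ m" using \<mu> by (intro power_increasing) (auto simp: m_def)
    then have "(21 / 20 :: real) ^ Suc \<mu> * (real m ^ Suc \<mu> / fact (Suc \<mu>)) \<le> (21 / 20) ^ m * exp 1 ^ m"
      using e by (intro mult_mono) auto
    also have "\<dots> = (21 / 20 * exp 1) ^ m" by (simp only: power_mult_distrib)
    also have "\<dots> \<le> 3 ^ m" using exp_one_le by (intro power_mono) auto
    finally have b: "(21 / 20 :: real) ^ Suc \<mu> * (real m ^ Suc \<mu> / fact (Suc \<mu>)) \<le> 3 ^ m" .
    \<comment> \<open>Writing \<open>1 / fact \<mu>\<close> as
      \<open>Suc \<mu> / fact (Suc \<mu>)\<close> matches the power \<open>m ^ Suc \<mu>\<close>.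
      The numerator, at most \<open>m\<close>, and the missing power of 2 give
      \<open>m / 2\<close>.\<close>
    have "(21 / 20 * real m) ^ Suc \<mu> * 2 ^ \<mu> / fact \<mu>
      = real (Suc \<mu>) / 2 * 2 ^ Suc \<mu> * ((21 / 20) ^ Suc \<mu> * (real m ^ Suc \<mu> / fact (Suc \<mu>)))"
    proof -
      have "(21 / 20 * real m) ^ Suc \<mu> = (21 / 20) ^ Suc \<mu> * real m ^ Suc \<mu>" by (rule power_mult_distrib)
      moreover have "fact (Suc \<mu>) = real (Suc \<mu>) * (fact \<mu> :: real)" by (rule fact_Suc)
      moreover have "2 ^ Suc \<mu> = 2 * (2 ^ \<mu> :: real)" by simp
      ultimately show ?thesis by (simp only:) (simp add: divide_simps del: power_Suc)
    qed
    also have "\<dots> \<le> real m / 2 * 2 ^ Suc \<mu> * 3 ^ m"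
      using \<mu> b by (intro mult_mono) (auto simp: m_def)
    finally have "real (m choose Suc \<mu>) * ((21 / 20 * real m) ^ Suc \<mu> * 2 ^ \<mu> / fact \<mu>)
      \<le> real (m choose Suc \<mu>) * (real m / 2 * 2 ^ Suc \<mu> * 3 ^ m)" by (intro mult_left_mono) auto
    then show ?thesis by (simp only: mult_ac times_divide_eq_right)
  qed
  have "extension_weight n \<le> (\<Sum>\<mu>\<le>n. real m / 2 * 3 ^ m * (real (m choose Suc \<mu>) * 2 ^ Suc \<mu>))"
    unfolding extension_weight_def m_def[symmetric] using trm by (intro sum_mono) auto
  also have "\<dots> = real m / 2 * 3 ^ m * (\<Sum>\<mu>\<le>n. real (m choose Suc \<mu>) * 2 ^ Suc \<mu>)"
    by (simp only: sum_distrib_left)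
  also have "(\<Sum>\<mu>\<le>n. real (m choose Suc \<mu>) * 2 ^ Suc \<mu>) \<le> (\<Sum>\<nu>\<le>m. real (m choose \<nu>) * 2 ^ \<nu>)"
    unfolding m_def by (subst sum.atMost_Suc_shift[of "\<lambda>\<nu>. real (Suc n choose \<nu>) * 2 ^ \<nu>" n]) simp
  also have "(\<Sum>\<nu>\<le>m. real (m choose \<nu>) * 2 ^ \<nu>) = 3 ^ m"
    using binomial_ring[of "2::real" 1 m] by simp
  finally have "extension_weight n \<le> real m / 2 * 3 ^ m * 3 ^ m" by (simp add: mult_left_mono)
  also have "\<dots> = real m / 2 * 9 ^ m" by (simp flip: power_mult_distrib)
  finally show ?thesis by (simp only: m_def)
qed

text \<open>Each term is scale invariant: the coefficient carries a factor \<open>L i\<close>, the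
  derivative of order \<open>m\<close> a factor \<open>1 / L i\<close>. At most \<open>m\<close> of
  the supports contain a given point in their interior, and \<open>fact n / fact m = 1 / m\<close>
  cancels this overlap.\<close>

lemma finite_extension_weight: "finite_extension n (extension_weight n)"
  unfolding finite_extension_def
proof (intro allI impI)
  fix N :: nat and t :: "nat \<Rightarrow> real" and f a
  assume t: "\<forall>i j. i < j \<longrightarrow> j \<le> N \<longrightarrow> t i < t j" and N: "n < N"
    and a: "\<forall>i. i + Suc n \<le> N \<longrightarrow> fact (Suc n) * \<bar>divided_difference (t ` {i..i + Suc n}) f\<bar> \<le> a"
  define m where "m = Suc n"
  \<comment> \<open>The step rises over \<open>[0, \<kappa>]\<close>, which is rescaled to
    \<open>[t i, t (i + m)]\<close>. A width \<open>\<theta>\<close> proportional to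
    \<open>m\<close> makes the stretch the fixed factor \<open>21 / 20\<close>.\<close>
  define \<theta> where "\<theta> = real m / 20"
  define \<kappa> where "\<kappa> = 21 / 20 * real m"
  have \<theta>: "0 < \<theta>" "real m + \<theta> = \<kappa>" "0 < \<kappa>" by (auto simp: \<theta>_def \<kappa>_def m_def)
  define L where "L i = t (i + m) - t i" for i
  have lt: "t i < t j" if "i < j" "j \<le> N" for i j using t that by blast
  have le: "t i \<le> t j" if "i \<le> j" "j \<le> N" for i j using lt that by (cases "i = j") (auto intro: less_imp_le)
  have L: "0 < L i" if "i + m \<le> N" for i using lt[of i "i + m"] that by (simp add: L_def m_def)
  define \<psi> where "\<psi> i k = poly ((pderiv ^^ k) (\<Prod>y\<in>t ` {Suc i..i + n}. [:- y, 1:]))" for i k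
  define G where "G i k x = (\<kappa> / L i) ^ k * smooth_step \<theta> m k (\<kappa> / L i * (x - t i))" for i k x
  define \<phi> where "\<phi> i k x = (\<Sum>j\<le>k. real (k choose j) * (\<psi> i (k - j) x * G i j x))" for i k x
  have D\<psi>: "(\<psi> i k has_real_derivative \<psi> i (Suc k) x) (at x)" for i k x
    unfolding \<psi>_def by (rule DERIV_higher_pderiv)
  have DG: "(G i k has_real_derivative G i (Suc k) x) (at x)" if "k < m" for i k x
  proof -
    let ?s = "\<kappa> / L i"
    have "((\<lambda>x. ?s * (x - t i)) has_real_derivative ?s * (1 - 0)) (at x)"
      by (intro DERIV_cmult DERIV_diff DERIV_ident DERIV_const)
    then have "((\<lambda>x. smooth_step \<theta> m k (?s * (x - t i))) has_real_derivative
      smooth_step \<theta> m (Suc k) (?s * (x - t i)) * (?s * (1 - 0))) (at x)"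
      by (rule DERIV_chain2[OF DERIV_smooth_step[OF that]])
    then have "(G i k has_real_derivative ?s ^ k * (smooth_step \<theta> m (Suc k) (?s * (x - t i)) * (?s * (1 - 0)))) (at x)"
      unfolding G_def[abs_def] by (rule DERIV_cmult)
    then show ?thesis by (rule DERIV_cong) (simp add: G_def)
  qed
  have D\<phi>: "(\<phi> i k has_real_derivative \<phi> i (Suc k) x) (at x)" if "k \<le> n" for i k x
    unfolding \<phi>_def[abs_def] using that by (intro DERIV_Leibniz D\<psi> DG) (auto simp: m_def)
  have \<psi>0: "\<psi> i 0 x = (\<Prod>y\<in>t ` {Suc i..i + n}. x - y)" for i x by (simp add: \<psi>_def poly_prod)
  have cardA: "card (t ` {Suc i..i + n}) = n" if "i + m \<le> N" for i
  proof -
    have "inj_on t {Suc i..i + n}"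
    proof (rule inj_onI)
      fix j l assume "j \<in> {Suc i..i + n}" "l \<in> {Suc i..i + n}" "t j = t l"
      then show "j = l" using lt[of j l] lt[of l j] that by (cases j l rule: linorder_cases) (auto simp: m_def)
    qed
    then show ?thesis by (simp add: card_image)
  qed
  have \<psi>m: "\<psi> i m x = 0" if i: "i + m \<le> N" for i x
  proof -
    have "coeff (\<Prod>y\<in>t ` {Suc i..i + n}. [:- y, 1:]) k = 0" if "k \<ge> m" for k
      using coeff_prod_linear(2)[of "t ` {Suc i..i + n}" k] cardA[OF i] that by (simp add: m_def)
    then have "coeff ((pderiv ^^ m) (\<Prod>y\<in>t ` {Suc i..i + n}. [:- y, 1:])) k = 0" for k
      by (subst coeff_higher_pderiv) simp
    then have "(pderiv ^^ m) (\<Prod>y\<in>t ` {Suc i..i + n}. [:- y, 1:]) = 0" by (intro poly_eqI) simp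
    then show ?thesis by (simp add: \<psi>_def)
  qed
  \<comment> \<open>Off the support every derivative of the step vanishes; the remaining Leibniz
    term puts all \<open>m\<close> derivatives on a polynomial of degree \<open>n\<close>.\<close>
  have out: "\<phi> i m x = 0" if i: "i + m \<le> N" and x: "x \<le> t i \<or> t (i + m) \<le> x" for i x
  proof -
    have "smooth_step \<theta> m (Suc j) (\<kappa> / L i * (x - t i)) = 0" if "j \<le> n" for j
    proof (rule smooth_step_derivative_bound(2)[OF \<theta>(1)])
      show "Suc j \<le> m" using that by (simp add: m_def)
      show "\<kappa> / L i * (x - t i) \<le> 0 \<or> real m + \<theta> \<le> \<kappa> / L i * (x - t i)"
        using x
      proof
        assume "x \<le> t i"
        then have "\<kappa> / L i * (x - t i) \<le> 0" using \<theta> L[OF i] by (intro mult_nonneg_nonpos) auto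
        then show ?thesis ..
      next
        assume "t (i + m) \<le> x"
        then have "\<kappa> / L i * L i \<le> \<kappa> / L i * (x - t i)" using \<theta> L[OF i] by (intro mult_left_mono) (auto simp: L_def)
        then show ?thesis using \<theta> L[OF i] by simp
      qed
    qed
    then have "G i (Suc j) x = 0" if "j \<le> n" for j using that by (simp add: G_def)
    moreover have "\<psi> i m x = 0" by (rule \<psi>m[OF i])
    ultimately show ?thesis unfolding \<phi>_def m_def by (subst sum.atMost_Suc_shift) (simp add: m_def)
  qed
  have ins: "\<bar>\<phi> i m x\<bar> \<le> fact n / L i * extension_weight n" if i: "i + m \<le> N" and x: "t i \<le> x" "x \<le> t (i + m)" for i x
  proof -
    note Li = L[OF i]
    have "\<phi> i m x = real (m choose 0) * (\<psi> i (m - 0) x * G i 0 x) + (\<Sum>\<mu>\<le>n. real (m choose Suc \<mu>) * (\<psi> i (m - Suc \<mu>) x * G i (Suc \<mu>) x))"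
      unfolding \<phi>_def m_def by (rule sum.atMost_Suc_shift)
    then have "\<bar>\<phi> i m x\<bar> = \<bar>\<Sum>\<mu>\<le>n. real (m choose Suc \<mu>) * (\<psi> i (m - Suc \<mu>) x * G i (Suc \<mu>) x)\<bar>"
      by (simp add: \<psi>m[OF i])
    also have "\<dots> \<le> (\<Sum>\<mu>\<le>n. \<bar>real (m choose Suc \<mu>) * (\<psi> i (m - Suc \<mu>) x * G i (Suc \<mu>) x)\<bar>)" by (rule sum_abs)
    also have "\<dots> \<le> (\<Sum>\<mu>\<le>n. fact n / L i * (real (m choose Suc \<mu>) * \<kappa> ^ Suc \<mu> * 2 ^ \<mu> / fact \<mu>))"
    proof (rule sum_mono)
      fix \<mu> assume "\<mu> \<in> {..n}"
      then have \<mu>: "\<mu> \<le> n" by simp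
      have "\<bar>\<psi> i (n - \<mu>) x\<bar> \<le> fact (card (t ` {Suc i..i + n})) / fact (card (t ` {Suc i..i + n}) - (n - \<mu>)) * L i ^ (card (t ` {Suc i..i + n}) - (n - \<mu>))"
        unfolding \<psi>_def
      proof (rule higher_pderiv_prod_linear_bound)
        fix y assume "y \<in> t ` {Suc i..i + n}"
        then obtain j where j: "y = t j" "Suc i \<le> j" "j \<le> i + n" by auto
        then have "t i \<le> y" "y \<le> t (i + m)" using le[of i j] le[of j "i + m"] i by (auto simp: m_def)
        then show "\<bar>x - y\<bar> \<le> L i" using x by (auto simp: L_def abs_le_iff)
      qed (use cardA[OF i] in auto)
      then have 1: "\<bar>\<psi> i (n - \<mu>) x\<bar> \<le> fact n / fact \<mu> * L i ^ \<mu>" using \<mu> cardA[OF i] by simp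
      have "\<bar>smooth_step \<theta> m (Suc \<mu>) (\<kappa> / L i * (x - t i))\<bar> \<le> 2 ^ \<mu>"
        using \<mu> by (intro smooth_step_derivative_bound(1) \<theta>) (simp add: m_def)
      then have 2: "\<bar>G i (Suc \<mu>) x\<bar> \<le> (\<kappa> / L i) ^ Suc \<mu> * 2 ^ \<mu>"
        unfolding G_def abs_mult using \<theta> Li by (intro mult_mono) auto
      have "\<bar>\<psi> i (n - \<mu>) x\<bar> * \<bar>G i (Suc \<mu>) x\<bar> \<le> (fact n / fact \<mu> * L i ^ \<mu>) * ((\<kappa> / L i) ^ Suc \<mu> * 2 ^ \<mu>)"
        using Li by (intro mult_mono 1 2) auto
      also have "\<dots> = fact n / L i * (\<kappa> ^ Suc \<mu> * 2 ^ \<mu> / fact \<mu>)"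
        using Li by (simp add: power_divide field_simps)
      finally have "real (m choose Suc \<mu>) * (\<bar>\<psi> i (n - \<mu>) x\<bar> * \<bar>G i (Suc \<mu>) x\<bar>) \<le> real (m choose Suc \<mu>) * (fact n / L i * (\<kappa> ^ Suc \<mu> * 2 ^ \<mu> / fact \<mu>))"
        by (intro mult_left_mono) auto
      moreover have "m - Suc \<mu> = n - \<mu>" by (simp add: m_def)
      ultimately show "\<bar>real (m choose Suc \<mu>) * (\<psi> i (m - Suc \<mu>) x * G i (Suc \<mu>) x)\<bar>
        \<le> fact n / L i * (real (m choose Suc \<mu>) * \<kappa> ^ Suc \<mu> * 2 ^ \<mu> / fact \<mu>)"
        by (simp only: abs_mult abs_of_nat mult_ac times_divide_eq_right)
    qed
    also have "\<dots> = fact n / L i * extension_weight n"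
      unfolding extension_weight_def \<kappa>_def m_def sum_distrib_left ..
    finally show ?thesis .
  qed
  have W: "0 \<le> extension_weight n" unfolding extension_weight_def by (intro sum_nonneg) auto
  show "\<exists>D. jet n (extension_weight n * a) D \<and> (\<forall>l\<le>N. D 0 (t l) = f (t l))"
  proof (rule blended_extension[of N t n "{}" \<phi>])
    show "(\<phi> i k has_real_derivative \<phi> i (Suc k) x) (at x)" if "k < n" for i k x using D\<phi> that by simp
    show "(\<phi> i n has_real_derivative \<phi> i (Suc n) x) (at x)" for i x using D\<phi> by simp
    show "isCont (\<phi> i n) x" for i x using D\<phi>[of n i x] DERIV_isCont by blast
  next
    fix i l assume i: "i + Suc n \<le> N" "l < i + Suc n"
    have im: "i + m \<le> N" using i by (simp add: m_def)
    consider "l \<le> i" | "Suc i \<le> l" "l \<le> i + n" using i by linarith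
    then show "\<phi> i 0 (t l) = 0"
    proof cases
      case 1
      then have "\<kappa> / L i * (t l - t i) \<le> 0" using le[of l i] i \<theta> L[OF im] by (intro mult_nonneg_nonpos) auto
      then have "G i 0 (t l) = 0" using smooth_step_range(3)[OF \<theta>(1)] by (simp add: G_def)
      then show ?thesis by (simp add: \<phi>_def)
    next
      case 2
      then have "\<psi> i 0 (t l) = 0" unfolding \<psi>0 by (auto simp: prod_zero_iff)
      then show ?thesis by (simp add: \<phi>_def)
    qed
  next
    fix i l assume i: "i + Suc n \<le> l" "l \<le> N"
    have im: "i + m \<le> N" using i by (simp add: m_def)
    have "L i \<le> t l - t i" using le[of "i + m" l] i by (simp add: L_def m_def)
    then have "\<kappa> / L i * L i \<le> \<kappa> / L i * (t l - t i)" using \<theta> L[OF im] by (intro mult_left_mono) auto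
    then have "G i 0 (t l) = 1"
      using smooth_step_range(4)[OF \<theta>(1), of m "\<kappa> / L i * (t l - t i)"] \<theta> L[OF im] by (simp add: G_def)
    then show "\<phi> i 0 (t l) = (\<Prod>y\<in>t ` {Suc i..i + n}. t l - y)" by (simp add: \<phi>_def \<psi>0)
  next
    fix x :: real
    let ?c = "\<lambda>i. divided_difference (t ` {i..i + Suc n}) f * (t (i + Suc n) - t i)"
    have a0: "0 \<le> a"
    proof -
      have "0 \<le> fact (Suc n) * \<bar>divided_difference (t ` {0..0 + Suc n}) f\<bar>" by simp
      also have "\<dots> \<le> a" using a[rule_format, of 0] N by simp
      finally show ?thesis .
    qed
    have b: "\<bar>?c i * \<phi> i (Suc n) x\<bar> \<le> a / real m * extension_weight n"
      if i: "i + m \<le> N" "t i < x" "x < t (i + m)" for i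
    proof -
      have "\<bar>divided_difference (t ` {i..i + Suc n}) f\<bar> \<le> a / fact m"
        using a[rule_format, of i] i
        by (subst pos_le_divide_eq) (simp_all add: m_def mult.commute del: fact_Suc)
      then have "\<bar>divided_difference (t ` {i..i + Suc n}) f\<bar> * L i \<le> a / fact m * L i"
        using L[OF i(1)] by (intro mult_right_mono) auto
      moreover have "\<bar>?c i\<bar> = \<bar>divided_difference (t ` {i..i + Suc n}) f\<bar> * L i"
        using L[OF i(1)] by (simp add: abs_mult L_def m_def)
      ultimately have 1: "\<bar>?c i\<bar> \<le> a / fact m * L i" by (simp only:)
      have "\<bar>?c i\<bar> * \<bar>\<phi> i m x\<bar> \<le> (a / fact m * L i) * (fact n / L i * extension_weight n)"
        using i a0 L[OF i(1)] by (intro mult_mono 1 ins) auto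
      also have "\<dots> = a / real m * extension_weight n"
      proof -
        have "fact m = real m * (fact n :: real)" by (simp add: m_def)
        then show ?thesis using L[OF i(1)] by simp
      qed
      finally show ?thesis by (simp only: abs_mult m_def)
    qed
    define A where "A = {i. i + m \<le> N \<and> t i < x \<and> x < t (i + m)}"
    have "A \<subseteq> {..N}" by (auto simp: A_def)
    then have finA: "finite A" using finite_subset by blast
    \<comment> \<open>The smallest active index \<open>r\<close> satisfies
      \<open>x < t (r + m)\<close>, so no index from \<open>r + m\<close> on is active.\<close>
    have cA: "card A \<le> m"
    proof (cases "A = {}")
      case False
      define r where "r = Min A"
      have r: "r \<in> A" using Min_in[OF finA False] by (simp add: r_def)
      have "A \<subseteq> {r..<r + m}"
      proof
        fix i assume i: "i \<in> A"
        have "r \<le> i" using Min_le[OF finA i] by (simp add: r_def)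
        moreover have "i < r + m"
        proof (rule ccontr)
          assume "\<not> i < r + m"
          then have "t (r + m) \<le> t i" using i by (intro le) (auto simp: A_def)
          then show False using i r by (auto simp: A_def)
        qed
        ultimately show "i \<in> {r..<r + m}" by simp
      qed
      then have "card A \<le> card {r..<r + m}" by (intro card_mono) auto
      then show ?thesis by simp
    qed simp
    have "\<bar>\<Sum>i<N - n. ?c i * \<phi> i (Suc n) x\<bar> \<le> (\<Sum>i<N - n. \<bar>?c i * \<phi> i (Suc n) x\<bar>)" by (rule sum_abs)
    also have "\<dots> = (\<Sum>i\<in>A. \<bar>?c i * \<phi> i (Suc n) x\<bar>)"
    proof (rule sum.mono_neutral_right)
      show "A \<subseteq> {..<N - n}" by (auto simp: A_def m_def)
      show "\<forall>i\<in>{..<N - n} - A. \<bar>?c i * \<phi> i (Suc n) x\<bar> = 0"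
      proof
        fix i assume i: "i \<in> {..<N - n} - A"
        then have "i + m \<le> N" by (auto simp: m_def)
        moreover from this have "x \<le> t i \<or> t (i + m) \<le> x" using i by (auto simp: A_def)
        ultimately have "\<phi> i m x = 0" by (rule out)
        then show "\<bar>?c i * \<phi> i (Suc n) x\<bar> = 0" by (simp add: m_def)
      qed
    qed simp
    also have "\<dots> \<le> (\<Sum>i\<in>A. a / real m * extension_weight n)"
      using b by (intro sum_mono) (auto simp: A_def)
    also have "\<dots> = real (card A) * (a / real m * extension_weight n)" by simp
    also have "\<dots> \<le> real m * (a / real m * extension_weight n)"
      using cA a0 W by (intro mult_right_mono) auto
    also have "\<dots> = extension_weight n * a" by (simp add: m_def)
    finally show "\<bar>\<Sum>i<N - n. ?c i * \<phi> i (Suc n) x\<bar> \<le> extension_weight n * a" .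
  qed (use t N in auto)
qed

section \<open>The lower bound\<close>

text \<open>Legendre's completion to a square: the tangent \<open>T\<close> solves
  \<open>T' = \<omega> * (1 + T\<^sup>2)\<close>, so adding the derivative of \<open>W\<close> turns
  \<open>u'\<^sup>2 - \<omega>\<^sup>2 * u\<^sup>2\<close> into a square, and \<open>W\<close>
  vanishes at both ends with \<open>u\<close>. The tangent is finite on the closed interval only for
  \<open>\<omega> < pi\<close>, so \<open>pi\<close> is reached as a limit.\<close>

lemma Wirtinger_Dirichlet:
  fixes u u' :: "real \<Rightarrow> real"
  assumes u: "\<And>x. (u has_real_derivative u' x) (at x)" and u': "\<And>x. isCont u' x"
    and z: "u a = 0" "u (a + 1) = 0"
  shows "pi\<^sup>2 * integral {a..a + 1} (\<lambda>x. (u x)\<^sup>2) \<le> integral {a..a + 1} (\<lambda>x. (u' x)\<^sup>2)"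
proof -
  define I0 where "I0 = integral {a..a + 1} (\<lambda>x. (u x)\<^sup>2)"
  define I1 where "I1 = integral {a..a + 1} (\<lambda>x. (u' x)\<^sup>2)"
  have cu: "continuous_on A u" for A using u by (meson DERIV_isCont continuous_at_imp_continuous_on)
  have cu': "continuous_on A u'" for A using u' by (simp add: continuous_at_imp_continuous_on)
  have i0: "((\<lambda>x. (u x)\<^sup>2) has_integral I0) {a..a + 1}"
    unfolding I0_def by (intro integrable_integral integrable_continuous_real continuous_intros cu)
  have i1: "((\<lambda>x. (u' x)\<^sup>2) has_integral I1) {a..a + 1}"
    unfolding I1_def by (intro integrable_integral integrable_continuous_real continuous_intros cu')
  have main: "\<omega>\<^sup>2 * I0 \<le> I1" if \<omega>: "0 < \<omega>" "\<omega> < pi" for \<omega>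
  proof -
    define T where "T x = tan (\<omega> * (x - (a + 1 / 2)))" for x
    define W where "W x = \<omega> * T x * (u x)\<^sup>2" for x
    define W' where "W' x = \<omega>\<^sup>2 * (1 + (T x)\<^sup>2) * (u x)\<^sup>2 + 2 * \<omega> * T x * u x * u' x" for x
    have dW: "(W has_real_derivative W' x) (at x)" if x: "x \<in> {a..a + 1}" for x
    proof -
      have "\<bar>x - (a + 1 / 2)\<bar> \<le> 1 / 2" unfolding abs_le_iff using x by auto
      then have "\<bar>\<omega> * (x - (a + 1 / 2))\<bar> \<le> \<omega> * (1 / 2)"
        unfolding abs_mult using \<omega> by (intro mult_mono) auto
      then have "\<bar>\<omega> * (x - (a + 1 / 2))\<bar> < pi / 2" using \<omega> by linarith
      then have cz: "cos (\<omega> * (x - (a + 1 / 2))) \<noteq> 0"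
        using cos_gt_zero_pi[of "\<omega> * (x - (a + 1 / 2))"] by linarith
      have dT: "(T has_real_derivative (1 + (T x)\<^sup>2) * \<omega>) (at x)"
        unfolding T_def[abs_def] using tan_sec[OF cz]
        by (auto intro!: derivative_eq_intros simp: cz power_inverse)
      show ?thesis unfolding W_def[abs_def] W'_def
        by (rule DERIV_cong, (rule derivative_intros dT u)+) (simp add: algebra_simps power2_eq_square)
    qed
    have "(W' has_integral (W (a + 1) - W a)) {a..a + 1}"
      by (rule fundamental_theorem_of_calculus)
        (auto simp: has_real_derivative_iff_has_vector_derivative[symmetric] intro!: has_field_derivative_at_within dW)
    then have iW: "(W' has_integral 0) {a..a + 1}" by (simp add: W_def z)
    have "((\<lambda>x. (u' x)\<^sup>2 - \<omega>\<^sup>2 * (u x)\<^sup>2 + W' x) has_integral (I1 - \<omega>\<^sup>2 * I0 + 0)) {a..a + 1}"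
      by (intro has_integral_add has_integral_diff has_integral_mult_right i0 i1 iW)
    moreover have "(u' x)\<^sup>2 - \<omega>\<^sup>2 * (u x)\<^sup>2 + W' x = (u' x + \<omega> * T x * u x)\<^sup>2" for x
      by (simp add: W'_def power2_eq_square algebra_simps)
    ultimately have "((\<lambda>x. (u' x + \<omega> * T x * u x)\<^sup>2) has_integral (I1 - \<omega>\<^sup>2 * I0)) {a..a + 1}" by simp
    then have "0 \<le> I1 - \<omega>\<^sup>2 * I0" by (rule has_integral_nonneg) auto
    then show ?thesis by simp
  qed
  have "pi\<^sup>2 * I0 \<le> I1"
  proof (rule tendsto_upperbound)
    show "((\<lambda>\<omega>. \<omega>\<^sup>2 * I0) \<longlongrightarrow> pi\<^sup>2 * I0) (at_left pi)" by (intro tendsto_intros)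
    show "\<forall>\<^sub>F \<omega> in at_left pi. \<omega>\<^sup>2 * I0 \<le> I1"
      using eventually_at_left_real[of 0 pi] by (rule eventually_mono) (use main in auto)
  qed simp
  then show ?thesis by (simp add: I0_def I1_def)
qed

lemma integral_periodic_shift:
  fixes p :: "real \<Rightarrow> real"
  assumes p: "\<And>x. p (x + 1) = p x" and c: "continuous_on UNIV p" and z: "0 \<le> z" "z \<le> 1"
  shows "integral {z..z + 1} p = integral {0..1} p"
proof -
  have int: "p integrable_on {a..b}" for a b
    by (rule integrable_continuous_real) (rule continuous_on_subset[OF c], simp)
  have "integral {z..1} p + integral {1..z + 1} p = integral {z..z + 1} p"
    using z int by (intro Henstock_Kurzweil_Integration.integral_combine) auto
  moreover have "integral {0..z} p + integral {z..1} p = integral {0..1} p"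
    using z int by (intro Henstock_Kurzweil_Integration.integral_combine) auto
  moreover have "integral {1..z + 1} p = integral {0..z} p"
  proof -
    have "(p has_integral integral {1..z + 1} p) (cbox 1 (z + 1))" using int by (simp add: integrable_integral)
    from has_integral_affinity[OF this, of 1 1]
    have "((\<lambda>x. p (x + 1)) has_integral integral {1..z + 1} p) {0..z}"
      by (simp add: image_affinity_atLeastAtMost_diff add.commute)
    then show ?thesis using p by (simp add: integral_unique)
  qed
  ultimately show ?thesis by linarith
qed

lemma antiperiodic_zero:
  fixes v :: "real \<Rightarrow> real"
  assumes "\<And>x. v (x + 1) = - v x" "continuous_on UNIV v"
  obtains z where "0 \<le> z" "z \<le> 1" "v z = 0" "v (z + 1) = 0"
proof -
  have c: "continuous_on {0..1} v" using assms(2) by (rule continuous_on_subset) simp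
  have "v 1 = - v 0" using assms(1)[of 0] by simp
  then have "\<exists>z. 0 \<le> z \<and> z \<le> 1 \<and> v z = 0"
    using IVT'[of v 0 0 1, OF _ _ _ c] IVT2'[of v 1 0 0, OF _ _ _ c] by (cases "v 0 \<le> 0") auto
  then show ?thesis using that assms(1) by force
qed

text \<open>An antiperiodic function has a zero \<open>z\<close>, and \<open>z + 1\<close> is
  another, so the Dirichlet version applies on \<open>[z, z + 1]\<close>; squares are periodic,
  which moves the integrals back to \<open>[0, 1]\<close>.\<close>

lemma Wirtinger_antiperiodic:
  fixes u u' :: "real \<Rightarrow> real"
  assumes u: "\<And>x. (u has_real_derivative u' x) (at x)" and u': "\<And>x. isCont u' x"
    and ap: "\<And>x. u (x + 1) = - u x" "\<And>x. u' (x + 1) = - u' x"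
  shows "pi\<^sup>2 * integral {0..1} (\<lambda>x. (u x)\<^sup>2) \<le> integral {0..1} (\<lambda>x. (u' x)\<^sup>2)"
proof -
  have cu: "continuous_on UNIV u" using u by (meson DERIV_isCont continuous_at_imp_continuous_on)
  have cu': "continuous_on UNIV u'" using u' by (simp add: continuous_at_imp_continuous_on)
  obtain z where z: "0 \<le> z" "z \<le> 1" "u z = 0" "u (z + 1) = 0"
    using antiperiodic_zero[OF ap(1) cu] by blast
  have "integral {z..z + 1} (\<lambda>x. (u x)\<^sup>2) = integral {0..1} (\<lambda>x. (u x)\<^sup>2)"
    using z by (intro integral_periodic_shift) (auto intro!: continuous_intros cu simp: ap)
  moreover have "integral {z..z + 1} (\<lambda>x. (u' x)\<^sup>2) = integral {0..1} (\<lambda>x. (u' x)\<^sup>2)"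
    using z by (intro integral_periodic_shift) (auto intro!: continuous_intros cu' simp: ap)
  ultimately show ?thesis using Wirtinger_Dirichlet[OF u u' z(3,4)] by simp
qed

text \<open>Zeros at distance 1 put the modulus of \<open>v\<close> below a tent of slope
  \<open>C\<close> and height \<open>C / 2\<close>; the bounds are the integrals of the squared tent
  and of the tent. This serves the top order, where \<open>v\<close> is only Lipschitz and
  Wirtinger's inequality does not apply.\<close>

lemma integral_antiperiodic_lipschitz:
  fixes v :: "real \<Rightarrow> real"
  assumes lip: "\<And>x y. \<bar>v x - v y\<bar> \<le> C * \<bar>x - y\<bar>" and ap: "\<And>x. v (x + 1) = - v x"
  shows "integral {0..1} (\<lambda>x. (v x)\<^sup>2) \<le> C\<^sup>2 / 12" "integral {0..1} (\<lambda>x. \<bar>v x\<bar>) \<le> C / 4"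
proof -
  have "absolutely_continuous_real v" by (rule lipschitz_imp_absolutely_continuous[OF lip])
  then have cv: "continuous_on UNIV v"
    using absolutely_continuous_imp_continuous by (simp add: continuous_at_imp_continuous_on)
  obtain z where z: "0 \<le> z" "z \<le> 1" "v z = 0" "v (z + 1) = 0"
    using antiperiodic_zero[OF ap cv] by blast
  have C: "0 \<le> C" using order_trans[OF abs_ge_zero lip[of 1 0]] by simp
  have vl: "\<bar>v x\<bar> \<le> C * (x - z)" if "x \<in> {z..z + 1 / 2}" for x using lip[of x z] z that by simp
  have vr: "\<bar>v x\<bar> \<le> C * (z + 1 - x)" if "x \<in> {z + 1 / 2..z + 1}" for x using lip[of x "z + 1"] z that by simp
  \<comment> \<open>Evenness of \<open>g\<close> makes \<open>g (v x)\<close> periodic; the square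
    and the modulus are treated together.\<close>
  have half: "integral {0..1} (\<lambda>x. g (v x)) \<le> A + B"
    if g: "continuous_on UNIV g" "\<And>y. g (- y) = g y"
      and l: "(hl has_integral A) {z..z + 1 / 2}" "\<And>x. x \<in> {z..z + 1 / 2} \<Longrightarrow> g (v x) \<le> hl x"
      and r: "(hr has_integral B) {z + 1 / 2..z + 1}" "\<And>x. x \<in> {z + 1 / 2..z + 1} \<Longrightarrow> g (v x) \<le> hr x"
    for g hl hr :: "real \<Rightarrow> real" and A B
  proof -
    have cg: "continuous_on S (\<lambda>x. g (v x))" for S
      using continuous_on_compose2[OF g(1) continuous_on_subset[OF cv, of S]] by simp
    have int: "(\<lambda>x. g (v x)) integrable_on {c..d}" for c d by (rule integrable_continuous_real[OF cg])
    have "integral {0..1} (\<lambda>x. g (v x)) = integral {z..z + 1} (\<lambda>x. g (v x))"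
      using z cg by (intro integral_periodic_shift[symmetric]) (auto simp: ap g)
    also have "\<dots> = integral {z..z + 1 / 2} (\<lambda>x. g (v x)) + integral {z + 1 / 2..z + 1} (\<lambda>x. g (v x))"
      using int by (intro Henstock_Kurzweil_Integration.integral_combine[symmetric]) auto
    also have "integral {z..z + 1 / 2} (\<lambda>x. g (v x)) \<le> A"
      by (rule has_integral_le[OF integrable_integral[OF int] l(1)]) (rule l(2))
    also have "integral {z + 1 / 2..z + 1} (\<lambda>x. g (v x)) \<le> B"
      by (rule has_integral_le[OF integrable_integral[OF int] r(1)]) (rule r(2))
    finally show ?thesis by simp
  qed
  have sq: "(v x)\<^sup>2 \<le> (C * w)\<^sup>2" if "\<bar>v x\<bar> \<le> C * w" for x w
    using that power_mono[of "\<bar>v x\<bar>" "C * w" 2] by simp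
  have "integral {0..1} (\<lambda>x. (v x)\<^sup>2) \<le> C\<^sup>2 / 24 + C\<^sup>2 / 24"
  proof (rule half)
    have "((\<lambda>x. (C * (x - z))\<^sup>2) has_integral (C\<^sup>2 * (z + 1 / 2 - z) ^ 3 / 3 - C\<^sup>2 * (z - z) ^ 3 / 3)) {z..z + 1 / 2}"
      by (rule fundamental_theorem_of_calculus)
        (auto simp: has_real_derivative_iff_has_vector_derivative[symmetric] power_mult_distrib intro!: derivative_eq_intros)
    then show "((\<lambda>x. (C * (x - z))\<^sup>2) has_integral C\<^sup>2 / 24) {z..z + 1 / 2}" by (simp add: power3_eq_cube)
    have "((\<lambda>x. (C * (z + 1 - x))\<^sup>2) has_integral (- (C\<^sup>2 * (z + 1 - (z + 1)) ^ 3 / 3) - (- (C\<^sup>2 * (z + 1 - (z + 1 / 2)) ^ 3 / 3)))) {z + 1 / 2..z + 1}"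
      by (rule fundamental_theorem_of_calculus)
        (auto simp: has_real_derivative_iff_has_vector_derivative[symmetric] power_mult_distrib intro!: derivative_eq_intros)
    then show "((\<lambda>x. (C * (z + 1 - x))\<^sup>2) has_integral C\<^sup>2 / 24) {z + 1 / 2..z + 1}" by (simp add: power3_eq_cube)
  qed (use sq[OF vl] sq[OF vr] in \<open>auto intro!: continuous_intros\<close>)
  then show "integral {0..1} (\<lambda>x. (v x)\<^sup>2) \<le> C\<^sup>2 / 12" by simp
  have "integral {0..1} (\<lambda>x. \<bar>v x\<bar>) \<le> C / 8 + C / 8"
  proof (rule half)
    have "((\<lambda>x. C * (x - z)) has_integral (C * (z + 1 / 2 - z) ^ 2 / 2 - C * (z - z) ^ 2 / 2)) {z..z + 1 / 2}"
      by (rule fundamental_theorem_of_calculus)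
        (auto simp: has_real_derivative_iff_has_vector_derivative[symmetric] intro!: derivative_eq_intros)
    then show "((\<lambda>x. C * (x - z)) has_integral C / 8) {z..z + 1 / 2}" by (simp add: power2_eq_square)
    have "((\<lambda>x. C * (z + 1 - x)) has_integral (- (C * (z + 1 - (z + 1)) ^ 2 / 2) - (- (C * (z + 1 - (z + 1 / 2)) ^ 2 / 2)))) {z + 1 / 2..z + 1}"
      by (rule fundamental_theorem_of_calculus)
        (auto simp: has_real_derivative_iff_has_vector_derivative[symmetric] field_simps intro!: derivative_eq_intros)
    then show "((\<lambda>x. C * (z + 1 - x)) has_integral C / 8) {z + 1 / 2..z + 1}" by (simp add: power2_eq_square)
  qed (use vl vr in \<open>auto intro!: continuous_intros\<close>)
  then show "integral {0..1} (\<lambda>x. \<bar>v x\<bar>) \<le> C / 4" by simp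
qed

text \<open>Cauchy-Schwarz against the constant 1, by expanding the variance.\<close>

lemma integral_square_le:
  fixes w :: "real \<Rightarrow> real"
  assumes "continuous_on {0..1} w"
  shows "(integral {0..1} w)\<^sup>2 \<le> integral {0..1} (\<lambda>x. (w x)\<^sup>2)"
proof -
  define A where "A = integral {0..1} w"
  have i1: "(w has_integral A) {0..1}"
    unfolding A_def by (intro integrable_integral integrable_continuous_real assms)
  have i2: "((\<lambda>x. (w x)\<^sup>2) has_integral integral {0..1} (\<lambda>x. (w x)\<^sup>2)) {0..1}"
    by (intro integrable_integral integrable_continuous_real continuous_intros assms)
  have i3: "((\<lambda>x. A\<^sup>2) has_integral A\<^sup>2) {0..1::real}" using has_integral_const_real[of "A\<^sup>2" 0 1] by simp
  have "((\<lambda>x. (w x)\<^sup>2 - 2 * A * w x + A\<^sup>2) has_integral (integral {0..1} (\<lambda>x. (w x)\<^sup>2) - 2 * A * A + A\<^sup>2)) {0..1}"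
    by (intro has_integral_add has_integral_diff has_integral_mult_right i1 i2 i3)
  moreover have "(w x)\<^sup>2 - 2 * A * w x + A\<^sup>2 = (w x - A)\<^sup>2" for x by (simp add: power2_eq_square algebra_simps)
  ultimately have "((\<lambda>x. (w x - A)\<^sup>2) has_integral (integral {0..1} (\<lambda>x. (w x)\<^sup>2) - 2 * A * A + A\<^sup>2)) {0..1}" by simp
  then have "0 \<le> integral {0..1} (\<lambda>x. (w x)\<^sup>2) - 2 * A * A + A\<^sup>2" by (rule has_integral_nonneg) auto
  then show ?thesis by (simp add: A_def power2_eq_square)
qed

text \<open>\<open>G 0\<close> drops from 1 to -1 over \<open>[0, 1]\<close>, so \<open>G 1\<close>
  has mean -2 and its square has integral at least 4. Wirtinger's inequality gains
  \<open>pi\<^sup>2\<close> for each of the next \<open>n\<close> orders, and the tent bound gives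
  \<open>4 * pi ^ (2 * n) \<le> C\<^sup>2 / 12\<close>. For \<open>n = 0\<close> this yields only
  \<open>sqrt 48\<close>; integrating moduli instead of squares yields the sharp 8.\<close>

lemma antiperiodic_jet_bound:
  assumes J: "jet (Suc n) C G" and ap: "\<And>x. G 0 (x + 1) = - G 0 x" and G0: "G 0 0 = 1"
  shows "48 * pi ^ (2 * n) \<le> C\<^sup>2" "n = 0 \<Longrightarrow> 8 \<le> C"
proof -
  have apk: "G k (x + 1) = - G k x" if "k \<le> Suc n" for k x
    using that
  proof (induction k arbitrary: x)
    case (Suc k)
    have "(G k has_real_derivative G (Suc k) (x + 1)) (at (x + 1))" using jet_DERIV[OF J] Suc.prems by simp
    then have "((\<lambda>x. - G k x) has_real_derivative G (Suc k) (x + 1)) (at x)"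
      unfolding DERIV_shift using Suc by simp
    moreover have "((\<lambda>x. - G k x) has_real_derivative - G (Suc k) x) (at x)"
      using jet_DERIV[OF J] Suc.prems by (intro DERIV_minus) simp
    ultimately show ?case by (rule DERIV_unique)
  qed (use ap in simp)
  have cont: "continuous_on A (G k)" if "k \<le> Suc n" for A k
    using jet_continuous[OF J that] by (simp add: continuous_at_imp_continuous_on)
  define I where "I k = integral {0..1} (\<lambda>x. (G k x)\<^sup>2)" for k
  have step: "pi\<^sup>2 * I k \<le> I (Suc k)" if "1 \<le> k" "k \<le> n" for k
    unfolding I_def using that
    by (intro Wirtinger_antiperiodic jet_DERIV[OF J] jet_continuous[OF J] apk) auto
  have "pi ^ (2 * j) * I 1 \<le> I (Suc j)" if "j \<le> n" for j
    using that
  proof (induction j)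
    case (Suc j)
    have "pi ^ (2 * Suc j) * I 1 = pi\<^sup>2 * (pi ^ (2 * j) * I 1)" by (simp add: power2_eq_square)
    also have "\<dots> \<le> pi\<^sup>2 * I (Suc j)" using Suc by (intro mult_left_mono) auto
    also have "\<dots> \<le> I (Suc (Suc j))" using step[of "Suc j"] Suc.prems by simp
    finally show ?case .
  qed simp
  then have chain: "pi ^ (2 * n) * I 1 \<le> I (Suc n)" by simp
  have "(G (Suc 0) has_integral (G 0 1 - G 0 0)) {0..1}"
    by (rule fundamental_theorem_of_calculus)
      (auto simp: has_real_derivative_iff_has_vector_derivative[symmetric] intro!: has_field_derivative_at_within jet_DERIV[OF J])
  then have int: "integral {0..1} (G 1) = - 2" using ap[of 0] G0 by (simp add: integral_unique)
  then have "4 \<le> I 1" using integral_square_le[OF cont[of 1]] by (simp add: I_def)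
  have v: "integral {0..1} (\<lambda>x. (G (Suc n) x)\<^sup>2) \<le> C\<^sup>2 / 12" "integral {0..1} (\<lambda>x. \<bar>G (Suc n) x\<bar>) \<le> C / 4"
    using integral_antiperiodic_lipschitz[of "G (Suc n)" C, OF jet_lipschitz[OF J] apk] by simp_all
  have "pi ^ (2 * n) * 4 \<le> pi ^ (2 * n) * I 1" using \<open>4 \<le> I 1\<close> by (intro mult_left_mono) auto
  moreover have "I (Suc n) \<le> C\<^sup>2 / 12" using v(1) by (simp add: I_def)
  ultimately show "48 * pi ^ (2 * n) \<le> C\<^sup>2" using chain by linarith
  show "8 \<le> C" if "n = 0"
  proof -
    have "\<bar>integral {0..1} (G 1)\<bar> \<le> integral {0..1} (\<lambda>x. \<bar>G 1 x\<bar>)"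
      using integral_norm_bound_integral[of "G 1" "{0..1}" "\<lambda>x. \<bar>G 1 x\<bar>"] cont[of 1]
      by (simp add: integrable_continuous_real continuous_intros)
    then show ?thesis using v(2) int that by simp
  qed
qed

section \<open>Antiperiodic averages\<close>

lemma jet_alternating_shift:
  assumes J: "jet n C D"
  shows "jet n C (\<lambda>k x. (-1) ^ j * D k (x + real j))"
  unfolding jet_def
proof (intro conjI allI impI)
  fix k and x :: real assume "k < n"
  then have "((\<lambda>x. D k (x + real j)) has_real_derivative D (Suc k) (x + real j)) (at x)"
    using jet_DERIV[OF J, of k "x + real j"] unfolding DERIV_shift by simp
  then show "((\<lambda>x. (-1) ^ j * D k (x + real j)) has_real_derivative (-1) ^ j * D (Suc k) (x + real j)) (at x)"
    by (rule DERIV_cmult)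
next
  fix x y :: real
  show "\<bar>(-1) ^ j * D n (x + real j) - (-1) ^ j * D n (y + real j)\<bar> \<le> C * \<bar>x - y\<bar>"
    using jet_lipschitz[OF J, of "x + real j" "y + real j"] by (simp add: abs_mult flip: right_diff_distrib)
qed

lemma jet_average:
  assumes J: "\<And>j. jet n C (D j)" and M: "0 < M"
  shows "jet n C (\<lambda>k x. (\<Sum>j<M. D j k x) / real M)"
  unfolding jet_def
proof (intro conjI allI impI)
  fix k and x :: real assume "k < n"
  then show "((\<lambda>x. (\<Sum>j<M. D j k x) / real M) has_real_derivative (\<Sum>j<M. D j (Suc k) x) / real M) (at x)"
    by (intro DERIV_cdivide DERIV_sum jet_DERIV[OF J])
next
  fix x y :: real
  have "\<bar>(\<Sum>j<M. D j n x) / real M - (\<Sum>j<M. D j n y) / real M\<bar> = \<bar>\<Sum>j<M. D j n x - D j n y\<bar> / real M"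
    by (simp add: sum_subtractf abs_divide flip: diff_divide_distrib)
  also have "\<dots> \<le> (\<Sum>j<M. C * \<bar>x - y\<bar>) / real M"
    by (intro divide_right_mono order_trans[OF sum_abs] sum_mono jet_lipschitz[OF J]) simp
  also have "\<dots> = C * \<bar>x - y\<bar>" using M by simp
  finally show "\<bar>(\<Sum>j<M. D j n x) / real M - (\<Sum>j<M. D j n y) / real M\<bar> \<le> C * \<bar>x - y\<bar>" .
qed

text \<open>Averaging \<open>(-1)^j F(x + j)\<close> over \<open>j\<close> replaces an interpolant of \<open>(-1)^i\<close> by an antiperiodic one.\<close>

lemma antiperiodic_interpolant:
  assumes J: "jet n C D" and f: "\<And>i::nat. D 0 (real i) = (-1) ^ i"
  shows "\<exists>G. jet n C G \<and> (\<forall>x. G 0 (x + 1) = - G 0 x) \<and> G 0 0 = 1"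
proof -
  \<comment> \<open>All averages keep the alternating values at these \<open>n + 1\<close> integers,
    which bounds their derivatives at 0 uniformly.\<close>
  define S where "S = real ` {..n}"
  have S: "finite S" "card S = Suc n" by (auto simp: S_def card_image)
  define g where "g x = (-1::real) ^ nat \<lfloor>x\<rfloor>" for x :: real
  obtain M where M: "\<forall>D. jet n C D \<longrightarrow> (\<forall>x\<in>S. D 0 x = g x) \<longrightarrow> (\<forall>k\<le>n. \<bar>D k 0\<bar> \<le> M)"
    using interpolating_jets_bounded[OF S] by blast
  define H where "H N k x = (\<Sum>j<Suc N. (-1) ^ j * D k (x + real j)) / real (Suc N)" for N k x
  have HJ: "jet n C (H N)" for N
    unfolding H_def[abs_def] by (intro jet_average jet_alternating_shift[OF J]) simp
  have D0: "(-1) ^ j * D 0 (real i + real j) = (-1) ^ i" for i j :: nat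
    using f[of "i + j"] by (simp add: power_add mult.left_commute flip: power_mult_distrib)
  then have H0: "H N 0 (real i) = (-1) ^ i" for N i by (simp add: H_def)
  then have "\<forall>x\<in>S. H N 0 x = g x" for N by (auto simp: S_def g_def)
  then have HM: "\<bar>H N k 0\<bar> \<le> M" if "k \<le> n" for N k using M HJ that by blast
  have "\<exists>r G. strict_mono (r :: nat \<Rightarrow> nat) \<and> jet n C G \<and> (\<forall>k\<le>n. \<forall>x. (\<lambda>j. H (r j) k x) \<longlonglongrightarrow> G k x)"
    using HJ HM by (rule jet_subsequence_limit)
  then obtain r G where r: "strict_mono (r :: nat \<Rightarrow> nat)" and G: "jet n C G"
    and lim: "\<forall>k\<le>n. \<forall>x. (\<lambda>j. H (r j) k x) \<longlonglongrightarrow> G k x"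
    by (elim exE conjE)
  have "G 0 (x + 1) = - G 0 x" for x
  proof -
    \<comment> \<open>Each alternating shift takes the same values on \<open>S\<close> as the
      averages do, so the shifts are bounded at \<open>x\<close> uniformly in
      \<open>j\<close>.\<close>
    have KJ: "jet n C (\<lambda>k x. (-1) ^ j * D k (x + real j))" for j
      by (rule jet_alternating_shift[OF J])
    have Kg: "\<forall>x\<in>S. (-1) ^ j * D 0 (x + real j) = g x" for j using D0 by (auto simp: S_def g_def)
    have KM: "\<forall>k\<le>n. \<bar>(-1) ^ j * D k (0 + real j)\<bar> \<le> M" for j
      using M[THEN spec, THEN mp, OF KJ, THEN mp, OF Kg] .
    obtain B where B: "\<forall>D. jet n C D \<longrightarrow> (\<forall>k\<le>n. \<bar>D k 0\<bar> \<le> M) \<longrightarrow> (\<forall>k\<le>n. \<forall>y. \<bar>y\<bar> \<le> \<bar>x\<bar> \<longrightarrow> \<bar>D k y\<bar> \<le> B)"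
      using jet_local_bound[of "\<bar>x\<bar>" n C M] by auto
    have bound: "\<bar>(-1) ^ j * D 0 (x + real j)\<bar> \<le> B" for j
      using B[THEN spec, THEN mp, OF KJ, THEN mp, OF KM] by blast
    \<comment> \<open>A translation by 1 shifts the index and flips the sign, so the sum telescopes:
      only the two extreme terms survive, divided by the number of terms.\<close>
    have sum: "H N 0 (x + 1) + H N 0 x = (D 0 x - (-1) ^ Suc N * D 0 (x + real (Suc N))) / real (Suc N)" for N
    proof -
      define w where "w j = (-1) ^ j * D 0 (x + real j)" for j
      have "(\<Sum>j<Suc N. (-1) ^ j * D 0 (x + 1 + real j)) = (\<Sum>j<Suc N. - w (Suc j))"
        by (intro sum.cong) (auto simp: w_def add.assoc)
      then have "(\<Sum>j<Suc N. (-1) ^ j * D 0 (x + 1 + real j)) + (\<Sum>j<Suc N. w j) = (\<Sum>j<Suc N. w j - w (Suc j))"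
        by (simp only: sum.distrib[symmetric] add.commute diff_conv_add_uminus)
      also have "\<dots> = w 0 - w (Suc N)" by (rule sum_lessThan_telescope')
      finally have "(\<Sum>j<Suc N. (-1) ^ j * D 0 (x + 1 + real j)) + (\<Sum>j<Suc N. w j) = w 0 - w (Suc N)" .
      then show ?thesis unfolding H_def w_def by (simp only: add_divide_distrib[symmetric]) simp
    qed
    have "(\<lambda>N. H N 0 (x + 1) + H N 0 x) \<longlonglongrightarrow> 0"
    proof (rule Lim_null_comparison)
      show "\<forall>\<^sub>F N in sequentially. norm (H N 0 (x + 1) + H N 0 x) \<le> 2 * B * inverse (real (Suc N))"
      proof (intro always_eventually allI)
        fix N
        have "\<bar>D 0 x - (-1) ^ Suc N * D 0 (x + real (Suc N))\<bar> \<le> 2 * B"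
          using bound[of 0] bound[of "Suc N"] unfolding abs_le_iff by (simp del: power_Suc of_nat_Suc)
        then show "norm (H N 0 (x + 1) + H N 0 x) \<le> 2 * B * inverse (real (Suc N))"
          unfolding sum real_norm_def abs_divide by (simp add: divide_inverse mult_right_mono del: power_Suc of_nat_Suc)
      qed
      show "(\<lambda>N. 2 * B * inverse (real (Suc N))) \<longlonglongrightarrow> 0"
        using tendsto_mult_right_zero[OF LIMSEQ_inverse_real_of_nat, of "2 * B"] by simp
    qed
    then have "(\<lambda>j. H (r j) 0 (x + 1) + H (r j) 0 x) \<longlonglongrightarrow> 0"
      using LIMSEQ_subseq_LIMSEQ[OF _ r] by (fastforce simp: comp_def)
    moreover have "(\<lambda>j. H (r j) 0 (x + 1) + H (r j) 0 x) \<longlonglongrightarrow> G 0 (x + 1) + G 0 x"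
      using lim by (intro tendsto_add) auto
    ultimately have "G 0 (x + 1) + G 0 x = 0" using LIMSEQ_unique by blast
    then show ?thesis by linarith
  qed
  moreover have "G 0 0 = 1"
  proof -
    have "(\<lambda>j. H (r j) 0 0) \<longlonglongrightarrow> G 0 0" using lim by simp
    moreover have "(\<lambda>j. H (r j) 0 0) = (\<lambda>j. 1)" using H0[of _ 0] by simp
    ultimately show ?thesis using LIMSEQ_unique[OF _ tendsto_const] by metis
  qed
  ultimately show ?thesis using G by blast
qed

text \<open>\<open>cos (pi * x)\<close> is the extension that puts the alternating data into the
  trace space; the phase shift by \<open>k * pi / 2\<close> gives all derivatives one
  formula.\<close>

lemma jet_cos: "jet n (pi ^ Suc n) (\<lambda>k x. pi ^ k * cos (pi * x + real k * (pi / 2)))"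
proof -
  have d: "((\<lambda>x. pi ^ k * cos (pi * x + real k * (pi / 2))) has_real_derivative
    pi ^ Suc k * cos (pi * x + real (Suc k) * (pi / 2))) (at x)" for k x
  proof -
    have "pi * x + real (Suc k) * (pi / 2) = (pi * x + real k * (pi / 2)) + pi / 2"
      by (simp add: field_simps)
    then have "cos (pi * x + real (Suc k) * (pi / 2)) = cos ((pi * x + real k * (pi / 2)) + pi / 2)"
      by (rule arg_cong)
    also have "\<dots> = - sin (pi * x + real k * (pi / 2))" by (simp add: cos_add)
    finally show ?thesis by (auto intro!: derivative_eq_intros)
  qed
  have "\<bar>pi ^ n * cos (pi * x + real n * (pi / 2)) - pi ^ n * cos (pi * y + real n * (pi / 2))\<bar> \<le> pi ^ Suc n * \<bar>x - y\<bar>" for x y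
  proof (rule bounded_derivative_imp_lipschitz_off_finite[of "{}", OF _ _ d])
    show "isCont (\<lambda>x. pi ^ n * cos (pi * x + real n * (pi / 2))) x" for x using d DERIV_isCont by blast
    show "\<bar>pi ^ Suc n * cos (pi * x + real (Suc n) * (pi / 2))\<bar> \<le> pi ^ Suc n" for x
      using mult_left_mono[OF abs_cos_le_one, of "pi ^ Suc n"] by (simp add: abs_mult)
  qed simp
  then show ?thesis unfolding jet_def using d by blast
qed

section \<open>From extension constants to the finiteness constant\<close>

lemma finiteness_constant_lower:
  assumes fc: "finiteness_constant (Suc n) \<gamma>" and c: "0 < c"
    and lb: "\<And>C D. jet n C D \<Longrightarrow> (\<And>i::nat. D 0 (real i) = (-1) ^ i) \<Longrightarrow> c \<le> C"
  shows "c \<le> \<gamma> * 2 ^ Suc n"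
proof -
  define f where "f x = cos (pi * x)" for x :: real
  have fi: "f (real i) = (-1) ^ i" for i by (simp add: f_def mult.commute)
  have f1: "\<bar>f x\<bar> \<le> 1" for x by (simp add: f_def)
  have "f \<in> L_inf_trace (Suc n) \<int>"
    unfolding L_inf_trace_def using jet_in_L_inf(1)[OF jet_cos[of n]] by (force simp: f_def)
  moreover have "closed (\<int> :: real set)" by (rule closed_Ints)
  moreover have inf: "infinite (\<int> :: real set)" 
  proof
    assume "finite (\<int> :: real set)"
    then have "finite (range (of_int :: int \<Rightarrow> real))" by (simp add: Ints_def)
    then have "finite (UNIV :: int set)" by (rule finite_imageD) (simp add: inj_def)
    then show False by simp
  qed
  ultimately have main: "trace_seminorm (Suc n) \<int> f
    \<le> ereal \<gamma> * (SUP S\<in>{S. S \<subseteq> \<int> \<and> card S = Suc n + 1}. trace_seminorm (Suc n) S f)"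
    using fc unfolding finiteness_constant_def by blast
  define s where "s = (SUP S\<in>{S. S \<subseteq> (\<int> :: real set) \<and> card S = Suc n + 1}. trace_seminorm (Suc n) S f)"
  have s1: "s \<le> ereal (2 ^ Suc n)"
    unfolding s_def
  proof (rule SUP_least)
    fix S :: "real set" assume S: "S \<in> {S. S \<subseteq> \<int> \<and> card S = Suc n + 1}"
    then have fin: "finite S" by (intro card_ge_0_finite) simp
    have "trace_seminorm (Suc n) S f \<le> ereal (fact (Suc n) * \<bar>divided_difference S f\<bar>)"
      using S by (intro trace_seminorm_le_divided_difference) simp
    also have "\<dots> \<le> ereal (2 ^ Suc n)"
      using divided_difference_Ints_le[of S "Suc n" f] S fin f1 by simp
    finally show "trace_seminorm (Suc n) S f \<le> ereal (2 ^ Suc n)" .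
  qed
  obtain S0 where S0: "S0 \<subseteq> (\<int> :: real set)" "card S0 = Suc n + 1"
    using infinite_arbitrarily_large[OF inf, of "Suc n + 1"] by blast
  have "0 \<le> trace_seminorm (Suc n) S0 f" by (rule trace_seminorm_nonneg)
  also have "\<dots> \<le> s" unfolding s_def using S0 by (intro SUP_upper) auto
  finally have s0: "0 \<le> s" .
  \<comment> \<open>The supremum is a real number, so the inequality in \<open>ereal\<close> becomes
    one between reals.\<close>
  obtain s' where s': "s = ereal s'" "0 \<le> s'" "s' \<le> 2 ^ Suc n"
    using s0 s1 by (cases s) auto
  have "ereal c \<le> trace_seminorm (Suc n) \<int> f"
  proof (rule ccontr)
    assume "\<not> ereal c \<le> trace_seminorm (Suc n) \<int> f"
    then have "trace_seminorm (Suc n) \<int> f < ereal c" by simp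
    then obtain C where C: "trace_seminorm (Suc n) \<int> f < ereal C" "ereal C < ereal c"
      using ereal_dense2 by blast
    obtain D where D: "jet n C D" "\<And>x. x \<in> \<int> \<Longrightarrow> D 0 x = f x"
      using trace_seminorm_less_imp_jet[OF C(1)] by blast
    have "c \<le> C" by (rule lb[OF D(1)]) (use D(2) fi in auto)
    then show False using C(2) by simp
  qed
  also note main
  also have "ereal \<gamma> * (SUP S\<in>{S. S \<subseteq> \<int> \<and> card S = Suc n + 1}. trace_seminorm (Suc n) S f) = ereal (\<gamma> * s')"
    unfolding s_def[symmetric] s'(1) by simp
  finally have cs: "c \<le> \<gamma> * s'" by simp
  \<comment> \<open>\<open>\<gamma>\<close> could be any real; its sign must be known before
    \<open>s'\<close> is replaced by its upper bound.\<close>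
  then have "0 < \<gamma> * s'" using c by linarith
  then have "0 < \<gamma>" using s'(2) by (simp add: zero_less_mult_iff)
  then have "\<gamma> * s' \<le> \<gamma> * 2 ^ Suc n" using s'(3) by (intro mult_left_mono) auto
  then show ?thesis using cs by linarith
qed

lemma finite_extension_set:
  assumes fe: "finite_extension n K" and U: "finite U" "n + 2 \<le> card U"
    and a: "\<And>S. S \<subseteq> U \<Longrightarrow> card S = n + 2 \<Longrightarrow> fact (Suc n) * \<bar>divided_difference S f\<bar> \<le> a"
  shows "\<exists>D. jet n (K * a) D \<and> (\<forall>x\<in>U. D 0 x = f x)"
proof -
  define t where "t i = sorted_list_of_set U ! i" for i
  define N where "N = card U - 1"
  have len: "length (sorted_list_of_set U) = Suc N" using U by (simp add: N_def)
  have t: "t i < t j" if "i < j" "j \<le> N" for i j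
  proof -
    have "sorted_wrt (<) (sorted_list_of_set U)" by simp
    from sorted_wrt_nth_less[OF this that(1)] show ?thesis using that(2) len by (simp add: t_def)
  qed
  have range: "U = t ` {..N}"
  proof -
    have "U = set (sorted_list_of_set U)" using U by simp
    also have "\<dots> = t ` {..<Suc N}" unfolding set_conv_nth t_def len by auto
    finally show ?thesis by (simp only: lessThan_Suc_atMost)
  qed
  have a': "fact (Suc n) * \<bar>divided_difference (t ` {i..i + Suc n}) f\<bar> \<le> a" if "i + Suc n \<le> N" for i
  proof (rule a)
    show "t ` {i..i + Suc n} \<subseteq> U" unfolding range using that by auto
    have "inj_on t {i..i + Suc n}"
    proof (rule inj_onI)
      fix j l assume "j \<in> {i..i + Suc n}" "l \<in> {i..i + Suc n}" "t j = t l"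
      then show "j = l" using t[of j l] t[of l j] that by (cases j l rule: linorder_cases) auto
    qed
    then show "card (t ` {i..i + Suc n}) = n + 2" by (simp add: card_image)
  qed
  have "n < N" using U by (simp add: N_def)
  then obtain D where "jet n (K * a) D" "\<forall>l\<le>N. D 0 (t l) = f (t l)"
    using fe t a' unfolding finite_extension_def by blast
  then show ?thesis unfolding range by blast
qed

text \<open>Membership in the trace space makes the supremum finite. \<open>T0\<close> is added to
  every finite set to guarantee the \<open>n + 2\<close> nodes that extension from finite sets
  requires, and \<open>S0\<close> consists of the \<open>n + 1\<close> points that anchor the
  compactness argument.\<close>

lemma finiteness_constant_upper:
  assumes fe: "finite_extension n K"
  shows "finiteness_constant (Suc n) K"
  unfolding finiteness_constant_def
proof (intro allI impI ballI)
  fix E :: "real set" and f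
  assume E: "closed E \<and> (infinite E \<or> Suc n + 1 \<le> card E)" and f: "f \<in> L_inf_trace (Suc n) E"
  obtain F B where F: "jet n B F" "\<And>x. x \<in> E \<Longrightarrow> F 0 x = f x" by (rule L_inf_traceE[OF f]) (rule that)
  define s where "s = (SUP S\<in>{S. S \<subseteq> E \<and> card S = Suc n + 1}. trace_seminorm (Suc n) S f)"
  obtain T0 where T0: "T0 \<subseteq> E" "card T0 = Suc n + 1"
    using E infinite_arbitrarily_large[of E "Suc n + 1"] obtain_subset_with_card_n[of "Suc n + 1" E] by metis
  have finT0: "finite T0" using T0 by (intro card_ge_0_finite) simp
  obtain S0 where S0: "S0 \<subseteq> T0" "card S0 = Suc n" using obtain_subset_with_card_n[of "Suc n" T0] T0 by force
  have s1: "s \<le> ereal B"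
    unfolding s_def using F by (intro SUP_least trace_seminorm_le_jet[OF F(1)]) auto
  have "0 \<le> trace_seminorm (Suc n) T0 f" by (rule trace_seminorm_nonneg)
  also have "\<dots> \<le> s" unfolding s_def using T0 by (intro SUP_upper) auto
  finally have s0: "0 \<le> s" .
  obtain a where a: "s = ereal a" using s0 s1 by (cases s) auto
  have dd: "fact (Suc n) * \<bar>divided_difference S f\<bar> \<le> a" if "S \<subseteq> E" "card S = n + 2" for S
  proof (rule divided_difference_le_trace_seminorm[OF that(2)])
    show "trace_seminorm (Suc n) S f \<le> ereal a"
      unfolding a[symmetric] s_def using that by (intro SUP_upper) auto
  qed
  have "\<exists>D. jet n (K * a) D \<and> (\<forall>x\<in>E. D 0 x = f x)"
  proof (rule jet_extension_from_finite_subsets)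
    show "finite S0" using finT0 S0 finite_subset by blast
    show "card S0 = Suc n" "S0 \<subseteq> E" using S0 T0 by auto
    have "continuous_on E (F 0)" using jet_continuous[OF F(1)] by (simp add: continuous_at_imp_continuous_on)
    then show "continuous_on E f" using F(2) by (simp cong: continuous_on_cong)
    fix T assume T: "finite T" "T \<subseteq> E"
    have "\<exists>D. jet n (K * a) D \<and> (\<forall>x\<in>T \<union> T0. D 0 x = f x)"
    proof (rule finite_extension_set[OF fe])
      show "finite (T \<union> T0)" using T finT0 by simp
      have "card T0 \<le> card (T \<union> T0)" using T finT0 by (intro card_mono) auto
      then show "n + 2 \<le> card (T \<union> T0)" using T0 by simp
      show "fact (Suc n) * \<bar>divided_difference S f\<bar> \<le> a" if S: "S \<subseteq> T \<union> T0" "card S = n + 2" for S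
      proof (rule dd[OF _ S(2)])
        show "S \<subseteq> E" using S(1) T(2) T0(1) by blast
      qed
    qed
    then show "\<exists>D. jet n (K * a) D \<and> (\<forall>x\<in>T. D 0 x = f x)" by blast
  qed
  then obtain D where "jet n (K * a) D" "\<And>x. x \<in> E \<Longrightarrow> D 0 x = f x" by blast
  then have "trace_seminorm (Suc n) E f \<le> ereal (K * a)" by (rule trace_seminorm_le_jet)
  then show "trace_seminorm (Suc n) E f \<le> ereal K * (SUP S\<in>{S. S \<subseteq> E \<and> card S = Suc n + 1}. trace_seminorm (Suc n) S f)"
    unfolding s_def[symmetric] a by simp
qed

lemma gamma_sharp_le: "finite_extension n K \<Longrightarrow> gamma_sharp (Suc n) \<le> ereal K"
  unfolding gamma_sharp_def using finiteness_constant_upper by (intro Inf_lower) blast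

text \<open>The denominator bounds the trace seminorms of the alternating data on
  \<open>Suc n + 1\<close> integers.\<close>

lemma gamma_sharp_ge:
  assumes "0 < c" "\<And>C D. jet n C D \<Longrightarrow> (\<And>i::nat. D 0 (real i) = (-1) ^ i) \<Longrightarrow> c \<le> C"
  shows "ereal (c / 2 ^ Suc n) \<le> gamma_sharp (Suc n)"
  unfolding gamma_sharp_def
proof (rule Inf_greatest)
  fix y assume "y \<in> {ereal \<gamma> |\<gamma>. finiteness_constant (Suc n) \<gamma>}"
  then obtain \<gamma> where \<gamma>: "y = ereal \<gamma>" "finiteness_constant (Suc n) \<gamma>" by blast
  from finiteness_constant_lower[OF \<gamma>(2) assms] show "ereal (c / 2 ^ Suc n) \<le> y"
    by (simp add: \<gamma>(1) pos_divide_le_eq)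
qed

text \<open>\<open>tan x > x\<close> at \<open>pi / 6\<close>, where the tangent is
  \<open>1 / sqrt 3\<close>. This margin makes the lower bound of the theorem strict.\<close>

lemma pi_less_sqrt_12: "pi < sqrt 12"
proof -
  have "pi / 6 < tan (pi / 6)"
  proof -
    have "\<exists>z>0. z < pi / 6 \<and> tan (pi / 6) - tan 0 = (pi / 6 - 0) * inverse ((cos z)\<^sup>2)"
    proof (rule MVT2)
      fix x :: real assume "0 \<le> x" "x \<le> pi / 6"
      then have "cos x > 0" using pi_gt_zero by (intro cos_gt_zero_pi) linarith+
      then show "(tan has_real_derivative inverse ((cos x)\<^sup>2)) (at x)" by (intro DERIV_tan) simp
    qed simp
    then obtain z where z: "0 < z" "z < pi / 6" "tan (pi / 6) = pi / 6 * inverse ((cos z)\<^sup>2)" by auto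
    have "0 < cos z" using z by (intro cos_gt_zero_pi) auto
    moreover have "cos z < 1" using cos_monotone_0_pi[of 0 z] z by simp
    ultimately have "1 < inverse ((cos z)\<^sup>2)" by (intro one_less_inverse) (auto simp: power_less_one_iff)
    then show ?thesis using z(3) by simp
  qed
  then have "pi < 6 / sqrt 3" by (simp add: tan_30)
  also have "6 / sqrt 3 = sqrt 12"
    using real_sqrt_mult[of 4 3] by (simp add: field_simps)
  finally show ?thesis .
qed

theorem theorem7p3:
  shows "gamma_sharp 1 = 1 \<and> gamma_sharp 2 = 2 \<and>
    (\<forall>m::nat. m > 2 \<longrightarrow>
       ereal ((pi / 2) ^ (m - 1)) < gamma_sharp m \<and>
       gamma_sharp m < ereal ((real m - 1) * 9 ^ m))"
proof (intro conjI allI impI)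
  show "gamma_sharp 1 = 1"
  proof (rule antisym)
    show "gamma_sharp 1 \<le> 1" using gamma_sharp_le[OF finite_extension_0] by (simp add: one_ereal_def)
    have "2 \<le> C" if "jet 0 C D" "\<And>i::nat. D 0 (real i) = (-1) ^ i" for C D
      using jet_lipschitz[OF that(1), of 0 1] that(2)[of 0] that(2)[of 1] by simp
    then show "1 \<le> gamma_sharp 1" using gamma_sharp_ge[of 2 0] by (simp add: one_ereal_def)
  qed
  show "gamma_sharp 2 = 2"
  proof (rule antisym)
    show "gamma_sharp 2 \<le> 2" using gamma_sharp_le[OF finite_extension_1] by (simp add: numeral_2_eq_2)
    have "8 \<le> C" if j: "jet 1 C D" "\<And>i::nat. D 0 (real i) = (-1) ^ i" for C D
    proof -
      obtain G where "jet (Suc 0) C G" "\<And>x. G 0 (x + 1) = - G 0 x" "G 0 0 = 1"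
        using antiperiodic_interpolant[OF j] by auto
      then show ?thesis by (rule antiperiodic_jet_bound(2)) simp
    qed
    then show "2 \<le> gamma_sharp 2" using gamma_sharp_ge[of 8 1] by (simp add: numeral_2_eq_2)
  qed
  fix m :: nat assume m: "m > 2"
  define n where "n = m - 2"
  have mn: "m = Suc (Suc n)" "0 < n" using m by (auto simp: n_def)
  \<comment> \<open>The left side is \<open>2 * pi * pi ^ n / 2 ^ m\<close>, so the comparison is
    \<open>2 * pi < sqrt 48\<close>.\<close>
  have "ereal ((pi / 2) ^ (m - 1)) < ereal (sqrt 48 * pi ^ n / 2 ^ m)"
  proof -
    have "pi * 2 < sqrt 48" using pi_less_sqrt_12 real_sqrt_mult[of 4 12] by simp
    then have "pi * 2 * pi ^ n / 2 ^ m < sqrt 48 * pi ^ n / 2 ^ m" by (simp add: divide_strict_right_mono)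
    then show ?thesis by (simp add: mn power_divide)
  qed
  also have "ereal (sqrt 48 * pi ^ n / 2 ^ m) \<le> gamma_sharp m"
    unfolding mn(1)
  proof (rule gamma_sharp_ge)
    show "0 < sqrt 48 * pi ^ n" by simp
    fix C D assume "jet (Suc n) C D" "\<And>i::nat. D 0 (real i) = (-1) ^ i"
    then obtain G where G: "jet (Suc n) C G" "\<And>x. G 0 (x + 1) = - G 0 x" "G 0 0 = 1"
      using antiperiodic_interpolant[of "Suc n" C D] by auto
    have "(sqrt 48 * pi ^ n)\<^sup>2 = 48 * pi ^ (2 * n)" by (simp add: power_mult_distrib mult.commute flip: power_mult)
    also have "\<dots> \<le> C\<^sup>2" by (rule antiperiodic_jet_bound(1)[OF G])
    finally show "sqrt 48 * pi ^ n \<le> C" using jet_nonneg[OF G(1)] by (rule power2_le_imp_le)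
  qed
  finally show "ereal ((pi / 2) ^ (m - 1)) < gamma_sharp m" .
  have "gamma_sharp m \<le> ereal (extension_weight (Suc n))"
    unfolding mn(1) by (rule gamma_sharp_le[OF finite_extension_weight])
  also have "\<dots> \<le> ereal (real m / 2 * 9 ^ m)" using extension_weight_le[of "Suc n"] by (simp add: mn)
  \<comment> \<open>\<open>m / 2 < m - 1\<close> holds exactly for \<open>m > 2\<close>.\<close>
  also have "\<dots> < ereal ((real m - 1) * 9 ^ m)" using m by simp
  finally show "gamma_sharp m < ereal ((real m - 1) * 9 ^ m)" .
qed

end
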